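(* Let $K$ be a field of characteristic $0$, $p$ an odd prime, $g$ a primitive root mod $p$, and $E/K$ an elliptic curve for which there is a basis $S,T$ of $E[p]$ with respect to which the image of the mod $p$ Galois representation is the group of all matrices $\begin{pmatrix} 1 & y \\ 0 & x\end{pmatrix}$, $x\in(\mathbb{Z}/p\mathbb{Z})^\times$, $y\in\mathbb{Z}/p\mathbb{Z}$. Let $M=K(T)=K(E[p])$, $L_1=K(\zeta_p)\subset M$, $\sigma,\tau\in\mathrm{Gal}(M/K)$ with $\sigma(S)=S$, $\sigma(T)=S+T$, $\tau(S)=S$, $\tau(T)=gT$, and $L_2$ the fixed field of $\tau$ in $M$. Let $\beta\in L_1^\times$ with $M=L_1(\sqrt[p]{\beta})$. Let $a\in K^\times$, let $\chi_a\in\mathrm{Hom}(G_{L_1},\mathbb{Z}/p\mathbb{Z})$ correspond to the class of $a$ in $L_1^\times/(L_1^\times)^p$ under the Kummer isomorphism, and suppose $\Delta(a)=0$, i.e. the class $(\chi_a,\beta)$ in $\mathrm{Br}(L_1)$ is trivial. Then there exists $\xi\in L_2$ with $N_{L_2/K}(\xi)=a$, and for any such $\xi$, setting $b=\prod_{i=1}^{p-1}\sigma^i(\xi)^{p-i}$, the pair $(a,b)$ lies in $H$, the group of pairs $(a,b)\in K^\times/(K^\times)^p\times M^\times/(M^\times)^p$ with $b^g/\tau(b)\in(M^\times)^p$, $N_{M/L_1}(b)\in(L_1^\times)^p$ and $\sigma(b)/(ab)\in(M^\times)^p$.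
   Context: Fix a primitive $p$th root of unity $\zeta_p\in L_1$; the Kummer isomorphism $\mathrm{Hom}(G_{L_1},\mathbb{Z}/p\mathbb{Z})\cong L_1^\times/(L_1^\times)^p$ uses the identification $\mathbb{Z}/p\mathbb{Z}\cong\mu_p$, $i\mapsto\zeta_p^i$. For a field $F$, $\chi\in\mathrm{Hom}(G_F,\mathbb{Z}/p\mathbb{Z})$ and $c\in F^\times$: if $\chi$ is trivial, $(\chi,c)=0$; otherwise let $L/F$ be the cyclic degree $p$ extension cut out by $\ker\chi$ and $\gamma\in\mathrm{Gal}(L/F)$ the element with $\chi(\gamma)=1$; the cyclic algebra $A(\chi,c)=\{\sum_{i=0}^{p-1}a_iv^i:a_i\in L\}$ has multiplication determined by $v^p=c$ and $vx=\gamma(x)v$ for $x\in L$, and $(\chi,c)$ denotes its class in $\mathrm{Br}(F)$. *)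

theory Defs
  imports
    "HOL-Algebra.Algebra"
    "HOL-Algebra.Algebraic_Closure_Type"
    "HOL-Number_Theory.Residue_Primitive_Roots"
begin

text \<open>
  The ground field \<open>K\<close> is a type \<open>'k\<close>, and all fields occurring are subfields, given as
  sets, of its algebraic closure \<open>'k alg_closure\<close>; \<open>K\<close> itself is the set \<open>range to_ac\<close>.
\<close>

abbreviation subring_of :: "'a::field set \<Rightarrow> 'a ring" where
  "subring_of F \<equiv> ring_of_type_algebra\<lparr>carrier := F\<rparr>"

definition adjoin :: "'a::field set \<Rightarrow> 'a set \<Rightarrow> 'a set" where
  "adjoin F B = generate_field ring_of_type_algebra (F \<union> B)"

text \<open>Functions are extensional, so that each automorphism of \<open>L\<close> is counted once.\<close>

definition gal :: "'a::field set \<Rightarrow> 'a set \<Rightarrow> ('a \<Rightarrow> 'a) set" where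
  "gal L F = {f \<in> extensional L. f \<in> ring_iso (subring_of L) (subring_of L) \<and> (\<forall>x\<in>F. f x = x)}"

abbreviation abs_gal :: "'a::alg_closed_field set \<Rightarrow> ('a \<Rightarrow> 'a) set" where
  "abs_gal F \<equiv> gal UNIV F"

definition embeddings :: "'a::alg_closed_field set \<Rightarrow> 'a set \<Rightarrow> ('a \<Rightarrow> 'a) set" where
  "embeddings L F =
     {f \<in> extensional L. f \<in> ring_hom (subring_of L) (subring_of UNIV) \<and> (\<forall>x\<in>F. f x = x)}"

text \<open>
  The norm of a finite separable extension \<open>L/F\<close>, as the product over all \<open>F\<close>-embeddings of
  \<open>L\<close> into the algebraic closure; \<open>L/F\<close> need not be normal.
\<close>

definition field_norm :: "'a::alg_closed_field set \<Rightarrow> 'a set \<Rightarrow> 'a \<Rightarrow> 'a" where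
  "field_norm L F x = (\<Prod>f\<in>embeddings L F. f x)"

definition pth_powers :: "nat \<Rightarrow> 'a::field set \<Rightarrow> 'a set" where
  "pth_powers p F = (\<lambda>x. x ^ p) ` (F - {0})"

abbreviation unit_group :: "'a::field set \<Rightarrow> 'a monoid" where
  "unit_group F \<equiv> mult_of (subring_of F)"

definition pth_power_class :: "nat \<Rightarrow> 'a::field set \<Rightarrow> 'a \<Rightarrow> 'a set" where
  "pth_power_class p F x = pth_powers p F #>\<^bsub>unit_group F\<^esub> x"

text \<open>
  \<open>y\<^sup>2 + a1 x y + a3 y = x\<^sup>3 + a2 x\<^sup>2 + a4 x + a6\<close>. The datatype map functions serve as base
  change of curves and as the Galois action on points; \<^term>\<open>set_point P\<close> is the set of affine
  coordinates of \<open>P\<close>.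
\<close>

datatype 'a weierstrass =
  Weierstrass (coeff_a1: 'a) (coeff_a2: 'a) (coeff_a3: 'a) (coeff_a4: 'a) (coeff_a6: 'a)

datatype 'a point = Infinity | Affine 'a 'a

fun discriminant :: "'a::field weierstrass \<Rightarrow> 'a" where
  "discriminant (Weierstrass a1 a2 a3 a4 a6) =
    (let b2 = a1^2 + 4 * a2;
         b4 = 2 * a4 + a1 * a3;
         b6 = a3^2 + 4 * a6;
         b8 = a1^2 * a6 + 4 * a2 * a6 - a1 * a3 * a4 + a2 * a3^2 - a4^2
     in - (b2^2) * b8 - 8 * b4^3 - 27 * b6^2 + 9 * b2 * b4 * b6)"

definition elliptic_curve :: "'a::field weierstrass \<Rightarrow> bool" where
  "elliptic_curve E \<longleftrightarrow> discriminant E \<noteq> 0"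

fun on_curve :: "'a::field weierstrass \<Rightarrow> 'a point \<Rightarrow> bool" where
  "on_curve _ Infinity \<longleftrightarrow> True"
| "on_curve (Weierstrass a1 a2 a3 a4 a6) (Affine x y) \<longleftrightarrow>
     y^2 + a1 * x * y + a3 * y = x^3 + a2 * x^2 + a4 * x + a6"

text \<open>
  The line through the two points (the tangent, if they coincide) is \<open>y = l x + n\<close>.
\<close>

fun point_add :: "'a::field weierstrass \<Rightarrow> 'a point \<Rightarrow> 'a point \<Rightarrow> 'a point" where
  "point_add _ Infinity Q = Q"
| "point_add _ P Infinity = P"
| "point_add (Weierstrass a1 a2 a3 a4 a6) (Affine x1 y1) (Affine x2 y2) =
    (if x1 = x2 \<and> y1 + y2 + a1 * x2 + a3 = 0 then Infinity
     else
       let l = (if x1 = x2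
                then (3 * x1^2 + 2 * a2 * x1 + a4 - a1 * y1) / (2 * y1 + a1 * x1 + a3)
                else (y2 - y1) / (x2 - x1));
           n = y1 - l * x1;
           x3 = l^2 + a1 * l - a2 - x1 - x2
       in Affine x3 (- (l + a1) * x3 - n - a3))"

definition point_mult :: "'a::field weierstrass \<Rightarrow> nat \<Rightarrow> 'a point \<Rightarrow> 'a point" where
  "point_mult E n P = (point_add E P ^^ n) Infinity"

definition lin_comb :: "'a::field weierstrass \<Rightarrow> 'a point \<Rightarrow> 'a point \<Rightarrow> nat \<Rightarrow> nat \<Rightarrow> 'a point" where
  "lin_comb E S T i j = point_add E (point_mult E i S) (point_mult E j T)"

abbreviation curve_ac :: "'k::field weierstrass \<Rightarrow> 'k alg_closure weierstrass" where
  "curve_ac E \<equiv> map_weierstrass to_ac E"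

definition torsion :: "'k::field weierstrass \<Rightarrow> nat \<Rightarrow> 'k alg_closure point set" where
  "torsion E n = {P. on_curve (curve_ac E) P \<and> point_mult (curve_ac E) n P = Infinity}"

definition torsion_basis ::
  "'k::field weierstrass \<Rightarrow> nat \<Rightarrow> 'k alg_closure point \<Rightarrow> 'k alg_closure point \<Rightarrow> bool" where
  "torsion_basis E p S T \<longleftrightarrow> S \<in> torsion E p \<and> T \<in> torsion E p \<and>
     bij_betw (\<lambda>(i, j). lin_comb (curve_ac E) S T i j) ({..<p} \<times> {..<p}) (torsion E p)"

definition torsion_field :: "'k::field weierstrass \<Rightarrow> nat \<Rightarrow> 'k alg_closure set" where
  "torsion_field E n = adjoin (range to_ac) (\<Union>P\<in>torsion E n. set_point P)"

text \<open>
  The image of the mod \<open>p\<close> representation in the basis \<open>S, T\<close>. A matrix is given by its rows, with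
  entries in \<open>{0..<p}\<close>; the columns are the coordinates of the images of \<open>S\<close> and \<open>T\<close>.
\<close>

definition galois_image ::
  "'k::field weierstrass \<Rightarrow> nat \<Rightarrow> 'k alg_closure point \<Rightarrow> 'k alg_closure point
     \<Rightarrow> ((nat \<times> nat) \<times> (nat \<times> nat)) set" where
  "galois_image E p S T = {((m11, m12), (m21, m22)) | m11 m12 m21 m22.
     {m11, m12, m21, m22} \<subseteq> {..<p} \<and>
     (\<exists>\<rho>\<in>abs_gal (range to_ac).
        map_point \<rho> S = lin_comb (curve_ac E) S T m11 m21 \<and>
        map_point \<rho> T = lin_comb (curve_ac E) S T m12 m22)}"

text \<open>
  Algebras over a subfield \<open>F\<close> (not necessarily commutative) are records of type
  \<^typ>\<open>('a, 'b) module\<close>, with scalar multiplication by elements of \<open>F\<close>.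
\<close>

definition algebra_iso ::
  "'a set \<Rightarrow> ('a, 'b) module \<Rightarrow> ('a, 'c) module \<Rightarrow> bool" where
  "algebra_iso F A B \<longleftrightarrow> (\<exists>\<phi>\<in>ring_iso A B.
     \<forall>c\<in>F. \<forall>x\<in>carrier A. \<phi> (c \<odot>\<^bsub>A\<^esub> x) = c \<odot>\<^bsub>B\<^esub> \<phi> x)"

definition matrix_algebra :: "nat \<Rightarrow> ('a, 'b) module \<Rightarrow> ('a, nat \<times> nat \<Rightarrow> 'b) module" where
  "matrix_algebra n A = \<lparr>
     carrier = ({..<n} \<times> {..<n}) \<rightarrow>\<^sub>E carrier A,
     monoid.mult = (\<lambda>P Q. \<lambda>(i, j)\<in>{..<n} \<times> {..<n}. finsum A (\<lambda>k. P (i, k) \<otimes>\<^bsub>A\<^esub> Q (k, j)) {..<n}),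
     one = (\<lambda>(i, j)\<in>{..<n} \<times> {..<n}. if i = j then \<one>\<^bsub>A\<^esub> else \<zero>\<^bsub>A\<^esub>),
     ring.zero = (\<lambda>ij\<in>{..<n} \<times> {..<n}. \<zero>\<^bsub>A\<^esub>),
     add = (\<lambda>P Q. \<lambda>ij\<in>{..<n} \<times> {..<n}. P ij \<oplus>\<^bsub>A\<^esub> Q ij),
     module.smult = (\<lambda>c P. \<lambda>ij\<in>{..<n} \<times> {..<n}. c \<odot>\<^bsub>A\<^esub> P ij)\<rparr>"

definition base_algebra :: "'a::field set \<Rightarrow> ('a, 'a) module" where
  "base_algebra F = \<lparr>carrier = F, monoid.mult = (*), one = 1, ring.zero = 0, add = (+), module.smult = (*)\<rparr>"

definition brauer_equivalent ::
  "'a set \<Rightarrow> ('a, 'b) module \<Rightarrow> ('a, 'c) module \<Rightarrow> bool" where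
  "brauer_equivalent F A B \<longleftrightarrow>
     (\<exists>m n. m > 0 \<and> n > 0 \<and> algebra_iso F (matrix_algebra m A) (matrix_algebra n B))"

text \<open>
  Characters \<open>G\<^sub>F \<rightarrow> \<int>/p\<int>\<close> are functions on \<^term>\<open>abs_gal F\<close> with values in \<open>{0..<p}\<close>.
\<close>

definition cut_out_field ::
  "'a::alg_closed_field set \<Rightarrow> (('a \<Rightarrow> 'a) \<Rightarrow> nat) \<Rightarrow> 'a set" where
  "cut_out_field F \<chi> = {x. \<forall>\<rho>\<in>abs_gal F. \<chi> \<rho> = 0 \<longrightarrow> \<rho> x = x}"

definition char_generator ::
  "'a::alg_closed_field set \<Rightarrow> (('a \<Rightarrow> 'a) \<Rightarrow> nat) \<Rightarrow> ('a \<Rightarrow> 'a)" where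
  "char_generator F \<chi> = (THE \<gamma>. \<gamma> \<in> gal (cut_out_field F \<chi>) F \<and>
     (\<exists>\<rho>\<in>abs_gal F. \<chi> \<rho> = 1 \<and> \<gamma> = restrict \<rho> (cut_out_field F \<chi>)))"

text \<open>
  The element \<open>\<Sum>i<p. a\<^sub>i v\<^sup>i\<close> is represented by the family \<open>a\<close>. The product comes from
  \<open>a v\<^sup>i \<cdot> b v\<^sup>j = a \<gamma>\<^sup>i(b) v\<^bsup>i+j\<^esup>\<close> together with \<open>v\<^sup>p = c\<close>.
\<close>

definition cyclic_algebra ::
  "'a::alg_closed_field set \<Rightarrow> nat \<Rightarrow> (('a \<Rightarrow> 'a) \<Rightarrow> nat) \<Rightarrow> 'a \<Rightarrow> ('a, nat \<Rightarrow> 'a) module" where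
  "cyclic_algebra F p \<chi> c = (let L = cut_out_field F \<chi>; \<gamma> = char_generator F \<chi> in \<lparr>
     carrier = {..<p} \<rightarrow>\<^sub>E L,
     monoid.mult = (\<lambda>a b. \<lambda>k\<in>{..<p}. \<Sum>(i, j) | i < p \<and> j < p \<and> (i + j) mod p = k.
       a i * (\<gamma> ^^ i) (b j) * (if i + j < p then 1 else c)),
     one = (\<lambda>k\<in>{..<p}. if k = 0 then 1 else 0),
     ring.zero = (\<lambda>k\<in>{..<p}. 0),
     add = (\<lambda>a b. \<lambda>k\<in>{..<p}. a k + b k),
     module.smult = (\<lambda>x a. \<lambda>k\<in>{..<p}. x * a k)\<rparr>)"

definition symbol_trivial ::
  "'a::alg_closed_field set \<Rightarrow> nat \<Rightarrow> (('a \<Rightarrow> 'a) \<Rightarrow> nat) \<Rightarrow> 'a \<Rightarrow> bool" where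
  "symbol_trivial F p \<chi> c \<longleftrightarrow> (\<forall>\<rho>\<in>abs_gal F. \<chi> \<rho> = 0) \<or>
     brauer_equivalent F (cyclic_algebra F p \<chi> c) (base_algebra F)"

text \<open>
  For \<open>\<rho>\<close> fixing the primitive \<open>p\<close>th root of unity \<open>\<zeta>\<close>, the quotient \<open>\<rho>(\<alpha>)/\<alpha>\<close> does not depend on
  the choice of the \<open>p\<close>th root \<open>\<alpha>\<close> of \<open>a\<close>.
\<close>

definition kummer_char :: "nat \<Rightarrow> 'a::alg_closed_field \<Rightarrow> 'a \<Rightarrow> ('a \<Rightarrow> 'a) \<Rightarrow> nat" where
  "kummer_char p \<zeta> a \<rho> = (THE i. i < p \<and> (\<forall>\<alpha>. \<alpha> ^ p = a \<longrightarrow> \<rho> \<alpha> = \<zeta> ^ i * \<alpha>))"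

text \<open>
  The conditions do not depend on the representatives \<open>a\<close>, \<open>b\<close> of the classes, so quantifying over
  all of them is the same as choosing one.
\<close>

definition pair_group ::
  "'a::alg_closed_field set \<Rightarrow> 'a set \<Rightarrow> 'a set \<Rightarrow> nat \<Rightarrow> nat \<Rightarrow> ('a \<Rightarrow> 'a) \<Rightarrow> ('a \<Rightarrow> 'a)
     \<Rightarrow> ('a set \<times> 'a set) set" where
  "pair_group K L1 M p g \<sigma> \<tau> =
     {(A, B) \<in> carrier (unit_group K Mod pth_powers p K) \<times> carrier (unit_group M Mod pth_powers p M).
        \<forall>a\<in>A. \<forall>b\<in>B.
          b ^ g / \<tau> b \<in> pth_powers p M \<and>
          field_norm M L1 b \<in> pth_powers p L1 \<and>
          \<sigma> b / (a * b) \<in> pth_powers p M}"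

end

theory Submission
  imports Defs
begin

text \<open>
  The action on \<open>S, T\<close> gives \<open>\<sigma>\<tau> = \<tau>\<sigma>\<^sup>g\<close>, with \<open>\<sigma>\<close> of order \<open>p\<close> and \<open>\<tau>\<close> of order \<open>p - 1\<close>. Hence
  \<open>\<sigma>\<close> generates the Galois group of \<open>M/L1\<close>, the embeddings of \<open>L2\<close> over \<open>K\<close> are the restrictions of
  the powers of \<open>\<sigma>\<close>, and the three conditions on \<open>b\<close> follow by reindexing products over the \<open>\<sigma>\<^sup>i \<xi>\<close>.

  For the existence of \<open>\<xi>\<close>, a splitting of (a matrix algebra over) the cyclic algebra \<open>A\<close> yields \<open>r \<noteq> 0\<close>
  in \<open>A\<close> with \<open>r A r \<subseteq> L1 r\<close>. If \<open>\<alpha>\<^sup>p = a\<close>, averaging \<open>r z\<close> over conjugation by the generator \<open>v\<close> shows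
  \<open>\<alpha> r = \<eta>(v) r\<close>, where \<open>v \<mapsto> \<delta>\<close> identifies \<open>L1[v]\<close> with \<open>M\<close>. Iterating this \<open>p\<close> times shows that \<open>a\<close> is
  the norm of \<open>\<eta>(\<delta>) \<in> M\<close>. The norm \<open>\<xi>'\<close> of that element to \<open>L2\<close> has norm \<open>a\<^bsup>p-1\<^esup>\<close> over \<open>K\<close>, so that
  \<open>\<xi> = a/\<xi>'\<close> has norm \<open>a\<close>.
\<close>

subsection \<open>Subfields and their homomorphisms\<close>

text \<open>The averaging step needs a non-zero polynomial in v. If \<open>z\<close> in the cut-out
  field makes one coefficient of r z equal to 1, then the sum of the conjugates v^i (r z) v^(-i), i
  < p, is a polynomial in v over L1 whose coefficient at that place is p. Each r z v^(-i) \<alpha> r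
  is an L1-multiple of r, so the sum sends \<alpha> r into L1[v] r, and \<open>\<eta>\<close> is the
  quotient of two polynomials in \<delta>.

  The cyclic algebra is never shown to be a ring. All products are evaluated on sequences, where
  \<alpha> moves one eigenvector of v to the next; p such moves come full circle and collect the
  factor \<alpha>^p = a.

  The descent to L2 succeeds because p - 1 and p are coprime, and a^p is a norm since a lies in K.

  The curve enters only through generators and relations for the group of M over K. Comparing
  automorphisms by their effect on T means rearranging sums of multiples of S and T, so the group
  law, associativity included, is derived from the addition formulas.\<close>

definition field_set :: "'a::field set \<Rightarrow> bool" where
  "field_set F \<longleftrightarrow> 1 \<in> F \<and> (\<forall>x\<in>F. \<forall>y\<in>F. x - y \<in> F \<and> x * y \<in> F) \<and> (\<forall>x\<in>F. inverse x \<in> F)"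

text \<open>No target is fixed, because all homomorphisms here take values in one ambient field. The
  value at 1 is prescribed since the zero map is also additive and multiplicative.\<close>

definition hom_on :: "'a::field set \<Rightarrow> ('a \<Rightarrow> 'a) \<Rightarrow> bool" where
  "hom_on F f \<longleftrightarrow> f 1 = 1 \<and> (\<forall>x\<in>F. \<forall>y\<in>F. f (x + y) = f x + f y \<and> f (x * y) = f x * f y)"

lemma field_set_UNIV [simp]: "field_set UNIV"
  by (simp add: field_set_def)

context
  fixes F :: "'a::field set"
  assumes F: "field_set F"
begin

lemma field_set_one: "1 \<in> F"
  and field_set_diff: "x \<in> F \<Longrightarrow> y \<in> F \<Longrightarrow> x - y \<in> F"
  and field_set_mult: "x \<in> F \<Longrightarrow> y \<in> F \<Longrightarrow> x * y \<in> F"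
  and field_set_inverse: "x \<in> F \<Longrightarrow> inverse x \<in> F"
  using F by (auto simp: field_set_def)

lemma field_set_zero: "0 \<in> F"
  using field_set_diff[OF field_set_one field_set_one] by simp

lemma field_set_uminus: "x \<in> F \<Longrightarrow> - x \<in> F"
  using field_set_diff[OF field_set_zero] by simp

lemma field_set_add: "x \<in> F \<Longrightarrow> y \<in> F \<Longrightarrow> x + y \<in> F"
  using field_set_diff[OF _ field_set_uminus] by simp

lemma field_set_divide: "x \<in> F \<Longrightarrow> y \<in> F \<Longrightarrow> x / y \<in> F"
  by (simp add: divide_inverse field_set_mult field_set_inverse)

lemma field_set_power: "x \<in> F \<Longrightarrow> x ^ n \<in> F"
  by (induction n) (auto intro: field_set_one field_set_mult)

lemma field_set_sum: "(\<And>i. i \<in> I \<Longrightarrow> f i \<in> F) \<Longrightarrow> sum f I \<in> F"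
  by (induction I rule: infinite_finite_induct) (auto intro: field_set_zero field_set_add)

lemma field_set_prod: "(\<And>i. i \<in> I \<Longrightarrow> f i \<in> F) \<Longrightarrow> prod f I \<in> F"
  by (induction I rule: infinite_finite_induct) (auto intro: field_set_one field_set_mult)

lemma field_set_of_nat: "of_nat n \<in> F"
  by (induction n) (auto intro: field_set_zero field_set_one field_set_add)

lemmas field_set_intros = field_set_zero field_set_one field_set_add field_set_diff field_set_uminus
  field_set_mult field_set_inverse field_set_divide field_set_power field_set_sum field_set_prod
  field_set_of_nat

context
  fixes f :: "'a \<Rightarrow> 'a"
  assumes f: "hom_on F f"
begin

lemma hom_on_one: "f 1 = 1"
  and hom_on_add: "x \<in> F \<Longrightarrow> y \<in> F \<Longrightarrow> f (x + y) = f x + f y"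
  and hom_on_mult: "x \<in> F \<Longrightarrow> y \<in> F \<Longrightarrow> f (x * y) = f x * f y"
  using f by (auto simp: hom_on_def)

lemma hom_on_zero: "f 0 = 0"
  using hom_on_add[OF field_set_zero field_set_zero] by (metis add_0 add_cancel_right_left)

lemma hom_on_uminus: "x \<in> F \<Longrightarrow> f (- x) = - f x"
  using hom_on_add[of x "- x"] by (simp add: hom_on_zero field_set_uminus eq_neg_iff_add_eq_0 add.commute)

lemma hom_on_diff: "x \<in> F \<Longrightarrow> y \<in> F \<Longrightarrow> f (x - y) = f x - f y"
  using hom_on_add[of x "- y"] by (simp add: hom_on_uminus field_set_uminus)

lemma hom_on_inverse: "x \<in> F \<Longrightarrow> f (inverse x) = inverse (f x)"
  using hom_on_mult[of x "inverse x"]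
  by (cases "x = 0") (auto simp: hom_on_zero hom_on_one field_set_inverse intro: inverse_unique[symmetric])

lemma hom_on_divide: "x \<in> F \<Longrightarrow> y \<in> F \<Longrightarrow> f (x / y) = f x / f y"
  by (simp add: divide_inverse hom_on_mult hom_on_inverse field_set_inverse)

lemma hom_on_power: "x \<in> F \<Longrightarrow> f (x ^ n) = f x ^ n"
  by (induction n) (auto simp: hom_on_one hom_on_mult field_set_power)

lemma hom_on_sum: "(\<And>i. i \<in> I \<Longrightarrow> h i \<in> F) \<Longrightarrow> f (sum h I) = (\<Sum>i\<in>I. f (h i))"
  by (induction I rule: infinite_finite_induct) (auto simp: hom_on_zero hom_on_add field_set_sum)

lemma hom_on_prod: "(\<And>i. i \<in> I \<Longrightarrow> h i \<in> F) \<Longrightarrow> f (prod h I) = (\<Prod>i\<in>I. f (h i))"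
  by (induction I rule: infinite_finite_induct) (auto simp: hom_on_one hom_on_mult field_set_prod)

lemma hom_on_eq_0_iff: "x \<in> F \<Longrightarrow> f x = 0 \<longleftrightarrow> x = 0"
  using hom_on_mult[of x "inverse x"] field_set_inverse[of x]
  by (cases "x = 0") (auto simp: hom_on_zero hom_on_one)

lemma hom_on_inj: "inj_on f F"
  using hom_on_eq_0_iff[OF field_set_diff] by (intro inj_onI) (auto simp: hom_on_diff)

lemmas hom_on_simps = hom_on_one hom_on_zero hom_on_add hom_on_mult hom_on_uminus hom_on_diff
  hom_on_inverse hom_on_divide hom_on_power hom_on_sum hom_on_prod

end

end

lemma field_set_equalizer:
  assumes "field_set F" "hom_on F f" "hom_on F h"
  shows "field_set {x \<in> F. f x = h x}"
  using assms unfolding field_set_def[of "{x \<in> F. f x = h x}"]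
  by (auto simp: hom_on_simps field_set_intros)

lemma field_set_vimage:
  assumes "field_set F" "hom_on F f" "field_set G"
  shows "field_set {x \<in> F. f x \<in> G}"
  using assms unfolding field_set_def[of "{x \<in> F. f x \<in> G}"]
  by (auto simp: hom_on_simps field_set_intros)

lemma hom_on_id: "hom_on F (\<lambda>x. x)"
  by (simp add: hom_on_def)

lemma hom_on_subset: "hom_on F f \<Longrightarrow> G \<subseteq> F \<Longrightarrow> hom_on G f"
  by (auto simp: hom_on_def)

lemma hom_on_compose: "hom_on F f \<Longrightarrow> hom_on G h \<Longrightarrow> f ` F \<subseteq> G \<Longrightarrow> hom_on F (\<lambda>x. h (f x))"
  by (auto simp: hom_on_def image_subset_iff)

lemma hom_on_cong:
  assumes "field_set F" "\<And>x. x \<in> F \<Longrightarrow> f x = h x"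
  shows "hom_on F f \<longleftrightarrow> hom_on F h"
  using assms unfolding hom_on_def by (simp add: field_set_intros)

lemma funpow_closed: "f ` M \<subseteq> M \<Longrightarrow> x \<in> M \<Longrightarrow> (f ^^ n) x \<in> M"
  by (induction n) auto

lemma funpow_cong_on:
  assumes "h ` M \<subseteq> M" "\<And>x. x \<in> M \<Longrightarrow> f x = h x" "x \<in> M"
  shows "(f ^^ n) x = (h ^^ n) x"
  by (induction n) (use assms funpow_closed[OF assms(1,3)] in auto)

lemma funpow_fixed: "f x = x \<Longrightarrow> (f ^^ n) x = x"
  by (induction n) auto

lemma hom_on_funpow: "hom_on M f \<Longrightarrow> f ` M \<subseteq> M \<Longrightarrow> hom_on M (f ^^ n)"
proof (induction n)
  case (Suc n)
  then show ?case
    using hom_on_compose[of M "f ^^ n" M f] funpow_closed[OF Suc.prems(2)] by (auto simp: o_def image_subset_iff)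
qed (simp add: hom_on_def)

lemma funpow_eigenvector:
  assumes "field_set M" "hom_on M f" "x \<in> M" "c \<in> M" "f c = c" "f x = c * x"
  shows "(f ^^ n) x = c ^ n * x"
  by (induction n) (use assms in \<open>simp_all add: hom_on_simps[of M f] field_set_intros mult_ac\<close>)

section \<open>Galois groups, embeddings and generated fields in terms of sets\<close>

lemma subring_of_simps [simp]:
  "carrier (subring_of F) = F" "monoid.mult (subring_of F) = (*)" "one (subring_of F) = 1"
  "ring.zero (subring_of F) = 0" "add (subring_of F) = (+)"
  by (simp_all add: ring_of_type_algebra_def)

lemma ring_hom_subring_of_iff:
  "f \<in> ring_hom (subring_of F) (subring_of G) \<longleftrightarrow> hom_on F f \<and> f ` F \<subseteq> G"
  by (auto simp: ring_hom_def hom_on_def)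

lemma gal_iff:
  "f \<in> gal L F \<longleftrightarrow> f \<in> extensional L \<and> hom_on L f \<and> bij_betw f L L \<and> (\<forall>x\<in>F. f x = x)"
  unfolding gal_def ring_iso_def mem_Collect_eq ring_hom_subring_of_iff subring_of_simps
  by (auto simp: bij_betw_def)

lemma embeddings_iff:
  "f \<in> embeddings L F \<longleftrightarrow> f \<in> extensional L \<and> hom_on L f \<and> (\<forall>x\<in>F. f x = x)"
  unfolding embeddings_def mem_Collect_eq ring_hom_subring_of_iff by auto

lemma ring_of_type_algebra_a_inv: "a_inv ring_of_type_algebra x = - (x :: 'a::field)"
proof -
  interpret field "ring_of_type_algebra :: 'a ring" by (rule field_from_type_algebra)
  show ?thesis
    by (rule minus_equality) (simp_all add: ring_of_type_algebra_def)
qed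

lemma ring_of_type_algebra_m_inv:
  assumes "x \<noteq> 0"
  shows "m_inv ring_of_type_algebra x = inverse (x :: 'a::field)"
proof -
  interpret field "ring_of_type_algebra :: 'a ring" by (rule field_from_type_algebra)
  show ?thesis
    using assms by (intro inv_unique'[symmetric]) (simp_all add: ring_of_type_algebra_def)
qed

lemma field_set_adjoin: "field_set (adjoin F B)"
proof -
  have minus: "- y \<in> adjoin F B" if "y \<in> adjoin F B" for y
    using generate_field.a_inv[of y ring_of_type_algebra "F \<union> B"] that
    by (simp add: adjoin_def ring_of_type_algebra_a_inv)
  have add: "x + y \<in> adjoin F B" if "x \<in> adjoin F B" "y \<in> adjoin F B" for x y
    using generate_field.eng_add[of x ring_of_type_algebra "F \<union> B" y] that
    by (simp add: adjoin_def ring_of_type_algebra_def)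
  have zero: "0 \<in> adjoin F B"
    using add[OF _ minus, of 1 1] generate_field.one[of ring_of_type_algebra "F \<union> B"]
    by (simp add: adjoin_def ring_of_type_algebra_def)
  \<comment> \<open>\<open>generate_field\<close> inverts non-zero elements only; at 0 the
    convention inverse 0 = 0 and membership of 0 are used.\<close>
  have "inverse y \<in> adjoin F B" if "y \<in> adjoin F B" for y
    using generate_field.m_inv[of y ring_of_type_algebra "F \<union> B"] that zero
    by (cases "y = 0") (auto simp: adjoin_def ring_of_type_algebra_m_inv, simp add: ring_of_type_algebra_def)
  moreover have "x * y \<in> adjoin F B" if "x \<in> adjoin F B" "y \<in> adjoin F B" for x y
    using generate_field.eng_mult[of x ring_of_type_algebra "F \<union> B" y] that
    by (simp add: adjoin_def ring_of_type_algebra_def)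
  moreover have "1 \<in> adjoin F B"
    using generate_field.one[of ring_of_type_algebra "F \<union> B"]
    by (simp add: adjoin_def ring_of_type_algebra_def)
  moreover have "x - y \<in> adjoin F B" if "x \<in> adjoin F B" "y \<in> adjoin F B" for x y
    using add[OF that(1) minus[OF that(2)]] by simp
  ultimately show ?thesis
    by (simp add: field_set_def)
qed

lemma adjoin_superset: "F \<subseteq> adjoin F B" "B \<subseteq> adjoin F B"
  by (auto simp: adjoin_def intro: generate_field.incl)

lemma adjoin_subset:
  assumes "field_set G" "F \<subseteq> G" "B \<subseteq> G"
  shows "adjoin F B \<subseteq> G"
proof
  fix x assume "x \<in> adjoin F B"
  then have "x \<in> generate_field ring_of_type_algebra (F \<union> B)"
    by (simp add: adjoin_def)
  then show "x \<in> G"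
  proof induction
    case (m_inv h)
    then have "h \<noteq> 0"
      by (simp add: ring_of_type_algebra_def)
    with m_inv show ?case
      using field_set_inverse[OF assms(1)] by (simp add: ring_of_type_algebra_m_inv)
  next
    case (a_inv h)
    then show ?case
      using field_set_uminus[OF assms(1)] by (simp add: ring_of_type_algebra_a_inv)
  qed (use assms in \<open>auto simp: ring_of_type_algebra_def intro: field_set_intros\<close>)
qed

text \<open>The equalizer of two homomorphisms is a field, so it contains everything generated by
  the elements on which they agree.\<close>

lemma hom_on_eq_adjoin:
  assumes "field_set M" "hom_on M f" "hom_on M h" "adjoin F B \<subseteq> M"
    and "\<And>x. x \<in> F \<union> B \<Longrightarrow> f x = h x" and "x \<in> adjoin F B"
  shows "f x = h x"
proof -
  have "adjoin F B \<subseteq> {x \<in> M. f x = h x}"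
    using assms adjoin_superset[of F B] adjoin_superset[of B F]
    by (intro adjoin_subset field_set_equalizer) auto
  with assms(6) show ?thesis by auto
qed

subsection \<open>Extension of homomorphisms\<close>

definition poly_over :: "'a::field set \<Rightarrow> 'a poly set" where
  "poly_over F = {q. \<forall>i. Polynomial.coeff q i \<in> F}"

definition algebraic_over :: "'a::field set \<Rightarrow> bool" where
  "algebraic_over F \<longleftrightarrow> (\<forall>x. \<exists>q\<in>poly_over F. q \<noteq> 0 \<and> poly q x = 0)"

lemma poly_over_mono: "F \<subseteq> G \<Longrightarrow> poly_over F \<subseteq> poly_over G"
  by (auto simp: poly_over_def)

lemma algebraic_over_mono: "algebraic_over F \<Longrightarrow> F \<subseteq> G \<Longrightarrow> algebraic_over G"
  unfolding algebraic_over_def using poly_over_mono by blast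

section \<open>Polynomials with coefficients in a subfield\<close>

context
  fixes F :: "'a::field set"
  assumes F: "field_set F"
begin

lemma poly_over_0: "0 \<in> poly_over F"
  and poly_over_pCons_iff: "pCons c q \<in> poly_over F \<longleftrightarrow> c \<in> F \<and> q \<in> poly_over F"
  and poly_over_add: "q \<in> poly_over F \<Longrightarrow> r \<in> poly_over F \<Longrightarrow> q + r \<in> poly_over F"
  and poly_over_diff: "q \<in> poly_over F \<Longrightarrow> r \<in> poly_over F \<Longrightarrow> q - r \<in> poly_over F"
  and poly_over_mult: "q \<in> poly_over F \<Longrightarrow> r \<in> poly_over F \<Longrightarrow> q * r \<in> poly_over F"
  and poly_over_monom: "c \<in> F \<Longrightarrow> Polynomial.monom c n \<in> poly_over F"
  using F by (auto simp: poly_over_def coeff_pCons coeff_mult field_set_intros split: nat.splits)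

lemma poly_over_pderiv: "q \<in> poly_over F \<Longrightarrow> pderiv q \<in> poly_over F"
  unfolding poly_over_def by (auto simp: coeff_pderiv intro!: field_set_intros[OF F] simp del: of_nat_Suc)

text \<open>\<open>R\<close> is only a set closed under sums and products, since one application is
  to the ring F[x] before it is known to be a field.\<close>

lemma poly_over_eval:
  assumes "q \<in> poly_over F" "0 \<in> R" "F \<subseteq> R" "x \<in> R" "\<And>u v. u \<in> R \<Longrightarrow> v \<in> R \<Longrightarrow> u + v \<in> R \<and> u * v \<in> R"
  shows "poly q x \<in> R"
  using assms(1) by (induction q) (use assms in \<open>auto simp: poly_over_pCons_iff\<close>)

text \<open>Long division carried out inside \<open>poly_over F\<close>, so that the quotient has
  its coefficients in \<open>F\<close>: subtracting a monomial multiple of \<open>m\<close> cancels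
  the leading term of \<open>q\<close>, and minimality keeps the monomial's exponent
  non-negative.\<close>

lemma minimal_polynomial_dvd:
  assumes m: "m \<in> poly_over F" "m \<noteq> 0" "poly m x = 0"
    and min: "\<And>q. q \<in> poly_over F \<Longrightarrow> q \<noteq> 0 \<Longrightarrow> poly q x = 0 \<Longrightarrow> Polynomial.degree m \<le> Polynomial.degree q"
    and q: "q \<in> poly_over F" "poly q x = 0"
  shows "\<exists>s\<in>poly_over F. q = s * m"
  using q
proof (induction "Polynomial.degree q" arbitrary: q rule: less_induct)
  case less
  show ?case
  proof (cases "q = 0")
    case True
    then show ?thesis
      using poly_over_0 by (intro bexI[of _ 0]) auto
  next
    case False
    define c where "c = Polynomial.lead_coeff q / Polynomial.lead_coeff m"
    define r where "r = Polynomial.monom c (Polynomial.degree q - Polynomial.degree m)"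
    have c: "c \<in> F" "c \<noteq> 0"
      using m less.prems False field_set_divide[OF F] by (auto simp: c_def poly_over_def)
    then have r: "r \<in> poly_over F" "r \<noteq> 0"
      unfolding r_def by (auto intro: poly_over_monom)
    have degr: "Polynomial.degree r = Polynomial.degree q - Polynomial.degree m"
      unfolding r_def by (rule degree_monom_eq[OF c(2)])
    have leadr: "Polynomial.lead_coeff r = c"
      unfolding degr by (simp add: r_def)
    have deg: "Polynomial.degree (r * m) = Polynomial.degree q"
      unfolding degree_mult_eq[OF r(2) m(2)] degr using min[OF less.prems(1) False less.prems(2)] by simp
    have lead: "Polynomial.lead_coeff (r * m) = Polynomial.lead_coeff q"
      using m(2) unfolding Polynomial.lead_coeff_mult leadr by (simp add: c_def)
    have "q - r * m \<in> poly_over F" "poly (q - r * m) x = 0"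
      using less.prems r m by (auto intro: poly_over_diff poly_over_mult)
    moreover have "q - r * m = 0 \<or> Polynomial.degree (q - r * m) < Polynomial.degree q"
      using deg lead by (metis (no_types, lifting) Polynomial.coeff_diff cancel_comm_monoid_add_class.diff_cancel
        degree_diff_le_max le_neq_implies_less leading_coeff_0_iff max.idem)
    ultimately obtain s where "s \<in> poly_over F" "q - r * m = s * m"
      using less.hyps[of "q - r * m"] poly_over_0 by (metis mult_zero_left)
    then show ?thesis
      using r poly_over_add by (intro bexI[of _ "s + r"]) (auto simp: algebra_simps)
  qed
qed

lemma minimal_polynomial:
  assumes "algebraic_over F"
  obtains m where "m \<in> poly_over F" "m \<noteq> 0" "poly m x = 0"
    "\<And>q. q \<in> poly_over F \<Longrightarrow> q \<noteq> 0 \<Longrightarrow> poly q x = 0 \<Longrightarrow> Polynomial.degree m \<le> Polynomial.degree q"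
    "\<forall>q\<in>poly_over F. poly q x = 0 \<longrightarrow> (\<exists>s\<in>poly_over F. q = s * m)"
proof -
  define P where "P q \<longleftrightarrow> q \<in> poly_over F \<and> q \<noteq> 0 \<and> poly q x = 0" for q
  obtain q where "P q"
    using assms unfolding algebraic_over_def P_def by blast
  then obtain m where m: "P m" and min: "\<And>q. P q \<Longrightarrow> Polynomial.degree m \<le> Polynomial.degree q"
    using ex_has_least_nat[of P q Polynomial.degree] by blast
  then have "\<exists>s\<in>poly_over F. q = s * m" if "q \<in> poly_over F" "poly q x = 0" for q
    using minimal_polynomial_dvd[of m x q] that unfolding P_def by blast
  with m min that show ?thesis
    unfolding P_def by blast
qed

context
  fixes f :: "'a \<Rightarrow> 'a"
  assumes f: "hom_on F f"
begin

lemma map_poly_hom_add: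
  "q \<in> poly_over F \<Longrightarrow> r \<in> poly_over F \<Longrightarrow> map_poly f (q + r) = map_poly f q + map_poly f r"
  by (rule poly_eqI) (simp add: coeff_map_poly hom_on_simps[OF F f] poly_over_def)

lemma map_poly_hom_diff:
  "q \<in> poly_over F \<Longrightarrow> r \<in> poly_over F \<Longrightarrow> map_poly f (q - r) = map_poly f q - map_poly f r"
  by (rule poly_eqI) (simp add: coeff_map_poly hom_on_simps[OF F f] poly_over_def)

lemma map_poly_hom_mult:
  "q \<in> poly_over F \<Longrightarrow> r \<in> poly_over F \<Longrightarrow> map_poly f (q * r) = map_poly f q * map_poly f r"
  by (rule poly_eqI)
    (simp add: coeff_map_poly coeff_mult hom_on_simps[OF F f] field_set_intros[OF F] poly_over_def)

lemma poly_map_poly_hom: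
  assumes "q \<in> poly_over F" "x \<in> F"
  shows "poly (map_poly f q) (f x) = f (poly q x)"
  using assms(1)
proof (induction q)
  case (pCons c q)
  then have "c \<in> F" "q \<in> poly_over F"
    by (auto simp: poly_over_pCons_iff)
  moreover have "poly q x \<in> F"
    using poly_over_eval[OF \<open>q \<in> poly_over F\<close>, of F x] assms(2) F by (simp add: field_set_intros)
  ultimately show ?case
    using pCons.IH assms(2) F by (simp add: map_poly_pCons hom_on_simps[OF F f] field_set_intros)
qed (simp add: hom_on_zero[OF F f])

text \<open>For algebraic x the ring F[x] is already a field, and q(x) goes to the value at x' of
  the image of q. Two polynomials with the same value at x differ by a multiple of \<open>m\<close>,
  whose image vanishes at x', so this is well defined.\<close>

lemma extend_hom_simple:
  assumes alg: "algebraic_over F"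
    and m: "m \<in> poly_over F" "\<forall>q\<in>poly_over F. poly q x = 0 \<longrightarrow> (\<exists>s\<in>poly_over F. q = s * m)"
    and x': "poly (map_poly f m) x' = 0"
  obtains G h where "field_set G" "F \<subseteq> G" "x \<in> G" "hom_on G h" "\<And>y. y \<in> F \<Longrightarrow> h y = f y" "h x = x'"
proof -
  define G where "G = (\<lambda>q. poly q x) ` poly_over F"
  \<comment> \<open>The choice picks some polynomial representing \<open>y\<close>; the fact
    \<open>h\<close> below shows that any other one gives the same value.\<close>
  define h where "h y = poly (map_poly f (SOME q. q \<in> poly_over F \<and> poly q x = y)) x'" for y
  have h: "h (poly q x) = poly (map_poly f q) x'" if q: "q \<in> poly_over F" for q
  proof -
    define r where "r = (SOME r. r \<in> poly_over F \<and> poly r x = poly q x)"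
    have r: "r \<in> poly_over F" "poly r x = poly q x"
      using someI[of "\<lambda>r. r \<in> poly_over F \<and> poly r x = poly q x" q] that unfolding r_def by auto
    then obtain s where "s \<in> poly_over F" "r - q = s * m"
      using m(2) poly_over_diff[OF r(1) q] by (metis poly_diff cancel_comm_monoid_add_class.diff_cancel)
    then have "map_poly f r - map_poly f q = map_poly f s * map_poly f m"
      using map_poly_hom_diff[OF r(1) that] map_poly_hom_mult[of s m] m(1) by simp
    then have "poly (map_poly f r) x' - poly (map_poly f q) x' = 0"
      by (metis poly_diff poly_mult x' mult_zero_right)
    then show ?thesis
      by (simp add: h_def r_def)
  qed
  have const: "[:c:] \<in> poly_over F" if "c \<in> F" for c
    using that by (simp add: poly_over_pCons_iff poly_over_0)
  have FG: "F \<subseteq> G"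
  proof
    fix c assume "c \<in> F"
    then show "c \<in> G"
      unfolding G_def using const by (intro image_eqI[of _ _ "[:c:]"]) auto
  qed
  have ring: "u + v \<in> G \<and> u * v \<in> G" if "u \<in> G" "v \<in> G" for u v
  proof -
    from that obtain q r where "q \<in> poly_over F" "r \<in> poly_over F" "u = poly q x" "v = poly r x"
      by (auto simp: G_def)
    then show ?thesis
      using image_eqI[of "u + v" "\<lambda>q. poly q x" "q + r"] image_eqI[of "u * v" "\<lambda>q. poly q x" "q * r"]
        poly_over_add poly_over_mult unfolding G_def by simp
  qed
  have minus: "u - v \<in> G" if "u \<in> G" "v \<in> G" for u v
  proof -
    from that obtain q r where "q \<in> poly_over F" "r \<in> poly_over F" "u = poly q x" "v = poly r x"
      by (auto simp: G_def)
    then show ?thesis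
      using poly_over_diff unfolding G_def by (auto intro!: image_eqI[of _ _ "q - r"])
  qed
  have inv: "inverse y \<in> G" if "y \<in> G" for y
  proof (cases "y = 0")
    case False
    obtain r where r: "r \<in> poly_over F" "r \<noteq> 0" "poly r y = 0"
      "\<And>q. q \<in> poly_over F \<Longrightarrow> q \<noteq> 0 \<Longrightarrow> poly q y = 0 \<Longrightarrow> Polynomial.degree r \<le> Polynomial.degree q"
      using minimal_polynomial[OF alg, of y] by metis
    obtain c r' where cr: "r = pCons c r'"
      by (cases r)
    have c: "c \<in> F" "r' \<in> poly_over F"
      using r(1) unfolding cr poly_over_pCons_iff by auto
    have eq: "c + y * poly r' y = 0"
      using r(3) cr by simp
    \<comment> \<open>With zero constant term, \<open>r'\<close> would be a polynomial of smaller
      degree vanishing at \<open>y\<close>. Once c is non-zero, c + y r'(y) = 0 exhibits the inverse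
      of \<open>y\<close> as a polynomial expression.\<close>
    have "c \<noteq> 0"
    proof
      assume "c = 0"
      then have "r' \<noteq> 0" "poly r' y = 0"
        using eq False r(2) cr by auto
      then show False
        using r(4)[of r'] c(2) unfolding cr by simp
    qed
    then have "inverse y = (- inverse c) * poly r' y"
      using eq False by (simp add: field_simps eq_neg_iff_add_eq_0)
    moreover have "poly r' y \<in> G"
      using poly_over_eval[OF c(2), of G y] ring FG field_set_zero[OF F] that by blast
    ultimately show ?thesis
      using ring FG field_set_uminus[OF F] field_set_inverse[OF F] c(1) by (metis subsetD)
  qed (use that in simp)
  have G: "field_set G"
    using FG field_set_one[OF F] ring minus inv by (auto simp: field_set_def)
  have "hom_on G h"
    unfolding hom_on_def
  proof (intro conjI ballI)
    show "h 1 = 1"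
      using h[OF const[OF field_set_one[OF F]]] by (simp add: hom_on_one[OF F f] map_poly_pCons hom_on_zero[OF F f])
  next
    fix u v assume "u \<in> G" "v \<in> G"
    then obtain q r where q: "q \<in> poly_over F" "r \<in> poly_over F" "u = poly q x" "v = poly r x"
      by (auto simp: G_def)
    show "h (u + v) = h u + h v"
      using h[OF poly_over_add[OF q(1,2)]] h q map_poly_hom_add by simp
    show "h (u * v) = h u * h v"
      using h[OF poly_over_mult[OF q(1,2)]] h q map_poly_hom_mult by simp
  qed
  moreover have "h y = f y" if "y \<in> F" for y
    using h[OF const[OF that]] by (simp add: map_poly_pCons hom_on_zero[OF F f])
  moreover have var: "[:0, 1:] \<in> poly_over F"
    using F by (simp add: poly_over_pCons_iff poly_over_0 field_set_zero field_set_one)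
  moreover have "x \<in> G"
    unfolding G_def using var by (intro image_eqI[of _ _ "[:0, 1:]"]) auto
  moreover have "h x = x'"
    using h[OF var] by (simp add: map_poly_pCons hom_on_zero[OF F f] hom_on_one[OF F f])
  ultimately show ?thesis
    using G FG that by blast
qed

end

end

text \<open>Graphs of homomorphisms defined on subfields. As relations they are ordered by
  inclusion, and unions of chains are immediate, which suits Zorn's lemma. The last clause forces
  single-valuedness, applied to differences of pairs.\<close>

definition hom_graph :: "('a::field \<times> 'a) set \<Rightarrow> bool" where
  "hom_graph g \<longleftrightarrow> (1, 1) \<in> g \<and>
     (\<forall>x y x' y'. (x, y) \<in> g \<longrightarrow> (x', y') \<in> g \<longrightarrow> (x - x', y - y') \<in> g \<and> (x * x', y * y') \<in> g) \<and>
     (\<forall>x y. (x, y) \<in> g \<longrightarrow> (inverse x, inverse y) \<in> g) \<and> (\<forall>y. (0, y) \<in> g \<longrightarrow> y = 0)"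

lemma hom_graphI:
  assumes "field_set F" "hom_on F f"
  shows "hom_graph ((\<lambda>x. (x, f x)) ` F)"
  using assms unfolding hom_graph_def
  by (auto simp: image_iff hom_on_simps field_set_intros)

lemma hom_graphE:
  assumes "hom_graph g"
  obtains F f where "field_set F" "hom_on F f" "g = (\<lambda>x. (x, f x)) ` F"
proof -
  have one: "(1, 1) \<in> g" and diff: "\<And>x y x' y'. (x, y) \<in> g \<Longrightarrow> (x', y') \<in> g \<Longrightarrow> (x - x', y - y') \<in> g"
    and mult: "\<And>x y x' y'. (x, y) \<in> g \<Longrightarrow> (x', y') \<in> g \<Longrightarrow> (x * x', y * y') \<in> g"
    and inv: "\<And>x y. (x, y) \<in> g \<Longrightarrow> (inverse x, inverse y) \<in> g" and zero: "\<And>y. (0, y) \<in> g \<Longrightarrow> y = 0"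
    using assms by (auto simp: hom_graph_def)
  have add: "(x + x', y + y') \<in> g" if "(x, y) \<in> g" "(x', y') \<in> g" for x y x' y'
    using diff[OF that(1) diff[OF diff[OF one one] that(2)]] by simp
  have unique: "y = y'" if "(x, y) \<in> g" "(x, y') \<in> g" for x y y'
    using zero[of "y - y'"] diff[OF that] by simp
  define f where "f x = (THE y. (x, y) \<in> g)" for x
  have f: "f x = y" if "(x, y) \<in> g" for x y
    unfolding f_def using that unique by blast
  have "field_set (Domain g)"
    unfolding field_set_def using one diff mult inv by blast
  moreover have "hom_on (Domain g) f"
    unfolding hom_on_def
  proof (intro conjI ballI)
    fix x x' assume "x \<in> Domain g" "x' \<in> Domain g"
    then have "(x, f x) \<in> g" "(x', f x') \<in> g"
      using f by blast+
    then show "f (x + x') = f x + f x'" "f (x * x') = f x * f x'"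
      using f add mult by blast+
  qed (fact f[OF one])
  moreover have "g = (\<lambda>x. (x, f x)) ` Domain g"
    using f by (auto simp: image_iff Domain_iff)
  ultimately show ?thesis
    using that by blast
qed

text \<open>A maximal graph containing that of \<open>f\<close> has full domain: for any x, the
  image of its minimal polynomial has a root in the algebraically closed field, and sending x to
  that root extends the map.\<close>

lemma extend_hom:
  fixes F :: "'a::alg_closed_field set"
  assumes "field_set F" "hom_on F f" "algebraic_over F"
  obtains h where "hom_on UNIV h" "\<forall>x\<in>F. h x = f x"
proof -
  define A where "A = {g. hom_graph g \<and> (\<lambda>x. (x, f x)) ` F \<subseteq> g}"
  have "\<exists>M\<in>A. \<forall>Y\<in>A. M \<subseteq> Y \<longrightarrow> Y = M"
  proof (rule subset_Zorn_nonempty)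
    show "A \<noteq> {}"
      using hom_graphI[OF assms(1,2)] by (auto simp: A_def)
  next
    fix C assume C: "C \<noteq> {}" "subset.chain A C"
    then have graph: "hom_graph g" and sub: "(\<lambda>x. (x, f x)) ` F \<subseteq> g" if "g \<in> C" for g
      using that by (auto simp: subset.chain_def A_def)
    have "hom_graph (\<Union>C)"
      unfolding hom_graph_def
    proof (intro conjI allI impI)
      show "(1, 1) \<in> \<Union>C"
        using C(1) graph by (auto simp: hom_graph_def)
    next
      fix x y x' y' assume "(x, y) \<in> \<Union>C" "(x', y') \<in> \<Union>C"
      then obtain g where "g \<in> C" "(x, y) \<in> g" "(x', y') \<in> g"
        using C(2) by (auto simp: subset.chain_def) blast
      then show "(x - x', y - y') \<in> \<Union>C" "(x * x', y * y') \<in> \<Union>C"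
        using graph[of g] unfolding hom_graph_def by blast+
    next
      fix x y assume "(x, y) \<in> \<Union>C"
      then show "(inverse x, inverse y) \<in> \<Union>C"
        using graph by (auto simp: hom_graph_def)
    next
      fix y assume "(0, y) \<in> \<Union>C"
      then show "y = 0"
        using graph by (auto simp: hom_graph_def)
    qed
    then show "\<Union>C \<in> A"
      using C(1) sub by (auto simp: A_def)
  qed
  then obtain M where M: "M \<in> A" and max: "\<And>Y. Y \<in> A \<Longrightarrow> M \<subseteq> Y \<Longrightarrow> Y = M"
    by blast
  then obtain G k where G: "field_set G" "hom_on G k" "M = (\<lambda>x. (x, k x)) ` G"
    using hom_graphE[of M] unfolding A_def by blast
  have FG: "x \<in> G \<and> k x = f x" if "x \<in> F" for x
    using M that unfolding A_def G(3) by auto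
  have alg: "algebraic_over G"
    using algebraic_over_mono[OF assms(3)] FG by blast
  have "x \<in> G" for x
  proof -
    obtain m where m: "m \<in> poly_over G" "m \<noteq> 0" "poly m x = 0"
      "\<forall>q\<in>poly_over G. poly q x = 0 \<longrightarrow> (\<exists>s\<in>poly_over G. q = s * m)"
      using minimal_polynomial[OF G(1) alg, of x] by metis
    \<comment> \<open>A field homomorphism is injective, so the leading coefficient survives and the
      image of \<open>m\<close> is still non-constant.\<close>
    have "Polynomial.lead_coeff m \<in> G"
      using m(1) by (simp add: poly_over_def)
    then have "Polynomial.coeff (map_poly k m) (Polynomial.degree m) \<noteq> 0"
      using m(2) hom_on_eq_0_iff[OF G(1,2)] by (simp add: coeff_map_poly hom_on_zero[OF G(1,2)])
    then have "Polynomial.degree m \<le> Polynomial.degree (map_poly k m)"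
      by (rule le_degree)
    moreover have "Polynomial.degree m > 0"
      using m(2,3) by (metis degree_eq_zeroE gr0I pCons_0_0 poly_const_conv)
    ultimately obtain x' where "poly (map_poly k m) x' = 0"
      using alg_closed_imp_poly_has_root[of "map_poly k m"] by auto
    then obtain G' h where G': "field_set G'" "G \<subseteq> G'" "x \<in> G'" "hom_on G' h" "\<And>y. y \<in> G \<Longrightarrow> h y = k y"
      using extend_hom_simple[OF G(1,2) alg m(1,4)] by metis
    have sub: "M \<subseteq> (\<lambda>x. (x, h x)) ` G'"
      unfolding G(3) using G'(2,5) by auto
    then have "(\<lambda>x. (x, h x)) ` G' \<in> A"
      using hom_graphI[OF G'(1,4)] M by (auto simp: A_def)
    then have "(\<lambda>x. (x, h x)) ` G' = M"
      using max sub by blast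
    then show "x \<in> G"
      using G'(3) unfolding G(3) by auto
  qed
  then have "G = UNIV" by auto
  then show ?thesis
    using that G(2) FG by blast
qed

text \<open>For surjectivity at y: an injective homomorphism over K maps the finite root set of a
  polynomial of y into itself, hence onto itself.\<close>

lemma bij_hom:
  fixes K :: "'a::field set"
  assumes "field_set K" "algebraic_over K" "hom_on UNIV h" "\<And>x. x \<in> K \<Longrightarrow> h x = x"
  shows "bij h"
proof (rule bijI)
  show inj: "inj h"
    using hom_on_inj[OF field_set_UNIV assms(3)] .
  show "surj h"
  proof -
    have "y \<in> range h" for y
    proof -
    obtain q where q: "q \<in> poly_over K" "q \<noteq> 0" "poly q y = 0"
      using assms(2) by (auto simp: algebraic_over_def)
    have "map_poly h q = q"
      using q(1) assms(4) by (intro poly_eqI) (auto simp: coeff_map_poly hom_on_zero[OF field_set_UNIV assms(3)] poly_over_def)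
    then have "poly q (h x) = h (poly q x)" for x
      using poly_map_poly_hom[OF field_set_UNIV assms(3), of q x] by (simp add: poly_over_def)
    then have "h ` {x. poly q x = 0} \<subseteq> {x. poly q x = 0}"
      by (auto simp: hom_on_zero[OF field_set_UNIV assms(3)])
    then have "h ` {x. poly q x = 0} = {x. poly q x = 0}"
      using q(2) inj by (intro endo_inj_surj poly_roots_finite) (auto intro: inj_on_subset)
    with q(3) show ?thesis by blast
    qed
    then show ?thesis by blast
  qed
qed

lemma abs_gal_iff: "f \<in> abs_gal F \<longleftrightarrow> hom_on UNIV f \<and> bij f \<and> (\<forall>x\<in>F. f x = x)"
  by (simp add: gal_iff)

lemma extend_abs_gal:
  fixes F K :: "'a::alg_closed_field set"
  assumes "field_set K" "algebraic_over K" "K \<subseteq> F" "field_set F" "hom_on F f" "\<And>x. x \<in> K \<Longrightarrow> f x = x"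
  obtains h where "h \<in> abs_gal K" "\<forall>x\<in>F. h x = f x"
proof -
  obtain h where h: "hom_on UNIV h" "\<forall>x\<in>F. h x = f x"
    using extend_hom[OF assms(4,5) algebraic_over_mono[OF assms(2,3)]] .
  have fixed: "h x = x" if "x \<in> K" for x
    using h(2) assms(3,6) that by auto
  then have "bij h"
    using bij_hom[OF assms(1,2) h(1)] by blast
  then show ?thesis
    using that[of h] h fixed unfolding abs_gal_iff by blast
qed

text \<open>An x outside F has a minimal polynomial of degree above one, separable in characteristic
  0. It therefore has a second root x', and the map from x to x' extends to an automorphism that
  moves x.\<close>

lemma abs_gal_fixed_field:
  fixes F :: "'a::{alg_closed_field,field_char_0} set"
  assumes F: "field_set F" and alg: "algebraic_over F" and fixed: "\<And>\<rho>. \<rho> \<in> abs_gal F \<Longrightarrow> \<rho> x = x"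
  shows "x \<in> F"
proof (rule ccontr)
  assume x: "x \<notin> F"
  obtain m where m: "m \<in> poly_over F" "m \<noteq> 0" "poly m x = 0"
    "\<And>q. q \<in> poly_over F \<Longrightarrow> q \<noteq> 0 \<Longrightarrow> poly q x = 0 \<Longrightarrow> Polynomial.degree m \<le> Polynomial.degree q"
    "\<forall>q\<in>poly_over F. poly q x = 0 \<longrightarrow> (\<exists>s\<in>poly_over F. q = s * m)"
    using minimal_polynomial[OF F alg, of x] by metis
  obtain m' where m': "m = [:- x, 1:] * m'"
    using m(3) by (auto simp: poly_eq_0_iff_dvd)
  have "Polynomial.degree m' > 0"
  proof (rule ccontr)
    assume "\<not> ?thesis"
    then obtain c where "m' = [:c:]"
      using degree_eq_zeroE by blast
    with m' m(1,2) have "- (c * x) \<in> F" "c \<in> F" "c \<noteq> 0"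
      by (auto simp: poly_over_pCons_iff[OF F] poly_over_0[OF F])
    then have "- (c * x) / (- c) \<in> F"
      using field_set_divide[OF F] field_set_uminus[OF F] by blast
    moreover have "- (c * x) / (- c) = x"
      using \<open>c \<noteq> 0\<close> by (simp add: field_simps)
    ultimately show False using x by simp
  qed
  moreover from this have "m' \<noteq> 0" by auto
  then have "Polynomial.degree m = Suc (Polynomial.degree m')"
    unfolding m' by (subst degree_mult_eq) auto
  then have "Polynomial.degree m > 0" by simp
  ultimately obtain x' where x': "poly m' x' = 0"
    using alg_closed_imp_poly_has_root by blast
  \<comment> \<open>The derivative is non-zero of smaller degree, so by minimality x is a simple
    root of \<open>m\<close>.\<close>
  have "poly (pderiv m) x \<noteq> 0"
  proof
    assume "poly (pderiv m) x = 0"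
    moreover have "pderiv m \<noteq> 0" "Polynomial.degree (pderiv m) < Polynomial.degree m"
      using \<open>Polynomial.degree m > 0\<close> by (auto simp: pderiv_eq_0_iff degree_pderiv)
    ultimately show False
      using m(4)[of "pderiv m"] poly_over_pderiv[OF F m(1)] by simp
  qed
  then have "x' \<noteq> x"
    using x' unfolding m' pderiv_mult by auto
  have "poly (map_poly (\<lambda>x. x) m) x' = 0"
    using x' unfolding m' by simp
  then obtain G h where G: "field_set G" "F \<subseteq> G" "x \<in> G" "hom_on G h" "\<And>y. y \<in> F \<Longrightarrow> h y = y" "h x = x'"
    using extend_hom_simple[OF F hom_on_id alg m(1,5)] by metis
  then obtain \<rho> where "\<rho> \<in> abs_gal F" "\<rho> x = x'"
    using extend_abs_gal[OF F alg G(2,1,4)] by metis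
  with fixed \<open>x' \<noteq> x\<close> show False by auto
qed

section \<open>The ground field inside its algebraic closure\<close>

lemma field_set_range_to_ac: "field_set (range to_ac)"
  unfolding field_set_def by (auto simp flip: to_ac_1 to_ac_diff to_ac_mult to_ac_inverse)

lemma algebraic_over_range_to_ac: "algebraic_over (range (to_ac :: 'k::field \<Rightarrow> _))"
  unfolding algebraic_over_def
proof
  fix x :: "'k alg_closure"
  obtain q where "q \<noteq> 0" "poly (map_poly to_ac q) x = 0"
    using alg_closure_algebraic .
  then show "\<exists>q\<in>poly_over (range to_ac). q \<noteq> 0 \<and> poly q x = 0"
    by (intro bexI[of _ "map_poly to_ac q"]) (auto simp: poly_over_def coeff_map_poly map_poly_eq_0_iff)
qed

subsection \<open>Split cyclic algebras\<close>

definition matrix_single :: "nat \<Rightarrow> ('a, 'b) module \<Rightarrow> nat \<Rightarrow> nat \<Rightarrow> 'b \<Rightarrow> nat \<times> nat \<Rightarrow> 'b" where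
  "matrix_single n A i0 j0 z = (\<lambda>(i, j)\<in>{..<n} \<times> {..<n}. if i = i0 \<and> j = j0 then z else \<zero>\<^bsub>A\<^esub>)"

text \<open>Exactly the laws that govern products with a matrix having a single non-zero entry; they
  hold for the coefficient families of a cyclic algebra by inspection, and \<open>finsum\<close>
  asks for the additive monoid.\<close>

locale prealgebra = abelian_monoid A for A :: "('a, 'b) module" (structure) +
  fixes F :: "'a set"
  assumes mult_closed: "x \<in> carrier A \<Longrightarrow> y \<in> carrier A \<Longrightarrow> x \<otimes> y \<in> carrier A"
    and smult_closed: "c \<in> F \<Longrightarrow> x \<in> carrier A \<Longrightarrow> c \<odot> x \<in> carrier A"
    and mult_zero: "x \<in> carrier A \<Longrightarrow> x \<otimes> \<zero> = \<zero>" "x \<in> carrier A \<Longrightarrow> \<zero> \<otimes> x = \<zero>"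
begin

lemma matrix_entry:
  "P \<in> carrier (matrix_algebra n A) \<Longrightarrow> i < n \<Longrightarrow> j < n \<Longrightarrow> P (i, j) \<in> carrier A"
  by (auto simp: matrix_algebra_def)

lemma matrix_mult_entry:
  "i < n \<Longrightarrow> j < n \<Longrightarrow>
     (P \<otimes>\<^bsub>matrix_algebra n A\<^esub> Q) (i, j) = finsum A (\<lambda>k. P (i, k) \<otimes> Q (k, j)) {..<n}"
  by (simp add: matrix_algebra_def)

lemma matrix_mult_closed:
  assumes "P \<in> carrier (matrix_algebra n A)" "Q \<in> carrier (matrix_algebra n A)"
  shows "P \<otimes>\<^bsub>matrix_algebra n A\<^esub> Q \<in> carrier (matrix_algebra n A)"
proof -
  have "finsum A (\<lambda>k. P (i, k) \<otimes> Q (k, j)) {..<n} \<in> carrier A" if "i < n" "j < n" for i j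
    using assms that by (intro finsum_closed Pi_I mult_closed matrix_entry) auto
  then show ?thesis
    by (auto simp: matrix_algebra_def)
qed

lemma matrix_smult_closed:
  assumes "c \<in> F" "P \<in> carrier (matrix_algebra n A)"
  shows "c \<odot>\<^bsub>matrix_algebra n A\<^esub> P \<in> carrier (matrix_algebra n A)"
  using assms smult_closed by (auto simp: matrix_algebra_def)

lemma matrix_single_closed:
  "z \<in> carrier A \<Longrightarrow> matrix_single n A i0 j0 z \<in> carrier (matrix_algebra n A)"
  by (auto simp: matrix_algebra_def matrix_single_def)

lemma finsum_single:
  fixes n :: nat
  assumes "k0 < n" "\<And>k. k < n \<Longrightarrow> k \<noteq> k0 \<Longrightarrow> f k = \<zero>" "f k0 \<in> carrier A"
  shows "finsum A f {..<n} = f k0"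
proof -
  have "f \<in> {..<n} \<rightarrow> carrier A"
    using assms by (metis Pi_I lessThan_iff zero_closed)
  then have "finsum A f {..<n} = finsum A (\<lambda>k. if k0 = k then f k else \<zero>) {..<n}"
    using assms by (intro finsum_cong') auto
  also have "\<dots> = f k0"
    using assms \<open>f \<in> {..<n} \<rightarrow> carrier A\<close> by (intro add.finprod_singleton) auto
  finally show ?thesis .
qed

lemma matrix_mult_single:
  assumes "P \<in> carrier (matrix_algebra n A)" "z \<in> carrier A" "i0 < n" "j0 < n" "i < n" "j < n"
  shows "(P \<otimes>\<^bsub>matrix_algebra n A\<^esub> matrix_single n A i0 j0 z) (i, j) = (if j = j0 then P (i, i0) \<otimes> z else \<zero>)"
    and "(matrix_single n A i0 j0 z \<otimes>\<^bsub>matrix_algebra n A\<^esub> P) (i, j) = (if i = i0 then z \<otimes> P (j0, j) else \<zero>)"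
proof -
  show "(P \<otimes>\<^bsub>matrix_algebra n A\<^esub> matrix_single n A i0 j0 z) (i, j) = (if j = j0 then P (i, i0) \<otimes> z else \<zero>)"
    unfolding matrix_mult_entry[OF assms(5,6)]
    by (subst finsum_single[of i0])
      (use assms in \<open>auto simp: matrix_single_def mult_zero mult_closed matrix_entry\<close>)
  show "(matrix_single n A i0 j0 z \<otimes>\<^bsub>matrix_algebra n A\<^esub> P) (i, j) = (if i = i0 then z \<otimes> P (j0, j) else \<zero>)"
    unfolding matrix_mult_entry[OF assms(5,6)]
    by (subst finsum_single[of j0])
      (use assms in \<open>auto simp: matrix_single_def mult_zero mult_closed matrix_entry\<close>)
qed

end

lemma prealgebra_base: "field_set F \<Longrightarrow> prealgebra (base_algebra F) F"
  by unfold_locales (auto simp: base_algebra_def field_set_intros algebra_simps)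

text \<open>\<open>r\<close> is a non-zero entry of the preimage of a diagonal matrix unit under the isomorphism.\<close>

lemma split_rank_one:
  fixes A :: "('a::field, 'b) module" (structure)
  assumes A: "prealgebra A F" and F: "field_set F" and mn: "m > 0" "n > 0"
    and iso: "algebra_iso F (matrix_algebra m A) (matrix_algebra n (base_algebra F))"
  obtains r where "r \<in> carrier A" "r \<noteq> \<zero>" "\<forall>z\<in>carrier A. \<exists>c\<in>F. (r \<otimes> z) \<otimes> r = c \<odot> r"
proof -
  interpret prealgebra A F
    by (rule A)
  interpret B: prealgebra "base_algebra F" F
    by (rule prealgebra_base[OF F])
  let ?P = "matrix_algebra m A" and ?Q = "matrix_algebra n (base_algebra F)"
  obtain \<phi> where \<phi>: "\<phi> \<in> ring_iso ?P ?Q"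
    and smult: "\<And>c x. c \<in> F \<Longrightarrow> x \<in> carrier ?P \<Longrightarrow> \<phi> (c \<odot>\<^bsub>?P\<^esub> x) = c \<odot>\<^bsub>?Q\<^esub> \<phi> x"
    using iso unfolding algebra_iso_def by blast
  have hom: "\<phi> \<in> ring_hom ?P ?Q" and bij: "bij_betw \<phi> (carrier ?P) (carrier ?Q)"
    using \<phi> by (auto simp: ring_iso_def)
  define e where "e = matrix_single n (base_algebra F) 0 0 (1 :: 'a)"
  have one: "(1 :: 'a) \<in> carrier (base_algebra F)"
    using F by (simp add: base_algebra_def field_set_one)
  have e: "e \<in> carrier ?Q"
    unfolding e_def by (rule B.matrix_single_closed[OF one])
  then obtain e' where e': "e' \<in> carrier ?P" "\<phi> e' = e"
    using bij unfolding bij_betw_def by (metis imageE)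
  \<comment> \<open>Over F one has e W e = W(0,0) e for the matrix unit e; this relation is pulled
    back along \<open>\<phi>\<close>.\<close>
  have key: "\<exists>c\<in>F. (e' \<otimes>\<^bsub>?P\<^esub> Y) \<otimes>\<^bsub>?P\<^esub> e' = c \<odot>\<^bsub>?P\<^esub> e'" if Y: "Y \<in> carrier ?P" for Y
  proof -
    define W where "W = \<phi> Y"
    have W: "W \<in> carrier ?Q"
      using bij Y by (auto simp: W_def bij_betw_def)
    define c where "c = W (0, 0)"
    have c: "c \<in> F"
      using B.matrix_entry[OF W mn(2) mn(2)] by (simp add: c_def base_algebra_def)
    have eX: "e \<otimes>\<^bsub>?Q\<^esub> W \<in> carrier ?Q"
      by (rule B.matrix_mult_closed[OF e W])
    have "\<phi> ((e' \<otimes>\<^bsub>?P\<^esub> Y) \<otimes>\<^bsub>?P\<^esub> e') = (e \<otimes>\<^bsub>?Q\<^esub> W) \<otimes>\<^bsub>?Q\<^esub> e"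
      using ring_hom_mult[OF hom] e' Y matrix_mult_closed by (simp add: W_def)
    also have "\<dots> = c \<odot>\<^bsub>?Q\<^esub> e"
    proof
      fix ij :: "nat \<times> nat"
      obtain i j where ij: "ij = (i, j)" by fastforce
      show "((e \<otimes>\<^bsub>?Q\<^esub> W) \<otimes>\<^bsub>?Q\<^esub> e) ij = (c \<odot>\<^bsub>?Q\<^esub> e) ij"
      proof (cases "i < n \<and> j < n")
        case True
        have "((e \<otimes>\<^bsub>?Q\<^esub> W) \<otimes>\<^bsub>?Q\<^esub> e) (i, j) = (if j = 0 then if i = 0 then c else 0 else 0)"
          using True B.matrix_mult_single(1)[OF eX one, of 0 0 i j] B.matrix_mult_single(2)[OF W one, of 0 0 i 0] mn
          unfolding e_def[symmetric] by (auto simp: base_algebra_def c_def)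
        then show ?thesis
          using True unfolding ij by (auto simp: matrix_algebra_def e_def matrix_single_def base_algebra_def)
      next
        case False
        then show ?thesis
          unfolding ij by (auto simp: matrix_algebra_def)
      qed
    qed
    also have "\<dots> = \<phi> (c \<odot>\<^bsub>?P\<^esub> e')"
      using smult[OF c e'(1)] e'(2) by simp
    finally have "(e' \<otimes>\<^bsub>?P\<^esub> Y) \<otimes>\<^bsub>?P\<^esub> e' = c \<odot>\<^bsub>?P\<^esub> e'"
      using bij matrix_mult_closed matrix_smult_closed[OF c] e'(1) Y
      by (auto simp: bij_betw_def inj_on_def)
    with c show ?thesis by blast
  qed
  \<comment> \<open>If all entries vanished, e' + e' = e'; additivity of \<open>\<phi>\<close> alone
    carries this over to e + e = e, that is 1 + 1 = 1.\<close>
  have "\<exists>i<m. \<exists>j<m. e' (i, j) \<noteq> \<zero>"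
  proof (rule ccontr)
    assume "\<not> ?thesis"
    then have zero: "e' (i, j) = \<zero>" if "i < m" "j < m" for i j
      using that by blast
    have "e' \<oplus>\<^bsub>?P\<^esub> e' = e'"
    proof
      fix ij
      show "(e' \<oplus>\<^bsub>?P\<^esub> e') ij = e' ij"
        using e'(1) zero by (cases ij; cases "ij \<in> {..<m} \<times> {..<m}") (auto simp: matrix_algebra_def PiE_def extensional_def)
    qed
    then have "e \<oplus>\<^bsub>?Q\<^esub> e = e"
      using ring_hom_add[OF hom e'(1) e'(1)] e'(2) by simp
    then have "(e \<oplus>\<^bsub>?Q\<^esub> e) (0, 0) = e (0, 0)"
      by simp
    then have "1 + 1 = (1 :: 'a)"
      using mn by (simp add: matrix_algebra_def e_def matrix_single_def base_algebra_def)
    then show False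
      by (metis add_cancel_right_left zero_neq_one)
  qed
  then obtain i j where ij: "i < m" "j < m" "e' (i, j) \<noteq> \<zero>"
    by blast
  define r where "r = e' (i, j)"
  have r: "r \<in> carrier A"
    unfolding r_def by (rule matrix_entry[OF e'(1) ij(1,2)])
  have "\<exists>c\<in>F. (r \<otimes> z) \<otimes> r = c \<odot> r" if z: "z \<in> carrier A" for z
  proof -
    \<comment> \<open>With \<open>z\<close> placed at the transposed position (j, i), the (i, j)
      entry of e' Y e' is the single product r z r.\<close>
    define Y where "Y = matrix_single m A j i z"
    have Y: "Y \<in> carrier ?P"
      unfolding Y_def by (rule matrix_single_closed[OF z])
    have e'Y: "(e' \<otimes>\<^bsub>?P\<^esub> Y) (i, k) = (if k = i then r \<otimes> z else \<zero>)" if "k < m" for k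
      unfolding Y_def r_def using matrix_mult_single(1)[OF e'(1) z ij(2,1,1) that] .
    obtain c where c: "c \<in> F" "(e' \<otimes>\<^bsub>?P\<^esub> Y) \<otimes>\<^bsub>?P\<^esub> e' = c \<odot>\<^bsub>?P\<^esub> e'"
      using key[OF Y] by blast
    have "((e' \<otimes>\<^bsub>?P\<^esub> Y) \<otimes>\<^bsub>?P\<^esub> e') (i, j) = (r \<otimes> z) \<otimes> r"
      unfolding matrix_mult_entry[OF ij(1,2)]
      by (subst finsum_single[of i])
        (use ij e'Y r z matrix_entry[OF e'(1)] in \<open>auto simp: r_def mult_zero mult_closed\<close>)
    moreover have "(c \<odot>\<^bsub>?P\<^esub> e') (i, j) = c \<odot> r"
      using ij by (simp add: matrix_algebra_def r_def)
    ultimately show ?thesis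
      using c by metis
  qed
  with r ij(3) that show ?thesis
    unfolding r_def by blast
qed

text \<open>The product of \<open>cyclic_algebra\<close> without the restriction of the result to
  indices below \<open>p\<close>, so that products can be nested as plain functions.\<close>

definition cyc_mult :: "nat \<Rightarrow> ('a::field \<Rightarrow> 'a) \<Rightarrow> 'a \<Rightarrow> (nat \<Rightarrow> 'a) \<Rightarrow> (nat \<Rightarrow> 'a) \<Rightarrow> nat \<Rightarrow> 'a" where
  "cyc_mult p \<gamma> c f h k = (\<Sum>(i, j) | i < p \<and> j < p \<and> (i + j) mod p = k.
     f i * (\<gamma> ^^ i) (h j) * (if i + j < p then 1 else c))"

section \<open>Roots of unity of prime order and Fourier inversion\<close>

lemma mult_inverse_mod:
  assumes "Factorial_Ring.prime (p :: nat)" "\<not> p dvd k"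
  obtains l where "(k * l) mod p = 1"
proof -
  have "coprime k p"
    using assms prime_imp_coprime_nat coprime_commute by blast
  then obtain l where "[k * l = 1] (mod p)"
    using cong_solve_coprime_nat by (metis One_nat_def)
  then show ?thesis
    using that prime_gt_1_nat[OF assms(1)] by (simp add: cong_def)
qed

lemma root_of_unity_eq_1_iff:
  fixes \<zeta> :: "'a::field"
  assumes "Factorial_Ring.prime p" "\<zeta> ^ p = 1" "\<zeta> \<noteq> 1"
  shows "\<zeta> ^ i = 1 \<longleftrightarrow> p dvd i"
proof
  assume i: "\<zeta> ^ i = 1"
  show "p dvd i"
  proof (rule ccontr)
    assume "\<not> p dvd i"
    then obtain x where "(i * x) mod p = 1"
      using mult_inverse_mod[OF assms(1)] by blast
    then have "i * x = p * (i * x div p) + 1"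
      by (metis mult_div_mod_eq)
    then have "\<zeta> ^ (i * x) = \<zeta>"
      by (metis assms(2) power_add power_mult power_one mult_1 power_one_right)
    with i assms(3) show False
      by (simp add: power_mult)
  qed
qed (use assms(2) in \<open>auto simp: power_mult\<close>)

lemma root_of_unity_power_eq_iff:
  fixes \<zeta> :: "'a::field"
  assumes "Factorial_Ring.prime p" "\<zeta> ^ p = 1" "\<zeta> \<noteq> 1"
  shows "\<zeta> ^ i = \<zeta> ^ j \<longleftrightarrow> i mod p = j mod p"
proof (induction i j rule: linorder_wlog)
  case (le i j)
  have nz: "\<zeta> \<noteq> 0"
    using assms(2) prime_gt_0_nat[OF assms(1)] by (metis power_0_left neq0_conv zero_neq_one)
  have "\<zeta> ^ i = \<zeta> ^ j \<longleftrightarrow> \<zeta> ^ i * \<zeta> ^ (j - i) = \<zeta> ^ i * 1"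
    using le by (simp flip: power_add) (auto)
  also have "\<dots> \<longleftrightarrow> p dvd j - i"
    using nz root_of_unity_eq_1_iff[OF assms] by simp
  also have "\<dots> \<longleftrightarrow> i mod p = j mod p"
    using mod_eq_dvd_iff_nat[OF le, of p] by auto
  finally show ?case .
qed auto

text \<open>The \<open>u k\<close> are the coefficients of a polynomial of degree below p that
  vanishes at the p distinct powers of \<zeta>.\<close>

lemma fourier_inversion:
  fixes \<zeta> :: "'a::field"
  assumes \<zeta>: "Factorial_Ring.prime p" "\<zeta> ^ p = 1" "\<zeta> \<noteq> 1"
    and zero: "\<And>j. j < p \<Longrightarrow> (\<Sum>k<p. u k * \<zeta> ^ (j * k)) = 0" and "l < p"
  shows "u l = 0"
proof -
  define P where "P = (\<Sum>k<p. Polynomial.monom (u k) k)"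
  have coeff: "Polynomial.coeff P k = (if k < p then u k else 0)" for k
    by (simp add: P_def coeff_sum if_distrib)
  have "inj_on (\<lambda>j. \<zeta> ^ j) {..<p}"
    using root_of_unity_power_eq_iff[OF \<zeta>] by (auto simp: inj_on_def)
  then have card: "card ((\<lambda>j. \<zeta> ^ j) ` {..<p}) = p"
    by (simp add: card_image)
  have "P = 0"
  proof (rule poly_eqI_degree)
    fix x assume "x \<in> (\<lambda>j. \<zeta> ^ j) ` {..<p}"
    then show "poly P x = poly 0 x"
      using zero by (auto simp: P_def poly_sum poly_monom power_mult)
  next
    show "Polynomial.degree P < card ((\<lambda>j. \<zeta> ^ j) ` {..<p})"
      unfolding card using \<open>l < p\<close> coeff by (intro degree_lessI) auto
  qed (use card \<open>l < p\<close> in simp)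
  with coeff[of l] \<open>l < p\<close> show ?thesis by simp
qed

lemma periodic_shift_sum:
  fixes h :: "nat \<Rightarrow> 'a::ab_group_add"
  assumes "\<And>n. h (n + p) = h n"
  shows "(\<Sum>n<p. h (n + k)) = (\<Sum>n<p. h n)"
proof (induction k)
  case (Suc k)
  have "(\<Sum>n<p. h (n + Suc k)) = (\<Sum>n<p. h (Suc n + k))"
    by simp
  also have "\<dots> = (\<Sum>n<p. h (n + k)) + h (p + k) - h k"
    using sum.lessThan_Suc_shift[of "\<lambda>n. h (n + k)" p] by (simp add: algebra_simps)
  also have "h (p + k) = h k"
    using assms[of k] by (simp add: add.commute)
  finally show ?case
    using Suc.IH by simp
qed simp

text \<open>The algebra acts on sequences with \<open>x (n + p) = \<beta> x n\<close>: the generator \<open>v\<close> is the shift, and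
  \<open>a \<in> L\<close> multiplies the \<open>n\<close>-th term by \<open>\<gamma>\<^sup>n a\<close>.\<close>

locale cyclic_data =
  fixes F L M :: "'a::field_char_0 set" and p :: nat and \<gamma> s :: "'a \<Rightarrow> 'a" and \<zeta> \<beta> \<delta> \<alpha> a :: 'a
  assumes F: "field_set F" and L: "field_set L" and M: "field_set M"
    and FL: "F \<subseteq> L" and FM: "F \<subseteq> M"
    and p: "Factorial_Ring.prime p"
    and \<zeta>: "\<zeta> \<in> F" "\<zeta> ^ p = 1" "\<zeta> \<noteq> 1"
    and \<gamma>: "hom_on L \<gamma>" "\<gamma> ` L \<subseteq> L" "\<And>x. x \<in> L \<Longrightarrow> (\<gamma> ^^ p) x = x" "\<And>x. x \<in> F \<Longrightarrow> \<gamma> x = x"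
    and trace: "\<And>x. x \<in> L \<Longrightarrow> (\<Sum>i<p. (\<gamma> ^^ i) x) \<in> F"
    and \<alpha>: "\<alpha> \<in> L" "\<alpha> ^ p = a" "\<gamma> \<alpha> = \<zeta> * \<alpha>"
    and s: "hom_on M s" "s ` M \<subseteq> M" "\<And>x. x \<in> F \<Longrightarrow> s x = x"
    and \<delta>: "\<delta> \<in> M" "\<delta> ^ p = \<beta>" "s \<delta> = \<zeta> * \<delta>"
    and \<beta>: "\<beta> \<in> F" "\<beta> \<noteq> 0"
begin

definition act :: "(nat \<Rightarrow> 'a) \<Rightarrow> (nat \<Rightarrow> 'a) \<Rightarrow> nat \<Rightarrow> 'a" where
  "act f x n = (\<Sum>k<p. (\<gamma> ^^ n) (f k) * x (n + k))"

lemma p_pos: "p > 0"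
  using p by (simp add: prime_gt_0_nat)

lemmas \<gamma>_closed = funpow_closed[OF \<gamma>(2)] and hom_\<gamma> = hom_on_funpow[OF \<gamma>(1,2)]
  and \<gamma>_fixed = funpow_fixed[of \<gamma>, OF \<gamma>(4)]

lemma \<gamma>_\<alpha>: "(\<gamma> ^^ n) \<alpha> = \<zeta> ^ n * \<alpha>"
  using FL \<zeta>(1) by (intro funpow_eigenvector[OF L \<gamma>(1) \<alpha>(1)] \<gamma>(4) \<alpha>(3)) auto

lemma \<gamma>_period: "x \<in> L \<Longrightarrow> (\<gamma> ^^ (n + p)) x = (\<gamma> ^^ n) x"
  by (simp add: funpow_add \<gamma>(3))

lemmas s_closed = funpow_closed[OF s(2)] and hom_s = hom_on_funpow[OF s(1,2)]
  and s_fixed = funpow_fixed[of s, OF s(3)]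

lemma s_\<delta>: "(s ^^ n) \<delta> = \<zeta> ^ n * \<delta>"
  using FM \<zeta>(1) by (intro funpow_eigenvector[OF M s(1) \<delta>(1)] s(3) \<delta>(3)) auto

text \<open>The exponents are given by a function \<open>h\<close> because both sums over \<delta>^k
  and sums over \<delta>^(k+1) occur below.\<close>

lemma s_polynomial:
  assumes "\<And>k. k < p \<Longrightarrow> c k \<in> F"
  shows "(\<Sum>k<p. c k * \<delta> ^ h k) \<in> M"
    and "(s ^^ m) (\<Sum>k<p. c k * \<delta> ^ h k) = (\<Sum>k<p. c k * (\<zeta> ^ m * \<delta>) ^ h k)"
proof -
  have M': "c k \<in> M" "\<delta> ^ h k \<in> M" if "k \<in> {..<p}" for k
    using that assms FM field_set_power[OF M \<delta>(1)] by auto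
  show "(\<Sum>k<p. c k * \<delta> ^ h k) \<in> M"
    by (intro field_set_sum[OF M] field_set_mult[OF M] M')
  have "(s ^^ m) (\<Sum>k<p. c k * \<delta> ^ h k) = (\<Sum>k<p. (s ^^ m) (c k * \<delta> ^ h k))"
    by (intro hom_on_sum[OF M hom_s] field_set_mult[OF M] M')
  also have "\<dots> = (\<Sum>k<p. c k * (\<zeta> ^ m * \<delta>) ^ h k)"
    using M' by (intro sum.cong)
      (auto simp: hom_on_mult[OF M hom_s] hom_on_power[OF M hom_s \<delta>(1)] s_\<delta> s_fixed assms)
  finally show "(s ^^ m) (\<Sum>k<p. c k * \<delta> ^ h k) = (\<Sum>k<p. c k * (\<zeta> ^ m * \<delta>) ^ h k)" .
qed

lemma \<delta>_nz: "\<delta> \<noteq> 0"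
  using \<delta>(2) \<beta>(2) p_pos by auto

text \<open>Makes the sequences a module and takes the place of associativity in the cyclic algebra.
  The factor \<beta> that the product acquires when i + j reaches p is the one that x acquires over
  a period.\<close>

lemma act_mult:
  assumes f: "\<And>k. k < p \<Longrightarrow> f k \<in> L" and h: "\<And>k. k < p \<Longrightarrow> h k \<in> L"
    and x: "\<And>n. x (n + p) = \<beta> * x n"
  shows "act (cyc_mult p \<gamma> \<beta> f h) x n = act f (act h x) n"
proof -
  let ?S = "\<lambda>k. {(i, j). i < p \<and> j < p \<and> (i + j) mod p = k}"
  let ?t = "\<lambda>(i, j). (\<gamma> ^^ n) (f i) * ((\<gamma> ^^ (n + i)) (h j) * x (n + i + j))"
  have fin: "finite (?S k)" for k
    by (rule finite_subset[of _ "{..<p} \<times> {..<p}"]) auto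
  have \<beta>L: "\<beta> \<in> L" "1 \<in> L"
    using \<beta> FL field_set_one[OF L] by auto
  have "(\<gamma> ^^ n) (cyc_mult p \<gamma> \<beta> f h k) * x (n + k) = sum ?t (?S k)" if "k < p" for k
  proof -
    have eq: "(\<gamma> ^^ n) (cyc_mult p \<gamma> \<beta> f h k) =
      (\<Sum>(i, j)\<in>?S k. (\<gamma> ^^ n) (f i * (\<gamma> ^^ i) (h j) * (if i + j < p then 1 else \<beta>)))"
      unfolding cyc_mult_def
      by (subst hom_on_sum[OF L hom_\<gamma>])
        (use f h \<beta>L \<gamma>_closed in \<open>auto intro!: field_set_intros[OF L] sum.cong\<close>)
    show ?thesis
      unfolding eq sum_distrib_right
    proof (rule sum.cong[OF refl])
      fix ij assume "ij \<in> ?S k"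
      then obtain i j where ij: "i < p" "j < p" "k = (i + j) mod p" and eq: "ij = (i, j)"
        by auto
      have *: "(if i + j < p then 1 else \<beta>) * x (n + k) = x (n + i + j)"
      proof (cases "i + j < p")
        case False
        then have "(i + j) mod p = i + j - p"
          using ij by (simp add: mod_if)
        then have "n + i + j = n + k + p"
          using ij False by simp
        then show ?thesis
          using x[of "n + k"] False by (simp only: if_False)
      qed (use ij in \<open>simp add: add.assoc\<close>)
      have "(\<gamma> ^^ n) (f i * (\<gamma> ^^ i) (h j) * (if i + j < p then 1 else \<beta>)) =
        (\<gamma> ^^ n) (f i) * (\<gamma> ^^ (n + i)) (h j) * (if i + j < p then 1 else \<beta>)"
        using f[OF ij(1)] h[OF ij(2)] \<beta>L \<gamma>_closed \<gamma>_fixed[OF \<beta>(1)]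
        by (simp add: hom_on_simps[OF L hom_\<gamma>] field_set_mult[OF L] funpow_add)
      then show "(case ij of (i, j) \<Rightarrow> (\<gamma> ^^ n) (f i * (\<gamma> ^^ i) (h j) * (if i + j < p then 1 else \<beta>))) * x (n + k) = ?t ij"
        using * unfolding eq by (simp add: mult.assoc)
    qed
  qed
  then have "act (cyc_mult p \<gamma> \<beta> f h) x n = (\<Sum>k<p. sum ?t (?S k))"
    by (simp add: act_def)
  also have "\<dots> = (\<Sum>k<p. sum ?t {ij \<in> {..<p} \<times> {..<p}. (fst ij + snd ij) mod p = k})"
    by (intro sum.cong refl) auto
  also have "\<dots> = sum ?t ({..<p} \<times> {..<p})"
    by (rule sum.group) (use p_pos in auto)
  also have "\<dots> = act f (act h x) n"
    by (simp add: act_def sum.cartesian_product sum_distrib_left add.assoc)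
  finally show ?thesis .
qed

lemma act_periodic:
  assumes f: "\<And>k. k < p \<Longrightarrow> f k \<in> L" and x: "\<And>n. x (n + p) = \<beta> * x n"
  shows "act f x (n + p) = \<beta> * act f x n"
proof -
  have "(\<gamma> ^^ (n + p)) (f k) * x (n + p + k) = \<beta> * ((\<gamma> ^^ n) (f k) * x (n + k))" if "k < p" for k
    using \<gamma>_period[OF f[OF that]] x[of "n + k"] by (simp add: ac_simps)
  then show ?thesis
    by (simp add: act_def sum_distrib_left)
qed

text \<open>On these Fourier coefficients \<open>v\<close> acts diagonally, by \<open>\<zeta>\<^sup>m \<delta>\<close>, while \<open>\<alpha>\<close> shifts the index \<open>m\<close>.\<close>

definition transform :: "(nat \<Rightarrow> 'a) \<Rightarrow> nat \<Rightarrow> 'a" where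
  "transform x m = (\<Sum>n<p. x n / (\<zeta> ^ m * \<delta>) ^ n)"

text \<open>With w = \<zeta>^m \<delta> one has w^p = \<beta>, so the terms x(n) / w^n have period p
  and the summation may start anywhere.\<close>

lemma transform_shift:
  assumes "\<And>n. x (n + p) = \<beta> * x n"
  shows "(\<Sum>n<p. x (n + k) / (\<zeta> ^ m * \<delta>) ^ n) = (\<zeta> ^ m * \<delta>) ^ k * transform x m"
proof -
  define w where "w = \<zeta> ^ m * \<delta>"
  have "(\<zeta> ^ m) ^ p = 1"
    using \<zeta>(2) by (metis power_mult mult.commute power_one)
  then have wp: "w ^ p = \<beta>"
    using \<delta>(2) by (simp add: w_def power_mult_distrib)
  then have w: "w \<noteq> 0" "w ^ p = \<beta>"
    using \<beta>(2) p_pos by auto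
  have "x (n + p) / w ^ (n + p) = x n / w ^ n" for n
    using assms[of n] w \<beta>(2) by (simp add: power_add)
  from periodic_shift_sum[of "\<lambda>n. x n / w ^ n", OF this]
  have "(\<Sum>n<p. x (n + k) / w ^ (n + k)) = transform x m"
    by (simp add: transform_def w_def)
  then have "w ^ k * transform x m = (\<Sum>n<p. w ^ k * (x (n + k) / w ^ (n + k)))"
    by (simp only: sum_distrib_left[symmetric])
  also have "\<dots> = (\<Sum>n<p. x (n + k) / w ^ n)"
    using w(1) by (intro sum.cong) (auto simp: power_add)
  finally show ?thesis
    unfolding w_def ..
qed

lemma transform_period: "transform x (m + p) = transform x m"
  by (simp add: transform_def power_add \<zeta>(2))

text \<open>The transform is the discrete Fourier transform of x(n) / \<delta>^n for the root of
  unity 1 / \<zeta>; if it vanished identically, so would x on one period and then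
  everywhere.\<close>

lemma transform_nonzero:
  assumes "\<And>n. x (n + p) = \<beta> * x n" "x n0 \<noteq> 0"
  obtains m where "transform x m \<noteq> 0"
proof (rule ccontr)
  assume "\<not> thesis"
  then have zero: "transform x m = 0" for m
    using that by blast
  have inv: "inverse \<zeta> ^ p = 1" "inverse \<zeta> \<noteq> 1"
    using \<zeta>(2,3) by (simp_all add: power_inverse)
  have "x n / \<delta> ^ n = 0" if "n < p" for n
  proof (rule fourier_inversion[OF p inv _ that])
    fix j
    have "(\<Sum>k<p. x k / \<delta> ^ k * inverse \<zeta> ^ (j * k)) = transform x j"
      unfolding transform_def
      by (intro sum.cong) (auto simp: power_mult_distrib power_inverse field_simps simp flip: power_mult)
    with zero show "(\<Sum>k<p. x k / \<delta> ^ k * inverse \<zeta> ^ (j * k)) = 0" by simp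
  qed
  then have base: "x n = 0" if "n < p" for n
    using that \<delta>_nz by simp
  have "x n = 0" for n
  proof (induction n rule: less_induct)
    case (less n)
    then show ?case
      using base[of n] assms(1)[of "n - p"] p_pos by (cases "n < p") auto
  qed
  with assms(2) show False by simp
qed

lemma cyc_mult_closed:
  assumes "\<And>k. k < p \<Longrightarrow> f k \<in> L" "\<And>k. k < p \<Longrightarrow> h k \<in> L"
  shows "cyc_mult p \<gamma> \<beta> f h k \<in> L"
  unfolding cyc_mult_def
  using assms \<gamma>_closed \<beta>(1) FL by (intro field_set_sum[OF L]) (auto intro!: field_set_intros[OF L])

text \<open>An identity \<mu>(v) \<alpha> r = \<nu>(v) r of the algebra is applied to a single
  sequence x, giving a linear recurrence for y = r x. Its Fourier coefficients satisfy a recurrence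
  of order one, and the product of that over a period is the norm of \<nu> / \<mu>.\<close>

theorem norm_from_rank_one:
  assumes r: "\<And>k. k < p \<Longrightarrow> r k \<in> L" and k0: "k0 < p" "r k0 \<noteq> 0"
    and rank_one: "\<And>z. (\<And>k. k < p \<Longrightarrow> z k \<in> L) \<Longrightarrow>
      \<exists>c\<in>F. \<forall>k<p. cyc_mult p \<gamma> \<beta> (cyc_mult p \<gamma> \<beta> r z) r k = c * r k"
  obtains \<eta> where "\<eta> \<in> M" "(\<Prod>i<p. (s ^^ i) \<eta>) = a"
proof -
  have root_period: "(\<zeta> ^ j * \<delta>) ^ (n + p) = \<beta> * (\<zeta> ^ j * \<delta>) ^ n" for j n
  proof -
    have "(\<zeta> ^ j) ^ p = 1"
      using \<zeta>(2) by (metis power_mult mult.commute power_one)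
    then show ?thesis
      using \<delta>(2) by (simp add: power_add power_mult_distrib mult_ac)
  qed
  \<comment> \<open>The sequences (\<zeta>^j \<delta>)^n are the eigenvectors of v. By Fourier
    inversion an r with a non-zero coefficient cannot make the initial terms of all their images
    vanish.\<close>
  have "\<exists>j. act r (\<lambda>n. (\<zeta> ^ j * \<delta>) ^ n) 0 \<noteq> 0"
  proof (rule ccontr)
    assume zero: "\<not> ?thesis"
    have "r k0 * \<delta> ^ k0 = 0"
    proof (rule fourier_inversion[OF p \<zeta>(2,3) _ k0(1)])
      fix j
      have "(\<Sum>k<p. r k * \<delta> ^ k * \<zeta> ^ (j * k)) = act r (\<lambda>n. (\<zeta> ^ j * \<delta>) ^ n) 0"
        by (simp add: act_def power_mult_distrib power_mult[symmetric] mult_ac)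
      with zero show "(\<Sum>k<p. r k * \<delta> ^ k * \<zeta> ^ (j * k)) = 0" by simp
    qed
    with k0(2) \<delta>_nz show False by simp
  qed
  then obtain j where j: "act r (\<lambda>n. (\<zeta> ^ j * \<delta>) ^ n) 0 \<noteq> 0" ..
  define x where "x n = (\<zeta> ^ j * \<delta>) ^ n" for n
  have x: "x (n + p) = \<beta> * x n" for n
    unfolding x_def by (rule root_period)
  define y where "y = act r x"
  have y0: "y 0 \<noteq> 0"
    using j unfolding y_def x_def .
  have y: "y (n + p) = \<beta> * y n" for n
    unfolding y_def by (rule act_periodic) (fact r x)+
  \<comment> \<open>Chosen so that \<gamma>^k0 z = 1 / r(k0), because \<gamma>^p is the identity;
    then r z has the coefficient 1 at v^k0.\<close>
  define z where "z = (\<gamma> ^^ (p - k0)) (inverse (r k0))"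
  have z: "z \<in> L"
    unfolding z_def by (intro \<gamma>_closed field_set_inverse[OF L] r k0)
  define u where "u k = r k * (\<gamma> ^^ k) z" for k
  have u: "u k \<in> L" if "k < p" for k
    unfolding u_def by (intro field_set_mult[OF L] r that \<gamma>_closed z)
  \<comment> \<open>Conjugation by v applies \<gamma> to the coefficients, so \<open>t k\<close> is
    the coefficient of v^k in the sum of the conjugates of r z. At k0 it equals p, non-zero in
    characteristic 0.\<close>
  define t where "t k = (\<Sum>i<p. (\<gamma> ^^ i) (u k))" for k
  have t: "t k \<in> F" if "k < p" for k
    unfolding t_def by (intro trace u that)
  have tk0: "t k0 \<noteq> 0"
  proof -
    have "(\<gamma> ^^ k0) z = (\<gamma> ^^ (k0 + (p - k0))) (inverse (r k0))"
      unfolding z_def by (simp add: funpow_add)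
    also have "\<dots> = inverse (r k0)"
      using k0(1) \<gamma>(3)[OF field_set_inverse[OF L r[OF k0(1)]]] by simp
    finally have "u k0 = 1"
      using k0(2) by (simp add: u_def)
    then have "t k0 = of_nat p"
      unfolding t_def using \<gamma>_fixed[OF field_set_one[OF F]] by simp
    then show ?thesis
      using p_pos by simp
  qed
  have "\<exists>c\<in>F. \<forall>n. c * y (n + Suc i) = \<beta> * (\<Sum>k<p. (\<gamma> ^^ (n + Suc i)) (u k) * (\<zeta> ^ (n + k) * \<alpha> * y (n + k)))"
    if i: "i < p" for i
  proof -
    \<comment> \<open>The test element w v^(p - Suc i) equals z v^(p - Suc i) \<alpha>. Multiplying
      r Z r = c r on the left by v^(Suc i) gives \<beta> times the conjugate of r z by v^(Suc i),
      times \<alpha> r, on one side and c v^(Suc i) r on the other; the positive exponent p - Suc i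
      stands for - Suc i and explains the factor \<beta>.\<close>
    define w where "w = z * (\<gamma> ^^ (p - Suc i)) \<alpha>"
    define Z where "Z k = (if k = p - Suc i then w else 0)" for k
    have w: "w \<in> L"
      unfolding w_def by (intro field_set_mult[OF L] z \<gamma>_closed \<alpha>)
    have Z: "Z k \<in> L" for k
      using w field_set_zero[OF L] by (simp add: Z_def)
    obtain c where c: "c \<in> F" "\<And>k. k < p \<Longrightarrow> cyc_mult p \<gamma> \<beta> (cyc_mult p \<gamma> \<beta> r Z) r k = c * r k"
      using rank_one[of Z] Z by blast
    have act_Z: "act Z y n = (\<gamma> ^^ n) w * y (n + (p - Suc i))" for n
    proof -
      have "act Z y n = (\<Sum>k<p. if k = p - Suc i then (\<gamma> ^^ n) w * y (n + k) else 0)"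
        unfolding act_def Z_def by (intro sum.cong) (auto simp: hom_on_zero[OF L hom_\<gamma>])
      also have "\<dots> = (\<gamma> ^^ n) w * y (n + (p - Suc i))"
        using p_pos by simp
      finally show ?thesis .
    qed
    have "c * y (n + Suc i) = \<beta> * (\<Sum>k<p. (\<gamma> ^^ (n + Suc i)) (u k) * (\<zeta> ^ (n + k) * \<alpha> * y (n + k)))" for n
    proof -
      define N where "N = n + Suc i"
      have "c * y N = act (cyc_mult p \<gamma> \<beta> (cyc_mult p \<gamma> \<beta> r Z) r) x N"
        unfolding y_def act_def sum_distrib_left
      proof (rule sum.cong[OF refl])
        fix k assume "k \<in> {..<p}"
        then show "c * ((\<gamma> ^^ N) (r k) * x (N + k)) =
          (\<gamma> ^^ N) (cyc_mult p \<gamma> \<beta> (cyc_mult p \<gamma> \<beta> r Z) r k) * x (N + k)"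
          using c FL r by (simp add: hom_on_mult[OF L hom_\<gamma>] \<gamma>_fixed subsetD)
      qed
      also have "\<dots> = act r (act Z y) N"
      proof -
        have "act (cyc_mult p \<gamma> \<beta> (cyc_mult p \<gamma> \<beta> r Z) r) x N = act (cyc_mult p \<gamma> \<beta> r Z) y N"
          unfolding y_def by (rule act_mult) (auto intro: cyc_mult_closed r Z x)
        also have "\<dots> = act r (act Z y) N"
          by (rule act_mult) (auto intro: r Z y)
        finally show ?thesis .
      qed
      also have "\<dots> = (\<Sum>k<p. (\<gamma> ^^ N) (r k) * ((\<gamma> ^^ (N + k)) w * y (N + k + (p - Suc i))))"
        unfolding act_def[of r] act_Z ..
      also have "\<dots> = (\<Sum>k<p. \<beta> * ((\<gamma> ^^ N) (u k) * (\<zeta> ^ (n + k) * \<alpha> * y (n + k))))"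
      proof (rule sum.cong[OF refl])
        fix k assume "k \<in> {..<p}"
        then have rk: "r k \<in> L" using r by simp
        have e: "N + k + (p - Suc i) = n + k + p"
          using i by (simp add: N_def)
        have yk: "y (N + k + (p - Suc i)) = \<beta> * y (n + k)"
          unfolding e by (rule y)
        have "(\<gamma> ^^ (N + k)) w = (\<gamma> ^^ (N + k)) z * (\<gamma> ^^ (N + k + (p - Suc i))) \<alpha>"
          unfolding w_def by (simp add: hom_on_mult[OF L hom_\<gamma>] z \<gamma>_closed \<alpha>(1) funpow_add[of "N + k" "p - Suc i"])
        also have "(\<gamma> ^^ (N + k + (p - Suc i))) \<alpha> = \<zeta> ^ (n + k) * \<alpha>"
          unfolding e \<gamma>_\<alpha> by (simp add: power_add \<zeta>(2))
        finally have wk: "(\<gamma> ^^ (N + k)) w = (\<gamma> ^^ (N + k)) z * (\<zeta> ^ (n + k) * \<alpha>)" .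
        have uk: "(\<gamma> ^^ N) (u k) = (\<gamma> ^^ N) (r k) * (\<gamma> ^^ (N + k)) z"
          unfolding u_def by (simp add: hom_on_mult[OF L hom_\<gamma>] z \<gamma>_closed rk funpow_add)
        show "(\<gamma> ^^ N) (r k) * ((\<gamma> ^^ (N + k)) w * y (N + k + (p - Suc i))) =
          \<beta> * ((\<gamma> ^^ N) (u k) * (\<zeta> ^ (n + k) * \<alpha> * y (n + k)))"
          unfolding wk uk yk by (simp add: mult_ac)
      qed
      finally show ?thesis
        unfolding N_def sum_distrib_left .
    qed
    with c(1) show ?thesis by blast
  qed
  then have "\<forall>i\<in>{..<p}. \<exists>c. c \<in> F \<and> (\<forall>n. c * y (n + Suc i) =
      \<beta> * (\<Sum>k<p. (\<gamma> ^^ (n + Suc i)) (u k) * (\<zeta> ^ (n + k) * \<alpha> * y (n + k))))"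
    by blast
  from bchoice[OF this] obtain c where *: "\<forall>i\<in>{..<p}. c i \<in> F \<and> (\<forall>n. c i * y (n + Suc i) =
      \<beta> * (\<Sum>k<p. (\<gamma> ^^ (n + Suc i)) (u k) * (\<zeta> ^ (n + k) * \<alpha> * y (n + k))))"
    by (rule exE)
  have cF: "c i \<in> F"
    and c: "c i * y (n + Suc i) = \<beta> * (\<Sum>k<p. (\<gamma> ^^ (n + Suc i)) (u k) * (\<zeta> ^ (n + k) * \<alpha> * y (n + k)))"
    if "i < p" for i n
    using * that by auto
  \<comment> \<open>Summing over i turns the conjugates of r z into their traces \<open>t k\<close>.
    The factor \<zeta>^(n + k) is the effect of \<alpha> on the term of index n + k.\<close>
  have main: "(\<Sum>i<p. c i * y (n + Suc i)) = \<beta> * \<alpha> * (\<Sum>k<p. t k * (\<zeta> ^ (n + k) * y (n + k)))" for n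
  proof -
    have "(\<Sum>i<p. c i * y (n + Suc i)) =
      (\<Sum>i<p. \<beta> * (\<Sum>k<p. (\<gamma> ^^ (n + Suc i)) (u k) * (\<zeta> ^ (n + k) * \<alpha> * y (n + k))))"
    proof (rule sum.cong[OF refl])
      fix i assume "i \<in> {..<p}"
      then have "i < p" by simp
      then show "c i * y (n + Suc i) =
        \<beta> * (\<Sum>k<p. (\<gamma> ^^ (n + Suc i)) (u k) * (\<zeta> ^ (n + k) * \<alpha> * y (n + k)))"
        by (rule c)
    qed
    also have "\<dots> = \<beta> * (\<Sum>i<p. \<Sum>k<p. (\<gamma> ^^ (n + Suc i)) (u k) * (\<zeta> ^ (n + k) * \<alpha> * y (n + k)))"
      by (rule sum_distrib_left[symmetric])
    also have "\<dots> = \<beta> * (\<Sum>k<p. (\<Sum>i<p. (\<gamma> ^^ (n + Suc i)) (u k)) * (\<zeta> ^ (n + k) * \<alpha> * y (n + k)))"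
      by (subst sum.swap) (simp only: sum_distrib_right)
    also have "\<dots> = \<beta> * (\<Sum>k<p. t k * (\<zeta> ^ (n + k) * \<alpha> * y (n + k)))"
    proof -
      have "(\<Sum>i<p. (\<gamma> ^^ (n + Suc i)) (u k)) = t k" if "k < p" for k
      proof -
        have "(\<Sum>i<p. (\<gamma> ^^ (n + Suc i)) (u k)) = (\<Sum>i<p. (\<gamma> ^^ Suc n) ((\<gamma> ^^ i) (u k)))"
          by (intro sum.cong refl) (metis add_Suc_right add_Suc funpow_add o_apply)
        also have "\<dots> = (\<gamma> ^^ Suc n) (t k)"
          unfolding t_def by (rule hom_on_sum[OF L hom_\<gamma>, symmetric]) (rule \<gamma>_closed[OF u[OF that]])
        finally show ?thesis
          unfolding \<gamma>_fixed[OF t[OF that]] .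
      qed
      then show ?thesis by (simp del: funpow.simps add_Suc_right)
    qed
    finally show ?thesis
      by (simp add: sum_distrib_left mult_ac)
  qed
  \<comment> \<open>The two polynomials in v of \<open>main\<close>, evaluated at \<delta>; unlike
    L1[v], the set M is known to be a field, so the quotient can be formed.\<close>
  define \<mu> \<nu> where "\<mu> = (\<Sum>k<p. \<beta> * t k * \<delta> ^ k)" and "\<nu> = (\<Sum>i<p. c i * \<delta> ^ Suc i)"
  have \<beta>t: "\<beta> * t k \<in> F" if "k < p" for k
    by (intro field_set_mult[OF F] \<beta> t that)
  have \<mu>M: "\<mu> \<in> M" and s\<mu>: "(s ^^ m) \<mu> = (\<Sum>k<p. \<beta> * t k * (\<zeta> ^ m * \<delta>) ^ k)" for m
    unfolding \<mu>_def using s_polynomial[where c = "\<lambda>k. \<beta> * t k" and h = "\<lambda>k. k"] \<beta>t by blast+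
  have \<nu>M: "\<nu> \<in> M" and s\<nu>: "(s ^^ m) \<nu> = (\<Sum>i<p. c i * (\<zeta> ^ m * \<delta>) ^ Suc i)" for m
    unfolding \<nu>_def using s_polynomial[where c = c and h = Suc] cF by blast+
  have "\<mu> \<noteq> 0"
  proof
    assume "\<mu> = 0"
    have "\<beta> * t k0 * \<delta> ^ k0 = 0"
    proof (rule fourier_inversion[OF p \<zeta>(2,3) _ k0(1)])
      fix m
      have "(\<Sum>k<p. \<beta> * t k * (\<zeta> ^ m * \<delta>) ^ k) = 0"
        using s\<mu>[of m] \<open>\<mu> = 0\<close> by (simp add: hom_on_zero[OF M hom_s])
      then show "(\<Sum>k<p. \<beta> * t k * \<delta> ^ k * \<zeta> ^ (m * k)) = 0"
        by (simp add: power_mult_distrib power_mult[symmetric] mult_ac)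
    qed
    with tk0 \<beta>(2) \<delta>_nz show False by simp
  qed
  define \<eta> where "\<eta> = \<nu> / \<mu>"
  have \<eta>M: "\<eta> \<in> M"
    unfolding \<eta>_def by (rule field_set_divide[OF M \<nu>M \<mu>M])
  \<comment> \<open>The transform of \<open>main\<close> at index Suc m: v becomes \<zeta>^(m+1)
    \<delta>, which turns \<mu> and \<nu> into their images under s^(m+1), and the powers \<zeta>^n
    coming from \<alpha> lower the index of the transform by one.\<close>
  have step: "(s ^^ Suc m) \<eta> * transform y (Suc m) = \<alpha> * transform y m" for m
  proof -
    define w where "w = \<zeta> ^ Suc m * \<delta>"
    have "(s ^^ Suc m) \<nu> * transform y (Suc m) = (\<Sum>i<p. c i * (w ^ Suc i * transform y (Suc m)))"
      unfolding s\<nu> w_def by (simp add: sum_distrib_right mult.assoc)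
    also have "\<dots> = (\<Sum>i<p. c i * (\<Sum>n<p. y (n + Suc i) / w ^ n))"
      unfolding w_def transform_shift[of y, OF y] ..
    also have "\<dots> = (\<Sum>n<p. (\<Sum>i<p. c i * y (n + Suc i)) / w ^ n)"
      unfolding sum_distrib_left sum_divide_distrib by (subst sum.swap) (simp only: times_divide_eq_right)
    also have "\<dots> = (\<Sum>n<p. \<beta> * \<alpha> * (\<Sum>k<p. t k * (\<zeta> ^ (n + k) * y (n + k))) / w ^ n)"
      unfolding main ..
    also have "\<dots> = \<beta> * \<alpha> * (\<Sum>k<p. t k * (\<Sum>n<p. \<zeta> ^ (n + k) * y (n + k) / w ^ n))"
      unfolding sum_distrib_left sum_divide_distrib
      by (subst sum.swap) (simp only: times_divide_eq_right mult.assoc)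
    also have "\<dots> = \<beta> * \<alpha> * (\<Sum>k<p. t k * (w ^ k * transform (\<lambda>n. \<zeta> ^ n * y n) (Suc m)))"
    proof -
      have "\<zeta> ^ (n + p) * y (n + p) = \<beta> * (\<zeta> ^ n * y n)" for n
        by (simp add: y power_add \<zeta>(2) mult_ac)
      then have "(\<Sum>n<p. \<zeta> ^ (n + k) * y (n + k) / w ^ n) = w ^ k * transform (\<lambda>n. \<zeta> ^ n * y n) (Suc m)" for k
        unfolding w_def by (rule transform_shift)
      then show ?thesis by (simp only:)
    qed
    also have "transform (\<lambda>n. \<zeta> ^ n * y n) (Suc m) = transform y m"
      unfolding transform_def
    proof (rule sum.cong[OF refl])
      fix n
      have "\<zeta> \<noteq> 0" using \<zeta>(2) p_pos by (metis power_0_left neq0_conv zero_neq_one)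
      then show "\<zeta> ^ n * y n / (\<zeta> ^ Suc m * \<delta>) ^ n = y n / (\<zeta> ^ m * \<delta>) ^ n"
        by (simp add: power_mult_distrib)
    qed
    also have "\<beta> * \<alpha> * (\<Sum>k<p. t k * (w ^ k * transform y m)) = (s ^^ Suc m) \<mu> * (\<alpha> * transform y m)"
      unfolding s\<mu> w_def[symmetric] by (simp add: sum_distrib_left sum_distrib_right mult_ac)
    finally have "(s ^^ Suc m) \<nu> * transform y (Suc m) = (s ^^ Suc m) \<mu> * (\<alpha> * transform y m)" .
    moreover have "(s ^^ Suc m) \<mu> \<noteq> 0"
      using \<open>\<mu> \<noteq> 0\<close> hom_on_eq_0_iff[OF M hom_s \<mu>M, of "Suc m"] by simp
    ultimately show ?thesis
      unfolding \<eta>_def hom_on_divide[OF M hom_s \<nu>M \<mu>M] by (simp add: field_simps)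
  qed
  obtain m where m: "transform y m \<noteq> 0"
    using transform_nonzero[of y 0] y y0 by blast
  \<comment> \<open>For n = p the transforms on both sides coincide by periodicity and cancel. The
    remaining product starts at exponent Suc m, so s^(m+1) \<eta> is the element returned.\<close>
  have "(\<Prod>i<n. (s ^^ Suc (m + i)) \<eta>) * transform y (m + n) = \<alpha> ^ n * transform y m" for n
  proof (induction n)
    case (Suc n)
    have "(\<Prod>i<Suc n. (s ^^ Suc (m + i)) \<eta>) * transform y (m + Suc n) =
      (\<Prod>i<n. (s ^^ Suc (m + i)) \<eta>) * ((s ^^ Suc (m + n)) \<eta> * transform y (Suc (m + n)))"
      by simp
    also have "\<dots> = \<alpha> * ((\<Prod>i<n. (s ^^ Suc (m + i)) \<eta>) * transform y (m + n))"
      unfolding step by (simp only: mult_ac)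
    finally show ?case
      unfolding Suc.IH by simp
  qed simp
  from this[of p] m have "(\<Prod>i<p. (s ^^ Suc (m + i)) \<eta>) = a"
    unfolding transform_period \<alpha>(2) by simp
  moreover have "(s ^^ Suc (m + i)) \<eta> = (s ^^ i) ((s ^^ Suc m) \<eta>)" for i
    by (metis add.commute add_Suc_right funpow_add o_apply)
  ultimately have "(\<Prod>i<p. (s ^^ i) ((s ^^ Suc m) \<eta>)) = a"
    by simp
  then show ?thesis
    using that s_closed[OF \<eta>M] by blast
qed

end

subsection \<open>Kummer characters\<close>

lemma roots_of_unity:
  fixes \<zeta> :: "'a::field"
  assumes "Factorial_Ring.prime p" "\<zeta> ^ p = 1" "\<zeta> \<noteq> 1" "x ^ p = 1"
  obtains i where "i < p" "x = \<zeta> ^ i"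
proof -
  let ?q = "Polynomial.monom 1 p - 1 :: 'a poly"
  have p: "p > 0"
    using assms(1) by (simp add: prime_gt_0_nat)
  have q: "Polynomial.coeff ?q p = 1"
    using p by simp
  then have nz: "?q \<noteq> 0" by force
  have roots: "{x. poly ?q x = 0} = {x. x ^ p = 1}"
    by (simp add: poly_monom)
  have "Polynomial.degree ?q \<le> p"
    by (rule degree_diff_le) (auto simp: degree_monom_le)
  then have "card {x :: 'a. x ^ p = 1} \<le> p"
    using card_poly_roots_bound[OF nz] roots by simp
  moreover have fin: "finite {x :: 'a. x ^ p = 1}"
    using poly_roots_finite[OF nz] roots by simp
  moreover have inj: "inj_on (\<lambda>i. \<zeta> ^ i) {..<p}"
    using root_of_unity_power_eq_iff[OF assms(1-3)] by (auto simp: inj_on_def)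
  moreover have sub: "(\<lambda>i. \<zeta> ^ i) ` {..<p} \<subseteq> {x. x ^ p = 1}"
    using assms(2) by (auto simp flip: power_mult) (simp add: mult.commute[of _ p] power_mult)
  ultimately have "(\<lambda>i. \<zeta> ^ i) ` {..<p} = {x. x ^ p = 1}"
    by (intro card_seteq) (auto simp: card_image)
  with assms(4) that show ?thesis by blast
qed

lemma abs_gal_hom: "\<rho> \<in> abs_gal F \<Longrightarrow> hom_on UNIV \<rho>"
  and abs_gal_fixes: "\<rho> \<in> abs_gal F \<Longrightarrow> x \<in> F \<Longrightarrow> \<rho> x = x"
  by (auto simp: abs_gal_iff)

lemma abs_gal_compose: "\<rho> \<in> abs_gal F \<Longrightarrow> \<tau> \<in> abs_gal F \<Longrightarrow> (\<lambda>x. \<rho> (\<tau> x)) \<in> abs_gal F"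
  unfolding abs_gal_iff using bij_comp[of \<tau> \<rho>] by (auto simp: hom_on_def o_def)

lemma abs_gal_funpow: "\<rho> \<in> abs_gal F \<Longrightarrow> \<rho> ^^ n \<in> abs_gal F"
proof (induction n)
  case (Suc n)
  then show ?case
    using abs_gal_compose[of \<rho> F "\<rho> ^^ n"] by (simp add: o_def)
qed (auto simp: abs_gal_iff hom_on_def)

lemma abs_gal_inv:
  assumes "\<rho> \<in> abs_gal F"
  shows "inv_into UNIV \<rho> \<in> abs_gal F"
proof -
  have \<rho>: "hom_on UNIV \<rho>" "bij \<rho>" "\<And>x. x \<in> F \<Longrightarrow> \<rho> x = x"
    using assms by (auto simp: abs_gal_iff)
  have [simp]: "\<rho> (inv_into UNIV \<rho> x) = x" for x
    using \<rho>(2) by (simp add: bij_is_surj surj_f_inv_f)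
  have eq: "x = y" if "\<rho> x = \<rho> y" for x y
    using \<rho>(2) that by (meson bij_is_inj injD)
  have "hom_on UNIV (inv_into UNIV \<rho>)"
    unfolding hom_on_def
  proof (intro conjI ballI)
    show "inv_into UNIV \<rho> 1 = 1"
      by (rule eq) (simp add: hom_on_one[OF field_set_UNIV \<rho>(1)])
    show "inv_into UNIV \<rho> (x + y) = inv_into UNIV \<rho> x + inv_into UNIV \<rho> y" for x y
      by (rule eq) (simp add: hom_on_add[OF field_set_UNIV \<rho>(1)])
    show "inv_into UNIV \<rho> (x * y) = inv_into UNIV \<rho> x * inv_into UNIV \<rho> y" for x y
      by (rule eq) (simp add: hom_on_mult[OF field_set_UNIV \<rho>(1)])
  qed
  moreover have "inv_into UNIV \<rho> x = x" if "x \<in> F" for x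
    by (rule eq) (simp add: \<rho>(3)[OF that])
  ultimately show ?thesis
    unfolding abs_gal_iff using bij_imp_bij_inv[OF \<rho>(2)] by blast
qed

lemma abs_gal_inv_apply:
  assumes "\<rho> \<in> abs_gal F"
  shows "\<rho> (inv_into UNIV \<rho> x) = x" "inv_into UNIV \<rho> (\<rho> x) = x"
  using assms by (simp_all add: abs_gal_iff bij_is_surj bij_is_inj surj_f_inv_f inv_f_f)

locale kummer =
  fixes F :: "'a::{alg_closed_field,field_char_0} set" and p :: nat and \<zeta> \<alpha> a :: 'a
  assumes F: "field_set F" and alg: "algebraic_over F" and p: "Factorial_Ring.prime p"
    and \<zeta>: "\<zeta> \<in> F" "\<zeta> ^ p = 1" "\<zeta> \<noteq> 1" and a: "a \<in> F" "a \<noteq> 0" and \<alpha>: "\<alpha> ^ p = a"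
begin

abbreviation \<chi> :: "('a \<Rightarrow> 'a) \<Rightarrow> nat" where
  "\<chi> \<equiv> kummer_char p \<zeta> a"

abbreviation L :: "'a set" where
  "L \<equiv> cut_out_field F \<chi>"

lemma p_pos: "p > 0"
  using p by (simp add: prime_gt_0_nat)

lemma \<alpha>_nz: "\<alpha> \<noteq> 0"
  using \<alpha> a(2) p_pos by auto

lemma \<zeta>_power_fixed: "\<rho> \<in> abs_gal F \<Longrightarrow> \<rho> (\<zeta> ^ i) = \<zeta> ^ i"
  using field_set_power[OF F \<zeta>(1)] by (auto simp: abs_gal_iff)

text \<open>\<open>kummer_char\<close> demands one exponent for all pth roots of a. It exists since
  two such roots differ by a power of \<zeta>, which \<rho> fixes.\<close>

lemma \<chi>:
  assumes "\<rho> \<in> abs_gal F"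
  shows "\<chi> \<rho> < p" "\<rho> \<alpha> = \<zeta> ^ \<chi> \<rho> * \<alpha>"
proof -
  have \<rho>: "hom_on UNIV \<rho>"
    using assms by (rule abs_gal_hom)
  have "(\<rho> \<alpha>) ^ p = a"
    using hom_on_power[OF field_set_UNIV \<rho>, of \<alpha> p] \<alpha> abs_gal_fixes[OF assms a(1)] by simp
  then have "(\<rho> \<alpha> / \<alpha>) ^ p = 1"
    using \<alpha> a(2) by (simp add: power_divide)
  then obtain i where i: "i < p" "\<rho> \<alpha> / \<alpha> = \<zeta> ^ i"
    using roots_of_unity[OF p \<zeta>(2,3)] by blast
  have all: "\<rho> \<alpha>' = \<zeta> ^ i * \<alpha>'" if "\<alpha>' ^ p = a" for \<alpha>'
  proof -
    have "(\<alpha>' / \<alpha>) ^ p = 1"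
      using \<alpha> a(2) that by (simp add: power_divide)
    then obtain j where "\<alpha>' / \<alpha> = \<zeta> ^ j"
      using roots_of_unity[OF p \<zeta>(2,3)] by blast
    then have "\<alpha>' = \<zeta> ^ j * \<alpha>"
      using \<alpha>_nz by (simp add: field_simps)
    moreover have "\<rho> \<alpha> = \<zeta> ^ i * \<alpha>"
      using i(2) \<alpha>_nz by (simp add: field_simps)
    ultimately show ?thesis
      using hom_on_mult[OF field_set_UNIV \<rho>] \<zeta>_power_fixed[OF assms] by (simp add: mult_ac)
  qed
  have "\<chi> \<rho> = i"
    unfolding kummer_char_def
  proof (rule the_equality)
    show "i < p \<and> (\<forall>\<alpha>. \<alpha> ^ p = a \<longrightarrow> \<rho> \<alpha> = \<zeta> ^ i * \<alpha>)"
      using i(1) all by blast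
  next
    fix j assume j: "j < p \<and> (\<forall>\<alpha>. \<alpha> ^ p = a \<longrightarrow> \<rho> \<alpha> = \<zeta> ^ j * \<alpha>)"
    then have "\<zeta> ^ j * \<alpha> = \<zeta> ^ i * \<alpha>"
      using all \<alpha> by metis
    then show "j = i"
      using \<alpha>_nz root_of_unity_power_eq_iff[OF p \<zeta>(2,3)] i(1) j by simp
  qed
  then show "\<chi> \<rho> < p" "\<rho> \<alpha> = \<zeta> ^ \<chi> \<rho> * \<alpha>"
    using i(1) all[OF \<alpha>] by auto
qed

lemma \<chi>_eqI:
  assumes "\<rho> \<in> abs_gal F" "\<rho> \<alpha> = \<zeta> ^ i * \<alpha>"
  shows "\<chi> \<rho> = i mod p"
  using \<chi>[OF assms(1)] assms(2) \<alpha>_nz root_of_unity_power_eq_iff[OF p \<zeta>(2,3)] by auto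

lemma field_set_L: "field_set L"
  using field_set_one[OF field_set_UNIV] unfolding field_set_def cut_out_field_def
  by (auto simp: hom_on_simps[OF field_set_UNIV abs_gal_hom])

lemma F_subset_L: "F \<subseteq> L"
  by (auto simp: cut_out_field_def abs_gal_iff)

lemma \<alpha>_in_L: "\<alpha> \<in> L"
  unfolding cut_out_field_def
proof (intro CollectI ballI impI)
  fix \<rho> assume "\<rho> \<in> abs_gal F" "\<chi> \<rho> = 0"
  then show "\<rho> \<alpha> = \<alpha>"
    using \<chi>(2)[of \<rho>] by simp
qed

text \<open>The inverse of \<tau> composed with \<rho> has character 0, so it fixes L by the
  definition of the cut-out field.\<close>

lemma \<chi>_eq_imp_eq_on_L:
  assumes "\<rho> \<in> abs_gal F" "\<tau> \<in> abs_gal F" "\<chi> \<rho> = \<chi> \<tau>" "x \<in> L"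
  shows "\<rho> x = \<tau> x"
proof -
  let ?\<upsilon> = "\<lambda>x. inv_into UNIV \<tau> (\<rho> x)"
  have "?\<upsilon> \<in> abs_gal F"
    using abs_gal_compose[OF abs_gal_inv[OF assms(2)] assms(1)] .
  moreover from this have "\<chi> ?\<upsilon> = 0 mod p"
    using \<chi>(2)[OF assms(1)] \<chi>(2)[OF assms(2)] assms(3) abs_gal_inv_apply(2)[OF assms(2), of \<alpha>]
    by (intro \<chi>_eqI) auto
  ultimately have "?\<upsilon> x = x"
    using assms(4) by (auto simp: cut_out_field_def)
  then show ?thesis
    using abs_gal_inv_apply(1)[OF assms(2), of "\<rho> x"] by simp
qed

text \<open>Normality of L over F: composing \<rho> with an element of the kernel does not change
  the character, hence does not change the values on L.\<close>

lemma abs_gal_L: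
  assumes "\<rho> \<in> abs_gal F" "x \<in> L"
  shows "\<rho> x \<in> L"
  unfolding cut_out_field_def
proof (intro CollectI ballI impI)
  fix \<tau> assume \<tau>: "\<tau> \<in> abs_gal F" "\<chi> \<tau> = 0"
  have 1: "(\<lambda>x. \<tau> (\<rho> x)) \<in> abs_gal F"
    using abs_gal_compose[OF \<tau>(1) assms(1)] .
  have "\<tau> (\<rho> \<alpha>) = \<zeta> ^ \<chi> \<rho> * \<alpha>"
    using \<chi>(2)[OF assms(1)] \<chi>(2)[OF \<tau>(1)] \<tau> hom_on_mult[OF field_set_UNIV abs_gal_hom[OF \<tau>(1)]]
      \<zeta>_power_fixed[OF \<tau>(1)] by simp
  then have "\<chi> (\<lambda>x. \<tau> (\<rho> x)) = \<chi> \<rho>"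
    using \<chi>_eqI[OF 1, of "\<chi> \<rho>"] \<chi>(1)[OF assms(1)] by simp
  from \<chi>_eq_imp_eq_on_L[OF 1 assms(1) this assms(2)] show "\<tau> (\<rho> x) = \<rho> x" .
qed

lemma gal_L:
  assumes "\<rho> \<in> abs_gal F"
  shows "restrict \<rho> L \<in> gal L F"
proof -
  have "bij_betw (restrict \<rho> L) L L"
    unfolding bij_betw_restrict_eq
    by (rule bij_betw_byWitness[where f' = "inv_into UNIV \<rho>"])
      (use abs_gal_L[OF assms] abs_gal_L[OF abs_gal_inv[OF assms]] abs_gal_inv_apply[OF assms] in auto)
  moreover have "hom_on L (restrict \<rho> L)"
    using hom_on_subset[OF abs_gal_hom[OF assms] subset_UNIV[of L]]
      hom_on_cong[OF field_set_L, of "restrict \<rho> L" \<rho>] by simp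
  ultimately show ?thesis
    using F_subset_L abs_gal_fixes[OF assms] by (auto simp: gal_iff)
qed

lemma char_generator:
  assumes "\<rho> \<in> abs_gal F" "\<chi> \<rho> = 1"
  shows "char_generator F \<chi> = restrict \<rho> L"
  unfolding char_generator_def
proof (rule the_equality)
  show "restrict \<rho> L \<in> gal L F \<and> (\<exists>\<tau>\<in>abs_gal F. \<chi> \<tau> = 1 \<and> restrict \<rho> L = restrict \<tau> L)"
    using gal_L assms by blast
next
  fix \<gamma> assume "\<gamma> \<in> gal L F \<and> (\<exists>\<tau>\<in>abs_gal F. \<chi> \<tau> = 1 \<and> \<gamma> = restrict \<tau> L)"
  then obtain \<tau> where "\<tau> \<in> abs_gal F" "\<chi> \<tau> = 1" "\<gamma> = restrict \<tau> L" by blast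
  then show "\<gamma> = restrict \<rho> L"
    using \<chi>_eq_imp_eq_on_L[OF _ assms(1)] assms(2) by (auto simp: restrict_def fun_eq_iff)
qed

text \<open>The character of \<rho>^k is k times that of \<rho>, and non-zero residues mod p are
  invertible.\<close>

lemma exists_generator:
  assumes "\<rho> \<in> abs_gal F" "\<chi> \<rho> \<noteq> 0"
  obtains \<rho>' where "\<rho>' \<in> abs_gal F" "\<chi> \<rho>' = 1"
proof -
  have "(\<rho> ^^ k) \<alpha> = (\<zeta> ^ \<chi> \<rho>) ^ k * \<alpha>" for k
    by (rule funpow_eigenvector[OF field_set_UNIV abs_gal_hom[OF assms(1)]])
      (use \<zeta>_power_fixed[OF assms(1)] \<chi>(2)[OF assms(1)] in auto)
  then have pow: "(\<rho> ^^ k) \<alpha> = \<zeta> ^ (k * \<chi> \<rho>) * \<alpha>" for k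
    by (simp add: power_mult[symmetric] mult.commute)
  have "\<not> p dvd \<chi> \<rho>"
    using assms(2) \<chi>(1)[OF assms(1)] nat_dvd_not_less by blast
  then obtain k where "(\<chi> \<rho> * k) mod p = 1"
    using mult_inverse_mod[OF p] by blast
  then have "(k * \<chi> \<rho>) mod p = 1"
    by (simp add: mult.commute)
  then have "\<chi> (\<rho> ^^ k) = 1"
    using \<chi>_eqI[OF abs_gal_funpow[OF assms(1)] pow] by simp
  then show ?thesis
    using that abs_gal_funpow[OF assms(1)] by blast
qed

lemma cyclic_algebra_simps:
  "carrier (cyclic_algebra F p \<chi> c) = {..<p} \<rightarrow>\<^sub>E L"
  "x \<otimes>\<^bsub>cyclic_algebra F p \<chi> c\<^esub> y = (\<lambda>k\<in>{..<p}. cyc_mult p (char_generator F \<chi>) c x y k)"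
  "\<zero>\<^bsub>cyclic_algebra F p \<chi> c\<^esub> = (\<lambda>k\<in>{..<p}. 0)"
  "x \<oplus>\<^bsub>cyclic_algebra F p \<chi> c\<^esub> y = (\<lambda>k\<in>{..<p}. x k + y k)"
  "b \<odot>\<^bsub>cyclic_algebra F p \<chi> c\<^esub> x = (\<lambda>k\<in>{..<p}. b * x k)"
  by (simp_all add: cyclic_algebra_def Let_def cyc_mult_def)

theorem symbol_norm:
  assumes "symbol_trivial F p \<chi> \<beta>"
    and M: "field_set M" "F \<subseteq> M" and s: "hom_on M s" "s ` M \<subseteq> M" "\<And>x. x \<in> F \<Longrightarrow> s x = x"
    and \<delta>: "\<delta> \<in> M" "\<delta> ^ p = \<beta>" "s \<delta> = \<zeta> * \<delta>" and \<beta>: "\<beta> \<in> F" "\<beta> \<noteq> 0"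
  obtains \<eta> where "\<eta> \<in> M" "(\<Prod>i<p. (s ^^ i) \<eta>) = a"
proof (cases "\<forall>\<rho>\<in>abs_gal F. \<chi> \<rho> = 0")
  \<comment> \<open>A trivial character means that \<alpha> is fixed by the whole group and so lies
    in F; then \<alpha> itself has norm \<alpha>^p = a.\<close>
  case True
  then have "\<alpha> \<in> F"
    using abs_gal_fixed_field[OF F alg] \<chi>(2) by simp
  moreover from this have "(s ^^ i) \<alpha> = \<alpha>" for i
    using funpow_fixed s(3) by metis
  ultimately show ?thesis
    using that[of \<alpha>] M(2) \<alpha> by auto
next
  case False
  then obtain \<rho> where \<rho>: "\<rho> \<in> abs_gal F" "\<chi> \<rho> = 1"
    using exists_generator by blast
  define \<gamma> where "\<gamma> = char_generator F \<chi>"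
  have \<gamma>: "\<gamma> = restrict \<rho> L"
    unfolding \<gamma>_def by (rule char_generator[OF \<rho>])
  have pow: "(\<gamma> ^^ n) x = (\<rho> ^^ n) x" if "x \<in> L" for n x
  proof (induction n)
    case (Suc n)
    then show ?case
      using abs_gal_L[OF abs_gal_funpow[OF \<rho>(1)] that] by (simp add: \<gamma>)
  qed simp
  have \<rho>\<alpha>: "(\<rho> ^^ n) \<alpha> = \<zeta> ^ n * \<alpha>" for n
    by (rule funpow_eigenvector[OF field_set_UNIV abs_gal_hom[OF \<rho>(1)]])
      (use abs_gal_fixes[OF \<rho>(1) \<zeta>(1)] \<chi>(2)[OF \<rho>(1)] \<rho>(2) in auto)
  have \<chi>_pow: "\<chi> (\<rho> ^^ n) = n mod p" for n
    using \<chi>_eqI[OF abs_gal_funpow[OF \<rho>(1)] \<rho>\<alpha>] .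
  have period: "(\<rho> ^^ (n + p)) x = (\<rho> ^^ n) x" if "x \<in> L" for n x
    by (rule \<chi>_eq_imp_eq_on_L[OF abs_gal_funpow[OF \<rho>(1)] abs_gal_funpow[OF \<rho>(1)] _ that]) (simp add: \<chi>_pow)
  \<comment> \<open>On L an automorphism \<tau> agrees with the power of \<rho> of exponent
    \<open>\<chi> \<tau>\<close>, so applying it only shifts a sum over a full period.\<close>
  have trace: "(\<Sum>i<p. (\<rho> ^^ i) x) \<in> F" if x: "x \<in> L" for x
  proof (rule abs_gal_fixed_field[OF F alg])
    fix \<tau> assume \<tau>: "\<tau> \<in> abs_gal F"
    have "\<tau> (\<Sum>i<p. (\<rho> ^^ i) x) = (\<Sum>i<p. \<tau> ((\<rho> ^^ i) x))"
      by (rule hom_on_sum[OF field_set_UNIV abs_gal_hom[OF \<tau>]]) simp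
    also have "\<dots> = (\<Sum>i<p. (\<rho> ^^ (i + \<chi> \<tau>)) x)"
    proof (rule sum.cong[OF refl])
      fix i
      have "\<chi> \<tau> = \<chi> (\<rho> ^^ \<chi> \<tau>)"
        using \<chi>_pow \<chi>(1)[OF \<tau>] by simp
      then have "\<tau> ((\<rho> ^^ i) x) = (\<rho> ^^ \<chi> \<tau>) ((\<rho> ^^ i) x)"
        by (rule \<chi>_eq_imp_eq_on_L[OF \<tau> abs_gal_funpow[OF \<rho>(1)] _ abs_gal_L[OF abs_gal_funpow[OF \<rho>(1)] x]])
      then show "\<tau> ((\<rho> ^^ i) x) = (\<rho> ^^ (i + \<chi> \<tau>)) x"
        by (simp add: funpow_add add.commute[of i])
    qed
    also have "\<dots> = (\<Sum>i<p. (\<rho> ^^ i) x)"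
      by (rule periodic_shift_sum) (rule period[OF x])
    finally show "\<tau> (\<Sum>i<p. (\<rho> ^^ i) x) = (\<Sum>i<p. (\<rho> ^^ i) x)" .
  qed
  have \<gamma>L: "\<gamma> x = \<rho> x" if "x \<in> L" for x
    using that by (simp add: \<gamma>)
  interpret cyclic_data F L M p \<gamma> s \<zeta> \<beta> \<delta> \<alpha> a
  proof
    show "hom_on L \<gamma>" "\<And>x. x \<in> F \<Longrightarrow> \<gamma> x = x"
      using gal_L[OF \<rho>(1)] unfolding \<gamma> gal_iff by auto
    show "\<gamma> ` L \<subseteq> L"
      using abs_gal_L[OF \<rho>(1)] \<gamma>L by auto
    show "(\<gamma> ^^ p) x = x" if "x \<in> L" for x
      using period[OF that, of 0] pow[OF that] by simp
    show "(\<Sum>i<p. (\<gamma> ^^ i) x) \<in> F" if "x \<in> L" for x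
      using trace[OF that] pow[OF that] by simp
    show "\<gamma> \<alpha> = \<zeta> * \<alpha>"
      using \<gamma>L[OF \<alpha>_in_L] \<rho>\<alpha>[of 1] by simp
  qed (use F field_set_L F_subset_L p \<zeta> \<alpha>_in_L \<alpha> assms in auto)
  let ?A = "cyclic_algebra F p \<chi> \<beta>"
  have A: "prealgebra ?A F"
  proof
    show "c \<odot>\<^bsub>?A\<^esub> x \<in> carrier ?A" if "c \<in> F" "x \<in> carrier ?A" for c x
      using that F_subset_L unfolding cyclic_algebra_simps
      by (auto intro!: field_set_mult[OF field_set_L])
    show "x \<otimes>\<^bsub>?A\<^esub> y \<in> carrier ?A" if "x \<in> carrier ?A" "y \<in> carrier ?A" for x y
    proof -
      have "cyc_mult p \<gamma> \<beta> x y k \<in> L" for k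
        by (rule cyc_mult_closed) (use that in \<open>auto simp: cyclic_algebra_simps\<close>)
      then show ?thesis
        unfolding cyclic_algebra_simps \<gamma>_def[symmetric] by auto
    qed
    have zero: "cyc_mult p \<gamma> \<beta> x (\<lambda>k\<in>{..<p}. 0) k = 0" "cyc_mult p \<gamma> \<beta> (\<lambda>k\<in>{..<p}. 0) x k = 0" for x k
      unfolding cyc_mult_def by (auto intro!: sum.neutral simp: hom_on_zero[OF field_set_L hom_\<gamma>])
    show "x \<otimes>\<^bsub>?A\<^esub> \<zero>\<^bsub>?A\<^esub> = \<zero>\<^bsub>?A\<^esub>" "\<zero>\<^bsub>?A\<^esub> \<otimes>\<^bsub>?A\<^esub> x = \<zero>\<^bsub>?A\<^esub>" for x
      unfolding cyclic_algebra_simps \<gamma>_def[symmetric] zero by simp_all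
  qed (auto simp: cyclic_algebra_simps field_set_intros[OF field_set_L] PiE_def Pi_iff extensional_def fun_eq_iff ac_simps)
  obtain m n where "m > 0" "n > 0" "algebra_iso F (matrix_algebra m ?A) (matrix_algebra n (base_algebra F))"
    using assms(1) False unfolding symbol_trivial_def brauer_equivalent_def by blast
  from split_rank_one[OF A F this] obtain r where r: "r \<in> carrier ?A" "r \<noteq> \<zero>\<^bsub>?A\<^esub>"
    and rank_one: "\<forall>z\<in>carrier ?A. \<exists>c\<in>F. (r \<otimes>\<^bsub>?A\<^esub> z) \<otimes>\<^bsub>?A\<^esub> r = c \<odot>\<^bsub>?A\<^esub> r"
    by blast
  have rL: "r k \<in> L" if "k < p" for k
    using r(1) that unfolding cyclic_algebra_simps by auto
  have "\<exists>k<p. r k \<noteq> 0"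
  proof (rule ccontr)
    assume "\<not> ?thesis"
    then have "r = (\<lambda>k\<in>{..<p}. 0)"
      using r(1) unfolding cyclic_algebra_simps by (auto simp: PiE_def extensional_def fun_eq_iff)
    with r(2) show False
      unfolding cyclic_algebra_simps by simp
  qed
  then obtain k0 where k0: "k0 < p" "r k0 \<noteq> 0"
    by blast
  \<comment> \<open>Bridges the extensional families of \<open>cyclic_algebra\<close> and the
    unrestricted ones of \<open>cyc_mult\<close>.\<close>
  have cong: "cyc_mult p \<gamma> \<beta> f h = cyc_mult p \<gamma> \<beta> f' h'"
    if "\<And>k. k < p \<Longrightarrow> f k = f' k" "\<And>k. k < p \<Longrightarrow> h k = h' k" for f f' h h'
    unfolding cyc_mult_def fun_eq_iff by (auto intro!: sum.cong simp: that)
  show ?thesis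
  proof (rule norm_from_rank_one[of r k0])
    fix z :: "nat \<Rightarrow> 'a"
    assume z: "\<And>k. k < p \<Longrightarrow> z k \<in> L"
    define z' where "z' = restrict z {..<p}"
    have "z' \<in> carrier ?A"
      using z unfolding z'_def cyclic_algebra_simps by auto
    then obtain c where c: "c \<in> F" "(r \<otimes>\<^bsub>?A\<^esub> z') \<otimes>\<^bsub>?A\<^esub> r = c \<odot>\<^bsub>?A\<^esub> r"
      using rank_one by blast
    have "cyc_mult p \<gamma> \<beta> (\<lambda>k\<in>{..<p}. cyc_mult p \<gamma> \<beta> r z' k) r = cyc_mult p \<gamma> \<beta> (cyc_mult p \<gamma> \<beta> r z) r"
      using cong[of r r z' z] by (intro cong) (auto simp: z'_def)
    then have "\<forall>k<p. cyc_mult p \<gamma> \<beta> (cyc_mult p \<gamma> \<beta> r z) r k = c * r k"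
      using c(2) unfolding cyclic_algebra_simps \<gamma>_def[symmetric] by (metis lessThan_iff restrict_apply')
    with c(1) show "\<exists>c\<in>F. \<forall>k<p. cyc_mult p \<gamma> \<beta> (cyc_mult p \<gamma> \<beta> r z) r k = c * r k"
      by blast
  qed (fact rL k0 that)+
qed

end

subsection \<open>The Galois group of order \<open>p (p - 1)\<close>\<close>

lemma bij_betw_affine_mod:
  assumes "coprime k (p :: nat)" "p > 0"
  shows "bij_betw (\<lambda>i. (k * i + l) mod p) {..<p} {..<p}"
proof -
  have "inj_on (\<lambda>i. (k * i + l) mod p) {..<p}"
  proof (rule inj_onI)
    fix i j assume ij: "i \<in> {..<p}" "j \<in> {..<p}" "(k * i + l) mod p = (k * j + l) mod p"
    then have "[k * i + l = k * j + l] (mod p)" by (simp add: cong_def)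
    then have "[i = j] (mod p)"
      using assms(1) cong_mult_lcancel_nat cong_add_rcancel_nat by blast
    with ij show "i = j" by (simp add: cong_def)
  qed
  moreover have "(\<lambda>i. (k * i + l) mod p) ` {..<p} \<subseteq> {..<p}"
    using assms(2) by auto
  ultimately show ?thesis
    by (metis bij_betw_def endo_inj_surj finite_lessThan)
qed

text \<open>What the curve contributes, in terms of fields only. As \<sigma> and \<tau> are
  meaningful just on M, \<open>generate\<close> compares restrictions to M. The element
  \<open>t\<close> witnesses that \<sigma> is not a power of \<tau>, in particular not the
  identity.\<close>

locale galois_data =
  fixes K L1 M :: "'a::{alg_closed_field,field_char_0} set" and p g :: nat
    and \<sigma> \<tau> :: "'a \<Rightarrow> 'a" and \<zeta> \<delta> \<beta> t :: 'a
  assumes K: "field_set K" and alg: "algebraic_over K" and KM: "K \<subseteq> M"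
    and p: "Factorial_Ring.prime p" "odd p" and g: "coprime g p"
    and \<zeta>: "\<zeta> ^ p = 1" "\<zeta> \<noteq> 1"
    and L1: "L1 = adjoin K {\<zeta>}" and M: "M = adjoin L1 {\<delta>}"
    and \<delta>: "\<delta> ^ p = \<beta>" and \<beta>: "\<beta> \<in> L1" "\<beta> \<noteq> 0"
    and \<sigma>: "hom_on M \<sigma>" "\<sigma> ` M \<subseteq> M" "\<And>x. x \<in> K \<Longrightarrow> \<sigma> x = x"
    and \<tau>: "hom_on M \<tau>" "\<tau> ` M \<subseteq> M" "\<And>x. x \<in> K \<Longrightarrow> \<tau> x = x"
    and generate: "\<And>\<rho>. \<rho> \<in> abs_gal K \<Longrightarrow> \<exists>i j. \<forall>x\<in>M. \<rho> x = (\<sigma> ^^ i) ((\<tau> ^^ j) x)"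
    and \<sigma>_order: "\<And>x. x \<in> M \<Longrightarrow> (\<sigma> ^^ p) x = x"
    and \<tau>_order: "\<And>x. x \<in> M \<Longrightarrow> (\<tau> ^^ (p - 1)) x = x"
    and commute: "\<And>x. x \<in> M \<Longrightarrow> \<sigma> (\<tau> x) = \<tau> ((\<sigma> ^^ g) x)"
    and t: "t \<in> M" "\<And>j. \<sigma> t \<noteq> (\<tau> ^^ j) t"
begin

definition L2 :: "'a set" where
  "L2 = {x \<in> M. \<tau> x = x}"

lemma p_pos: "p > 0" and p_gt_1: "p > 1"
  using p by (simp_all add: prime_gt_0_nat prime_gt_Suc_0_nat)

lemma field_set_L1: "field_set L1" and field_set_M: "field_set M"
  by (simp_all add: L1 M field_set_adjoin)

lemma K_subset_L1: "K \<subseteq> L1" and \<zeta>_in_L1: "\<zeta> \<in> L1" and L1_subset_M: "L1 \<subseteq> M" and \<delta>_in_M: "\<delta> \<in> M"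
  using adjoin_superset[of K "{\<zeta>}"] adjoin_superset[of "{\<zeta>}" K]
    adjoin_superset[of L1 "{\<delta>}"] adjoin_superset[of "{\<delta>}" L1]
  unfolding L1 M by auto

lemma \<delta>_nz: "\<delta> \<noteq> 0"
  using \<delta> \<beta> p_pos by auto

lemmas \<sigma>_closed = funpow_closed[OF \<sigma>(2)] and \<tau>_closed = funpow_closed[OF \<tau>(2)]
  and hom_\<sigma> = hom_on_funpow[OF \<sigma>(1,2)] and hom_\<tau> = hom_on_funpow[OF \<tau>(1,2)]
  and \<sigma>_K = funpow_fixed[of \<sigma>, OF \<sigma>(3)] and \<tau>_K = funpow_fixed[of \<tau>, OF \<tau>(3)]

lemmas \<sigma>_mod = funpow_mod_eq[OF \<sigma>_order]

lemma \<sigma>_\<tau>: "x \<in> M \<Longrightarrow> (\<sigma> ^^ i) (\<tau> x) = \<tau> ((\<sigma> ^^ (g * i)) x)"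
proof (induction i)
  case (Suc i)
  have "(\<sigma> ^^ Suc i) (\<tau> x) = \<sigma> (\<tau> ((\<sigma> ^^ (g * i)) x))"
    using Suc by simp
  also have "\<dots> = \<tau> ((\<sigma> ^^ (g + g * i)) x)"
    using commute[OF \<sigma>_closed[OF Suc.prems]] by (simp add: funpow_add)
  finally show ?case by simp
qed simp

lemma \<sigma>_\<tau>_pow: "x \<in> M \<Longrightarrow> (\<sigma> ^^ i) ((\<tau> ^^ j) x) = (\<tau> ^^ j) ((\<sigma> ^^ (g ^ j * i)) x)"
proof (induction j arbitrary: i)
  case (Suc j)
  have "(\<sigma> ^^ i) ((\<tau> ^^ Suc j) x) = \<tau> ((\<sigma> ^^ (g * i)) ((\<tau> ^^ j) x))"
    using \<sigma>_\<tau>[OF \<tau>_closed[OF Suc.prems]] by simp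
  then show ?case
    using Suc by (simp add: mult_ac)
qed simp

lemma root_of_unity_image:
  assumes "hom_on M f" "x \<in> M" "x ^ p \<in> L1" "x \<noteq> 0" "f (x ^ p) = x ^ p"
  obtains i where "i < p" "f x = \<zeta> ^ i * x"
proof -
  have "(f x) ^ p = x ^ p"
    using hom_on_power[OF field_set_M assms(1,2), of p] assms(5) by simp
  then have "(f x / x) ^ p = 1"
    using assms(4) by (simp add: power_divide)
  then obtain i where "i < p" "f x / x = \<zeta> ^ i"
    using roots_of_unity[OF p(1) \<zeta>] by blast
  with assms(4) that show ?thesis by (simp add: field_simps)
qed

text \<open>\<sigma> raises \<zeta> to some power c. Its order gives c^p = 1 mod p, while Fermat
  gives c^p = c, so c = 1 mod p.\<close>

lemma \<sigma>_\<zeta>: "\<sigma> \<zeta> = \<zeta>"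
proof -
  have \<zeta>M: "\<zeta> \<in> M"
    using \<zeta>_in_L1 L1_subset_M by blast
  have "(\<sigma> \<zeta>) ^ p = 1"
    using hom_on_power[OF field_set_M \<sigma>(1) \<zeta>M, of p] \<zeta>(1) hom_on_one[OF field_set_M \<sigma>(1)] by simp
  then obtain c where c: "\<sigma> \<zeta> = \<zeta> ^ c"
    using roots_of_unity[OF p(1) \<zeta>] by blast
  have "(\<sigma> ^^ n) \<zeta> = \<zeta> ^ (c ^ n)" for n
  proof (induction n)
    case (Suc n)
    then show ?case
      using hom_on_power[OF field_set_M \<sigma>(1) \<zeta>M] c by (simp add: power_mult[symmetric])
  qed simp
  then have "\<zeta> ^ (c ^ p) = \<zeta> ^ 1"
    using \<sigma>_order[OF \<zeta>M] by simp
  then have cp: "c ^ p mod p = 1"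
    using root_of_unity_power_eq_iff[OF p(1) \<zeta>, of "c ^ p" 1] p_gt_1 by simp
  have "\<not> p dvd c"
  proof
    assume "p dvd c"
    then have "c ^ p mod p = 0"
      using p_pos by (simp add: dvd_power_le dvd_imp_mod_0 dvd_trans dvd_power)
    with cp show False by simp
  qed
  then have "[c ^ (p - 1) = 1] (mod p)"
    using fermat_theorem[OF p(1)] by simp
  then have "[c * c ^ (p - 1) = c * 1] (mod p)"
    by (rule cong_scalar_left)
  moreover have "c * c ^ (p - 1) = c ^ p"
    using p_pos by (metis power_eq_if neq0_conv)
  ultimately have "c mod p = 1 mod p"
    using cp p_gt_1 by (simp add: cong_def)
  then have "\<zeta> ^ c = \<zeta> ^ 1"
    using root_of_unity_power_eq_iff[OF p(1) \<zeta>] by blast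
  with c show ?thesis by simp
qed

lemma \<sigma>_L1: "x \<in> L1 \<Longrightarrow> (\<sigma> ^^ n) x = x"
  using hom_on_eq_adjoin[OF field_set_M \<sigma>(1) hom_on_id, of K "{\<zeta>}" x] L1_subset_M \<sigma>(3) \<sigma>_\<zeta>
  unfolding L1 by (intro funpow_fixed) auto

lemma eq_on_M:
  assumes "hom_on M f" "hom_on M h" "\<And>x. x \<in> L1 \<Longrightarrow> f x = h x" "f \<delta> = h \<delta>" "x \<in> M"
  shows "f x = h x"
  using hom_on_eq_adjoin[OF field_set_M assms(1,2), of L1 "{\<delta>}" x] assms(3-5) unfolding M by auto

text \<open>If p divided \<open>e\<close>, then \<sigma> would fix L1 and \<delta>, hence all of M,
  contradicting the property of \<open>t\<close> for j = 0.\<close>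

lemma \<sigma>_\<delta>:
  obtains e where "\<not> p dvd e" "\<And>n. (\<sigma> ^^ n) \<delta> = \<zeta> ^ (n * e) * \<delta>"
proof -
  have "\<sigma> (\<delta> ^ p) = \<delta> ^ p"
    using \<sigma>_L1[OF \<beta>(1), of 1] \<delta> by simp
  then obtain e where e: "\<sigma> \<delta> = \<zeta> ^ e * \<delta>"
    using root_of_unity_image[OF \<sigma>(1) \<delta>_in_M _ \<delta>_nz] \<delta> \<beta>(1) by metis
  have "(\<sigma> ^^ n) \<delta> = (\<zeta> ^ e) ^ n * \<delta>" for n
    using \<sigma>_L1[OF field_set_power[OF field_set_L1 \<zeta>_in_L1], of 1] L1_subset_M \<zeta>_in_L1
    by (intro funpow_eigenvector[OF field_set_M \<sigma>(1) \<delta>_in_M] field_set_power[OF field_set_M] e) auto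
  then have pow: "(\<sigma> ^^ n) \<delta> = \<zeta> ^ (n * e) * \<delta>" for n
    by (simp add: power_mult[symmetric] mult.commute)
  have "\<not> p dvd e"
  proof
    assume "p dvd e"
    then have "\<zeta> ^ e = 1"
      using root_of_unity_eq_1_iff[OF p(1) \<zeta>] by blast
    then have "\<sigma> \<delta> = \<delta>" using e by simp
    moreover have "\<sigma> x = x" if "x \<in> L1" for x
      using \<sigma>_L1[OF that, of 1] by simp
    ultimately have "\<sigma> t = t"
      using eq_on_M[OF \<sigma>(1) hom_on_id _ _ t(1)] by blast
    with t(2)[of 0] show False by simp
  qed
  with pow that show ?thesis by blast
qed

text \<open>Such a map is determined by the root of unity by which it multiplies \<delta>; since
  \<open>e\<close> is invertible mod p, some power of \<sigma> produces the same one.\<close>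

lemma hom_fixing_L1:
  assumes "hom_on M f" "\<And>x. x \<in> L1 \<Longrightarrow> f x = x"
  obtains i where "i < p" "\<And>x. x \<in> M \<Longrightarrow> f x = (\<sigma> ^^ i) x"
proof -
  obtain e where e: "\<not> p dvd e" "\<And>n. (\<sigma> ^^ n) \<delta> = \<zeta> ^ (n * e) * \<delta>"
    using \<sigma>_\<delta> by blast
  obtain l where l: "l < p" "f \<delta> = \<zeta> ^ l * \<delta>"
    using root_of_unity_image[OF assms(1) \<delta>_in_M _ \<delta>_nz] assms(2)[OF \<beta>(1)] \<delta> \<beta>(1) by metis
  obtain k where k: "(e * k) mod p = 1"
    using mult_inverse_mod[OF p(1) e(1)] .
  define i where "i = (k * l) mod p"
  have "(i * e) mod p = ((e * k) mod p * l) mod p"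
    unfolding i_def by (simp add: mod_mult_left_eq mod_mult_right_eq mult_ac)
  then have "\<zeta> ^ (i * e) = \<zeta> ^ l"
    using root_of_unity_power_eq_iff[OF p(1) \<zeta>] k by simp
  then have "f \<delta> = (\<sigma> ^^ i) \<delta>"
    using l(2) e(2) by simp
  then have "f x = (\<sigma> ^^ i) x" if "x \<in> M" for x
    using eq_on_M[OF assms(1) hom_\<sigma> _ _ that] assms(2) \<sigma>_L1 by simp
  moreover have "i < p"
    using p_pos by (simp add: i_def)
  ultimately show ?thesis using that by blast
qed

text \<open>The norm from M to L1 and, on elements of L2, at the same time the norm from L2 to
  K.\<close>

definition conj_prod :: "'a \<Rightarrow> 'a" where
  "conj_prod x = (\<Prod>i<p. (\<sigma> ^^ i) x)"

lemma conj_prod_closed: "x \<in> M \<Longrightarrow> conj_prod x \<in> M"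
  unfolding conj_prod_def by (intro field_set_prod[OF field_set_M] \<sigma>_closed)

lemma conj_prod_reindex:
  assumes "x \<in> M" "coprime k p"
  shows "(\<Prod>i<p. (\<sigma> ^^ (k * i + l)) x) = conj_prod x"
proof -
  have "(\<Prod>i<p. (\<sigma> ^^ (k * i + l)) x) = (\<Prod>i<p. (\<sigma> ^^ ((k * i + l) mod p)) x)"
    using \<sigma>_mod[OF assms(1)] by simp
  also have "\<dots> = conj_prod x"
    unfolding conj_prod_def
    using prod.reindex_bij_betw[OF bij_betw_affine_mod[OF assms(2) p_pos], of "\<lambda>i. (\<sigma> ^^ i) x"] by simp
  finally show ?thesis .
qed

lemma conj_prod_shift: "x \<in> M \<Longrightarrow> (\<Prod>i<p. (\<sigma> ^^ (i + l)) x) = conj_prod x"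
  using conj_prod_reindex[of x 1] by simp

lemma conj_prod_mult_index: "x \<in> M \<Longrightarrow> coprime k p \<Longrightarrow> (\<Prod>i<p. (\<sigma> ^^ (k * i)) x) = conj_prod x"
  using conj_prod_reindex[of x k 0] by simp

lemma conj_prod_mult:
  "x \<in> M \<Longrightarrow> y \<in> M \<Longrightarrow> conj_prod (x * y) = conj_prod x * conj_prod y"
  by (simp add: conj_prod_def hom_on_mult[OF field_set_M hom_\<sigma>] prod.distrib)

lemma conj_prod_divide:
  "x \<in> M \<Longrightarrow> y \<in> M \<Longrightarrow> conj_prod (x / y) = conj_prod x / conj_prod y"
  by (simp add: conj_prod_def hom_on_divide[OF field_set_M hom_\<sigma>] prod_dividef)

lemma conj_prod_power: "x \<in> M \<Longrightarrow> conj_prod (x ^ n) = conj_prod x ^ n"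
  by (simp add: conj_prod_def hom_on_power[OF field_set_M hom_\<sigma>] prod_power_distrib)

lemma conj_prod_K: "x \<in> K \<Longrightarrow> conj_prod x = x ^ p"
  by (simp add: conj_prod_def \<sigma>_K)

lemma conj_prod_nz: "x \<in> M \<Longrightarrow> x \<noteq> 0 \<Longrightarrow> conj_prod x \<noteq> 0"
  by (simp add: conj_prod_def hom_on_eq_0_iff[OF field_set_M hom_\<sigma>])

text \<open>Elements of \<open>abs_gal L1\<close> act on M as powers of \<sigma> and permute the
  factors. This places the norm of a changed representative in L1.\<close>

lemma conj_prod_in_L1:
  assumes "x \<in> M"
  shows "conj_prod x \<in> L1"
proof (rule abs_gal_fixed_field[OF field_set_L1 algebraic_over_mono[OF alg K_subset_L1]])
  fix \<rho> assume \<rho>: "\<rho> \<in> abs_gal L1"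
  then obtain k where k: "\<And>x. x \<in> M \<Longrightarrow> \<rho> x = (\<sigma> ^^ k) x"
    using hom_fixing_L1[of \<rho>] hom_on_subset[OF abs_gal_hom[OF \<rho>] subset_UNIV] abs_gal_fixes[OF \<rho>] by metis
  have "\<rho> (conj_prod x) = (\<Prod>i<p. (\<sigma> ^^ k) ((\<sigma> ^^ i) x))"
    unfolding k[OF conj_prod_closed[OF assms]] unfolding conj_prod_def
    by (rule hom_on_prod[OF field_set_M hom_\<sigma>]) (rule \<sigma>_closed[OF assms])
  also have "\<dots> = (\<Prod>i<p. (\<sigma> ^^ (i + k)) x)"
    by (simp add: funpow_add[symmetric] add.commute[of k] flip: o_apply[of "\<sigma> ^^ k"])
  finally show "\<rho> (conj_prod x) = conj_prod x"
    using conj_prod_shift[OF assms] by simp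
qed

lemma prod_over_conjugates:
  assumes "field_set G" "G \<subseteq> M" "x \<in> G"
    and "\<And>f. f \<in> embeddings G F \<longleftrightarrow> (\<exists>i<p. f = restrict (\<sigma> ^^ i) G)"
    and "\<And>i j. i < p \<Longrightarrow> j < p \<Longrightarrow> \<forall>y\<in>G. (\<sigma> ^^ i) y = (\<sigma> ^^ j) y \<Longrightarrow> i = j"
  shows "field_norm G F x = conj_prod x"
proof -
  have "embeddings G F = (\<lambda>i. restrict (\<sigma> ^^ i) G) ` {..<p}"
    using assms(4) by blast
  moreover have "inj_on (\<lambda>i. restrict (\<sigma> ^^ i) G) {..<p}"
  proof (rule inj_onI)
    fix i j
    assume ij: "i \<in> {..<p}" "j \<in> {..<p}" "restrict (\<sigma> ^^ i) G = restrict (\<sigma> ^^ j) G"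
    have "\<forall>y\<in>G. (\<sigma> ^^ i) y = (\<sigma> ^^ j) y"
      using ij(3) by (metis restrict_apply')
    with ij(1,2) show "i = j"
      using assms(5) by simp
  qed
  ultimately show ?thesis
    using assms(3) unfolding field_norm_def conj_prod_def by (simp add: prod.reindex)
qed

lemma restrict_embedding:
  assumes "field_set G" "G \<subseteq> M" "\<And>x. x \<in> F \<Longrightarrow> x \<in> G \<and> (\<sigma> ^^ i) x = x"
  shows "restrict (\<sigma> ^^ i) G \<in> embeddings G F"
  using hom_on_cong[OF assms(1), of "restrict (\<sigma> ^^ i) G" "\<sigma> ^^ i"] hom_on_subset[OF hom_\<sigma> assms(2)] assms(3)
  by (auto simp: embeddings_iff)

lemma field_norm_M:
  assumes "x \<in> M"
  shows "field_norm M L1 x = conj_prod x"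
proof (rule prod_over_conjugates[OF field_set_M subset_refl assms])
  fix f
  show "f \<in> embeddings M L1 \<longleftrightarrow> (\<exists>i<p. f = restrict (\<sigma> ^^ i) M)"
  proof
    assume f: "f \<in> embeddings M L1"
    then obtain i where i: "i < p" "\<And>x. x \<in> M \<Longrightarrow> f x = (\<sigma> ^^ i) x"
      using hom_fixing_L1[of f] unfolding embeddings_iff by metis
    then have "f = restrict (\<sigma> ^^ i) M"
      using f by (auto simp: embeddings_iff extensional_def fun_eq_iff)
    with i(1) show "\<exists>i<p. f = restrict (\<sigma> ^^ i) M" by blast
  next
    assume "\<exists>i<p. f = restrict (\<sigma> ^^ i) M"
    then show "f \<in> embeddings M L1"
      using restrict_embedding[OF field_set_M subset_refl] L1_subset_M \<sigma>_L1 by blast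
  qed
next
  fix i j assume ij: "i < p" "j < p" "\<forall>y\<in>M. (\<sigma> ^^ i) y = (\<sigma> ^^ j) y"
  obtain e where e: "\<not> p dvd e" "\<And>n. (\<sigma> ^^ n) \<delta> = \<zeta> ^ (n * e) * \<delta>"
    using \<sigma>_\<delta> by blast
  have "\<zeta> ^ (i * e) = \<zeta> ^ (j * e)"
    using bspec[OF ij(3) \<delta>_in_M] \<delta>_nz unfolding e(2) by simp
  then have "[i * e = j * e] (mod p)"
    using root_of_unity_power_eq_iff[OF p(1) \<zeta>] by (simp add: cong_def)
  moreover have "coprime e p"
    using e(1) p(1) prime_imp_coprime_nat coprime_commute by blast
  ultimately have "[i = j] (mod p)"
    using cong_mult_rcancel_nat by blast
  with ij show "i = j" by (simp add: cong_def)
qed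

section \<open>The fixed field of \<tau> and its norm to K\<close>

lemma field_set_L2: "field_set L2"
  unfolding L2_def by (rule field_set_equalizer[OF field_set_M \<tau>(1) hom_on_id])

lemma L2_subset_M: "L2 \<subseteq> M" and K_subset_L2: "K \<subseteq> L2"
  using KM \<tau>(3) by (auto simp: L2_def)

lemma \<tau>_L2: "x \<in> L2 \<Longrightarrow> (\<tau> ^^ n) x = x"
  by (simp add: L2_def funpow_fixed)

lemma \<tau>_prod_in_L2:
  assumes "x \<in> M"
  shows "(\<Prod>j<p - 1. (\<tau> ^^ j) x) \<in> L2"
proof -
  let ?P = "\<Prod>j<p - 1. (\<tau> ^^ j) x"
  have "\<tau> ?P = (\<Prod>j<p - 1. (\<tau> ^^ Suc j) x)"
    using hom_on_prod[OF field_set_M \<tau>(1), of "{..<p - 1}" "\<lambda>j. (\<tau> ^^ j) x"] \<tau>_closed[OF assms] by simp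
  moreover have "x * (\<Prod>j<p - 1. (\<tau> ^^ Suc j) x) = ?P * (\<tau> ^^ (p - 1)) x"
    using prod.lessThan_Suc_shift[of "\<lambda>j. (\<tau> ^^ j) x" "p - 1"] by simp
  ultimately have "x * \<tau> ?P = x * ?P"
    using \<tau>_order[OF assms] by (simp add: mult.commute)
  \<comment> \<open>Rotation of the product was expressed after multiplication by x, so x = 0 is
    separate; there the factor of index 0 vanishes, and p > 1 ensures that it occurs.\<close>
  moreover have "\<tau> ?P = ?P" if "x = 0"
  proof -
    have "(\<tau> ^^ 0) x = 0" "0 \<in> {..<p - 1}"
      using that p_gt_1 by simp_all
    then have "?P = 0"
      by (intro prod_zero finite_lessThan) (rule bexI)
    then show ?thesis
      using hom_on_zero[OF field_set_M \<tau>(1)] by (simp only:)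
  qed
  ultimately have "\<tau> ?P = ?P" by auto
  moreover have "?P \<in> M"
    by (intro field_set_prod[OF field_set_M] \<tau>_closed assms)
  ultimately show ?thesis
    by (simp add: L2_def)
qed

text \<open>If \<open>\<sigma>\<close> fixed \<open>L2\<close>, the polynomial with roots \<open>\<tau>\<^sup>j t\<close> would have \<open>\<sigma> t\<close> as a root.\<close>

lemma \<sigma>_moves_L2: "\<exists>x\<in>L2. \<sigma> x \<noteq> x"
proof (rule ccontr)
  assume "\<not> ?thesis"
  then have fixed: "\<sigma> x = x" if "x \<in> L2" for x
    using that by blast
  define P Q where "P = (\<Prod>j<p - 1. [:- (\<tau> ^^ j) t, 1:])" and "Q = (\<Prod>j<p - 1. [:- \<sigma> ((\<tau> ^^ j) t), 1:])"
  \<comment> \<open>Comparing values at c in K instead of coefficients: P(c) is the product of the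
    \<tau>^j (c - t), so it lies in L2, and K is infinite in characteristic 0.\<close>
  have "poly P c = poly Q c" if c: "c \<in> K" for c
  proof -
    have cM: "c \<in> M" using c KM by blast
    have \<tau>c: "(\<tau> ^^ j) (c - t) = c - (\<tau> ^^ j) t" for j
      using hom_on_diff[OF field_set_M hom_\<tau> cM t(1)] \<tau>_K[OF c] by simp
    have P: "poly P c = (\<Prod>j<p - 1. (\<tau> ^^ j) (c - t))"
      unfolding P_def poly_prod \<tau>c by simp
    have "poly P c = \<sigma> (poly P c)"
      unfolding P using fixed[OF \<tau>_prod_in_L2[OF field_set_diff[OF field_set_M cM t(1)]]] by simp
    also have "\<dots> = (\<Prod>j<p - 1. \<sigma> ((\<tau> ^^ j) (c - t)))"
      unfolding P by (rule hom_on_prod[OF field_set_M \<sigma>(1)])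
        (intro \<tau>_closed field_set_diff[OF field_set_M] cM t)
    also have "\<dots> = poly Q c"
      unfolding Q_def poly_prod \<tau>c using hom_on_diff[OF field_set_M \<sigma>(1) cM \<tau>_closed[OF t(1)]] \<sigma>(3)[OF c] by simp
    finally show ?thesis .
  qed
  then have "K \<subseteq> {c. poly (P - Q) c = 0}" by auto
  moreover have "infinite K"
  proof
    assume "finite K"
    then have "finite (range (of_nat :: nat \<Rightarrow> 'a))"
      by (rule rev_finite_subset) (auto intro: field_set_of_nat[OF K])
    then show False
      using inj_of_nat finite_imageD infinite_UNIV_nat by blast
  qed
  ultimately have "P - Q = 0"
    using poly_roots_finite finite_subset by blast
  then have "poly P (\<sigma> t) = poly Q (\<sigma> t)" by simp
  also have "\<dots> = 0"
    unfolding Q_def poly_prod using p_gt_1 by (auto intro!: bexI[of _ 0])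
  finally obtain j where "\<sigma> t = (\<tau> ^^ j) t"
    unfolding P_def poly_prod by auto
  with t(2) show False by blast
qed

text \<open>An embedding extends to the algebraic closure and acts on M as \<sigma>^i \<tau>^j,
  where \<tau>^j is trivial on L2. If two powers of \<sigma> with exponents below p agreed on L2,
  some \<sigma>^k with k prime to p, and with it \<sigma>, would be trivial there.\<close>

lemma field_norm_L2:
  assumes "x \<in> L2"
  shows "field_norm L2 K x = conj_prod x"
proof (rule prod_over_conjugates[OF field_set_L2 L2_subset_M assms])
  fix f
  show "f \<in> embeddings L2 K \<longleftrightarrow> (\<exists>i<p. f = restrict (\<sigma> ^^ i) L2)"
  proof
    assume f: "f \<in> embeddings L2 K"
    then have "hom_on L2 f" "\<And>x. x \<in> K \<Longrightarrow> f x = x"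
      by (auto simp: embeddings_iff)
    then obtain \<rho> where \<rho>: "\<rho> \<in> abs_gal K" "\<forall>x\<in>L2. \<rho> x = f x"
      using extend_abs_gal[OF K alg K_subset_L2 field_set_L2] by metis
    obtain i j where ij: "\<forall>x\<in>M. \<rho> x = (\<sigma> ^^ i) ((\<tau> ^^ j) x)"
      using generate[OF \<rho>(1)] by blast
    have "f x = (\<sigma> ^^ (i mod p)) x" if "x \<in> L2" for x
    proof -
      have "x \<in> M" using that L2_subset_M by blast
      then have "\<rho> x = (\<sigma> ^^ (i mod p)) x"
        using ij unfolding \<sigma>_mod[OF \<open>x \<in> M\<close>] by (simp add: \<tau>_L2[OF that])
      then show ?thesis
        using that \<rho>(2) by simp
    qed
    then have "f = restrict (\<sigma> ^^ (i mod p)) L2"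
      using f by (auto simp: embeddings_iff extensional_def fun_eq_iff)
    then show "\<exists>i<p. f = restrict (\<sigma> ^^ i) L2"
      using p_pos mod_less_divisor by blast
  next
    assume "\<exists>i<p. f = restrict (\<sigma> ^^ i) L2"
    then show "f \<in> embeddings L2 K"
      using restrict_embedding[OF field_set_L2 L2_subset_M] K_subset_L2 \<sigma>_K by blast
  qed
next
  have wlog: "False" if ij: "i < j" "j < p" "\<forall>y\<in>L2. (\<sigma> ^^ i) y = (\<sigma> ^^ j) y" for i j
  proof -
    define k where "k = j - i"
    have fixed: "(\<sigma> ^^ k) y = y" if "y \<in> L2" for y
    proof -
      have yM: "y \<in> M" using that L2_subset_M by blast
      have "(\<sigma> ^^ i) ((\<sigma> ^^ k) y) = (\<sigma> ^^ j) y"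
        using ij(1) by (simp add: k_def flip: o_apply[of "\<sigma> ^^ i"] funpow_add)
      also have "\<dots> = (\<sigma> ^^ i) y"
        using ij(3) that by simp
      finally show ?thesis
        using hom_on_inj[OF field_set_M hom_\<sigma>] \<sigma>_closed yM by (meson inj_onD)
    qed
    have "\<not> p dvd k"
      using ij(1,2) by (simp add: k_def nat_dvd_not_less)
    then obtain l where l: "(k * l) mod p = 1"
      using mult_inverse_mod[OF p(1)] by blast
    have "\<sigma> y = y" if "y \<in> L2" for y
    proof -
      have yM: "y \<in> M" using that L2_subset_M by blast
      have "(\<sigma> ^^ (k * n)) y = y" for n
        by (induction n) (simp_all add: funpow_add fixed[OF that])
      then show ?thesis
        using \<sigma>_mod[OF yM, of "k * l"] l by simp
    qed
    with \<sigma>_moves_L2 show False by blast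
  qed
  fix i j assume "i < p" "j < p" "\<forall>y\<in>L2. (\<sigma> ^^ i) y = (\<sigma> ^^ j) y"
  then show "i = j"
    using wlog[of i j] wlog[of j i] by (metis linorder_neqE_nat)
qed

lemma norm_from_L2:
  assumes a: "a \<in> K" "a \<noteq> 0" and \<Delta>: "symbol_trivial L1 p (kummer_char p \<zeta> a) \<beta>"
  obtains \<xi> where "\<xi> \<in> L2" "conj_prod \<xi> = a"
proof -
  obtain \<alpha> where \<alpha>: "\<alpha> ^ p = a"
    using nth_root_exists[OF p_pos] by blast
  interpret kum: kummer L1 p \<zeta> \<alpha> a
    by unfold_locales
      (use field_set_L1 algebraic_over_mono[OF alg K_subset_L1] p \<zeta>_in_L1 \<zeta> a K_subset_L1 \<alpha> in auto)
  obtain e where e: "\<not> p dvd e" "\<And>n. (\<sigma> ^^ n) \<delta> = \<zeta> ^ (n * e) * \<delta>"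
    using \<sigma>_\<delta> by blast
  \<comment> \<open>\<open>symbol_norm\<close> expects an automorphism multiplying \<delta> by
    \<zeta> itself; \<sigma> only does so by \<zeta>^e, and \<sigma>^k corrects this.\<close>
  obtain k where k: "(e * k) mod p = 1"
    using mult_inverse_mod[OF p(1) e(1)] .
  have "coprime k p"
    using k p(1) by (metis coprime_commute dvd_mult mod_0_imp_dvd dvd_imp_mod_0 prime_imp_coprime_nat zero_neq_one)
  have "\<zeta> ^ (k * e) = \<zeta> ^ 1"
    using root_of_unity_power_eq_iff[OF p(1) \<zeta>, of "k * e" 1] k p_gt_1 by (simp add: mult.commute)
  then have k\<delta>: "(\<sigma> ^^ k) \<delta> = \<zeta> * \<delta>"
    using e(2) by simp
  obtain \<eta> where \<eta>: "\<eta> \<in> M" "(\<Prod>i<p. ((\<sigma> ^^ k) ^^ i) \<eta>) = a"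
    using kum.symbol_norm[OF \<Delta> field_set_M L1_subset_M hom_\<sigma>[of k] _ _ \<delta>_in_M \<delta> k\<delta> \<beta>] \<sigma>_closed \<sigma>_L1 by blast
  then have N\<eta>: "conj_prod \<eta> = a"
    using conj_prod_mult_index[OF \<eta>(1) \<open>coprime k p\<close>] by (simp add: funpow_mult mult.commute)
  define \<xi> where "\<xi> = (\<Prod>j<p - 1. (\<tau> ^^ j) \<eta>)"
  have \<xi>: "\<xi> \<in> L2"
    unfolding \<xi>_def by (rule \<tau>_prod_in_L2[OF \<eta>(1)])
  have "conj_prod \<xi> = (\<Prod>i<p. \<Prod>j<p - 1. (\<sigma> ^^ i) ((\<tau> ^^ j) \<eta>))"
    unfolding conj_prod_def \<xi>_def
    by (intro prod.cong refl hom_on_prod[OF field_set_M hom_\<sigma>] \<tau>_closed \<eta>)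
  \<comment> \<open>For fixed j the exponents g^j i run over all residues mod p, so the inner
    product is \<tau>^j applied to the norm a of \<eta>.\<close>
  also have "\<dots> = (\<Prod>j<p - 1. \<Prod>i<p. (\<tau> ^^ j) ((\<sigma> ^^ (g ^ j * i)) \<eta>))"
    unfolding \<sigma>_\<tau>_pow[OF \<eta>(1)] by (rule prod.swap)
  also have "\<dots> = (\<Prod>j<p - 1. a)"
  proof (rule prod.cong[OF refl])
    fix j
    have "(\<Prod>i<p. (\<tau> ^^ j) ((\<sigma> ^^ (g ^ j * i)) \<eta>)) = (\<tau> ^^ j) (\<Prod>i<p. (\<sigma> ^^ (g ^ j * i)) \<eta>)"
      by (rule hom_on_prod[OF field_set_M hom_\<tau>, symmetric]) (rule \<sigma>_closed[OF \<eta>(1)])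
    also have "\<dots> = (\<tau> ^^ j) a"
      using conj_prod_mult_index[OF \<eta>(1), of "g ^ j"] g N\<eta> by simp
    finally show "(\<Prod>i<p. (\<tau> ^^ j) ((\<sigma> ^^ (g ^ j * i)) \<eta>)) = a"
      using \<tau>_K[OF a(1)] by simp
  qed
  finally have N\<xi>: "conj_prod \<xi> = a ^ (p - 1)"
    by simp
  have "conj_prod (a / \<xi>) = a ^ p / a ^ (p - 1)"
    using conj_prod_divide[of a \<xi>] a(1) KM \<xi> L2_subset_M N\<xi> conj_prod_K[OF a(1)] by auto
  also have "\<dots> = a"
    using a(2) p_pos by (simp add: power_eq_if[of a p])
  finally show ?thesis
    using that[of "a / \<xi>"] field_set_divide[OF field_set_L2] a(1) K_subset_L2 \<xi> by blast
qed

section \<open>The pair attached to an element of L2 of norm a\<close>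

context
  fixes a \<xi> b
  assumes a: "a \<in> K" "a \<noteq> 0" and \<xi>: "\<xi> \<in> L2" "conj_prod \<xi> = a"
  defines "b \<equiv> \<Prod>i = 1..p - 1. (\<sigma> ^^ i) \<xi> ^ (p - i)"
begin

lemma \<xi>_in_M: "\<xi> \<in> M"
  using \<xi>(1) L2_subset_M by blast

lemma \<sigma>_\<xi>_nz: "(\<sigma> ^^ i) \<xi> \<noteq> 0"
proof -
  have "conj_prod 0 = 0"
    using p_pos hom_on_zero[OF field_set_M hom_\<sigma>] by (auto simp: conj_prod_def)
  then have "\<xi> \<noteq> 0"
    using \<xi>(2) a(2) by auto
  then show ?thesis
    using hom_on_eq_0_iff[OF field_set_M hom_\<sigma> \<xi>_in_M] by simp
qed

lemma b_in_M: "b \<in> M" and b_nz: "b \<noteq> 0"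
  unfolding b_def using \<sigma>_\<xi>_nz
  by (auto intro!: field_set_prod[OF field_set_M] field_set_power[OF field_set_M] \<sigma>_closed \<xi>_in_M)

text \<open>As \<tau> fixes \<xi>, it maps \<sigma>^(g m) \<xi> to \<sigma>^m \<xi>. So \<sigma>^m
  \<xi> has the exponent p - (g m mod p) in \<tau> b and g (p - m) in b^g. The difference is p (g -
  1 - (g m div p)), a non-negative number because m < p; this explains the exponents in
  \<open>c\<close>.\<close>

lemma b_power_g: "b ^ g / \<tau> b \<in> pth_powers p M"
proof -
  define c where "c = (\<Prod>m = 1..p - 1. (\<sigma> ^^ m) \<xi> ^ (g - 1 - g * m div p))"
  have "\<tau> b = (\<Prod>i = 1..p - 1. \<tau> ((\<sigma> ^^ i) \<xi>) ^ (p - i))"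
    unfolding b_def
    by (simp add: hom_on_prod[OF field_set_M \<tau>(1)] hom_on_power[OF field_set_M \<tau>(1)] \<sigma>_closed \<xi>_in_M
        field_set_power[OF field_set_M])
  also have "\<dots> = (\<Prod>m = 1..p - 1. \<tau> ((\<sigma> ^^ (g * m mod p)) \<xi>) ^ (p - g * m mod p))"
  proof (rule prod.reindex_bij_betw[symmetric])
    have "bij_betw (\<lambda>m. g * m mod p) ({..<p} - {0}) ({..<p} - {g * 0 mod p})"
      by (rule bij_betw_DiffI[OF bij_betw_affine_mod[OF g p_pos, of 0, simplified]]) (use p_pos in \<open>auto simp: bij_betw_def\<close>)
    moreover have "{..<p} - {0} = {1..p - 1}"
      by auto
    ultimately show "bij_betw (\<lambda>m. g * m mod p) {1..p - 1} {1..p - 1}"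
      by simp
  qed
  also have "\<dots> = (\<Prod>m = 1..p - 1. (\<sigma> ^^ m) \<xi> ^ (p - g * m mod p))"
  proof -
    have "\<tau> ((\<sigma> ^^ (g * m mod p)) \<xi>) = (\<sigma> ^^ m) \<xi>" for m
      using \<sigma>_mod[OF \<xi>_in_M] \<sigma>_\<tau>[OF \<xi>_in_M, of m] \<tau>_L2[OF \<xi>(1), of 1] by simp
    then show ?thesis by simp
  qed
  finally have \<tau>b: "\<tau> b = (\<Prod>m = 1..p - 1. (\<sigma> ^^ m) \<xi> ^ (p - g * m mod p))" .
  have "g > 0"
    using g p_gt_1 by (cases g) auto
  have "b ^ g = (\<Prod>m = 1..p - 1. (\<sigma> ^^ m) \<xi> ^ ((p - m) * g))"
    unfolding b_def by (simp add: prod_power_distrib power_mult)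
  also have "\<dots> = (\<Prod>m = 1..p - 1. (\<sigma> ^^ m) \<xi> ^ (p - g * m mod p) * ((\<sigma> ^^ m) \<xi> ^ (g - 1 - g * m div p)) ^ p)"
  proof (rule prod.cong[OF refl])
    fix m assume m: "m \<in> {1..p - 1}"
    have "m < p" using m p_gt_1 by auto
    then have "g * m < g * p"
      using \<open>g > 0\<close> by simp
    then have "g * m div p < g"
      using p_pos by (simp add: div_less_iff_less_mult)
    from less_imp_Suc_add[OF this] obtain q where q: "g = Suc (g * m div p) + q"
      by auto
    define d r where "d = g * m div p" and "r = g * m mod p"
    have gm: "g * m = d * p + r"
      by (simp add: d_def r_def)
    have "r < p" using p_pos by (simp add: r_def)
    have "(p - m) * g + (d * p + r) = g * p"
      unfolding gm[symmetric] using \<open>m < p\<close> by (simp add: mult.commute[of g] flip: add_mult_distrib)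
    moreover have "g * p = Suc d * p + q * p"
      using q unfolding d_def[symmetric] by (metis add_mult_distrib)
    ultimately have "(p - m) * g = (p - r) + q * p"
      using \<open>r < p\<close> by simp
    moreover have "g - 1 - d = q"
      using q unfolding d_def[symmetric] by simp
    ultimately show "(\<sigma> ^^ m) \<xi> ^ ((p - m) * g) =
      (\<sigma> ^^ m) \<xi> ^ (p - g * m mod p) * ((\<sigma> ^^ m) \<xi> ^ (g - 1 - g * m div p)) ^ p"
      unfolding d_def[symmetric] r_def[symmetric] by (simp add: power_add power_mult)
  qed
  also have "\<dots> = \<tau> b * c ^ p"
    unfolding \<tau>b c_def by (simp add: prod.distrib prod_power_distrib)
  finally have "b ^ g / \<tau> b = c ^ p"
    using hom_on_eq_0_iff[OF field_set_M \<tau>(1) b_in_M] b_nz by simp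
  moreover have "c \<in> M - {0}"
    unfolding c_def using \<sigma>_\<xi>_nz
    by (auto intro!: field_set_prod[OF field_set_M] field_set_power[OF field_set_M] \<sigma>_closed \<xi>_in_M)
  ultimately show ?thesis
    by (auto simp: pth_powers_def)
qed

text \<open>Each conjugate of \<xi> has norm a, so the norm of b is a to the sum of the p - i,
  namely p (p - 1) / 2. This is a multiple of p because p is odd.\<close>

lemma conj_prod_b: "conj_prod b \<in> pth_powers p L1"
proof -
  have "conj_prod b = (\<Prod>k<p. \<Prod>i = 1..p - 1. (\<sigma> ^^ (k + i)) \<xi> ^ (p - i))"
    unfolding conj_prod_def b_def
    by (simp add: hom_on_prod[OF field_set_M hom_\<sigma>] hom_on_power[OF field_set_M hom_\<sigma>] \<sigma>_closed \<xi>_in_M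
        field_set_power[OF field_set_M] funpow_add)
  also have "\<dots> = (\<Prod>i = 1..p - 1. (\<Prod>k<p. (\<sigma> ^^ (k + i)) \<xi>) ^ (p - i))"
    by (subst prod.swap) (simp add: prod_power_distrib)
  also have "\<dots> = (\<Prod>i = 1..p - 1. a ^ (p - i))"
    unfolding conj_prod_shift[OF \<xi>_in_M] \<xi>(2) ..
  also have "\<dots> = a ^ (\<Sum>i = 1..p - 1. p - i)"
    by (simp add: power_sum)
  also have "(\<Sum>i = 1..p - 1. p - i) = (\<Sum>i = 1..p - 1. i)"
    by (rule sum.reindex_bij_witness[of _ "\<lambda>i. p - i" "\<lambda>i. p - i"]) auto
  also have "\<dots> = (p - 1) div 2 * p"
  proof -
    have "2 * (\<Sum>i = 1..n. i) = n * Suc n" for n :: nat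
      by (induction n) auto
    from this[of "p - 1"] have "2 * (\<Sum>i = 1..p - 1. i) = (p - 1) * p"
      using p_pos by simp
    moreover have "2 * ((p - 1) div 2) = p - 1"
      using p(2) by simp
    ultimately have "2 * (\<Sum>i = 1..p - 1. i) = 2 * ((p - 1) div 2 * p)"
      by (simp only: mult.assoc[symmetric])
    then show ?thesis by simp
  qed
  finally have "conj_prod b = (a ^ ((p - 1) div 2)) ^ p"
    by (simp add: power_mult)
  moreover have "a ^ ((p - 1) div 2) \<in> L1 - {0}"
    using a K_subset_L1 field_set_power[OF field_set_L1] by auto
  ultimately show ?thesis
    by (auto simp: pth_powers_def)
qed

text \<open>Multiplying b by a, the product of all conjugates of \<xi>, raises each exponent by one.
  Applying \<sigma> to b shifts the indices and has the same effect, except that \<sigma> \<xi>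
  drops out instead of receiving the exponent p. Hence a b = (\<sigma> \<xi>)^p \<sigma> b.\<close>

lemma \<sigma>_b: "\<sigma> b / (a * b) \<in> pth_powers p M"
proof -
  define x where "x i = (\<sigma> ^^ i) \<xi>" for i
  obtain q where q: "p = Suc (Suc q)"
    using p_gt_1 by (metis less_natE add_Suc_right One_nat_def plus_nat.add_0 add_Suc)
  have "\<sigma> b = (\<Prod>i = 1..p - 1. x (Suc i) ^ (p - i))"
    unfolding b_def x_def
    by (simp add: hom_on_prod[OF field_set_M \<sigma>(1)] hom_on_power[OF field_set_M \<sigma>(1)] \<sigma>_closed \<xi>_in_M
        field_set_power[OF field_set_M])
  also have "\<dots> = (\<Prod>i = 2..p. x i ^ (p + 1 - i))"
    by (rule prod.reindex_bij_witness[of _ "\<lambda>i. i - 1" Suc]) auto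
  finally have \<sigma>b: "x 1 ^ p * \<sigma> b = (\<Prod>i = 1..p. x i ^ (p + 1 - i))"
    using prod.atLeast_Suc_atMost[of 1 p "\<lambda>i. x i ^ (p + 1 - i)"] p_pos by (simp add: numeral_2_eq_2)
  have "a = (\<Prod>i<p. x (i + 1))"
    unfolding x_def conj_prod_shift[OF \<xi>_in_M] \<xi>(2) ..
  also have "\<dots> = (\<Prod>i = 1..p. x i)"
    by (rule prod.reindex_bij_witness[of _ "\<lambda>i. i - 1" "\<lambda>i. i + 1"]) auto
  finally have a_eq: "a = (\<Prod>i = 1..p. x i)" .
  have "b = (\<Prod>i = 1..p. x i ^ (p - i))"
    unfolding b_def x_def[symmetric] q by simp
  then have "a * b = (\<Prod>i = 1..p. x i * x i ^ (p - i))"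
    unfolding a_eq by (simp add: prod.distrib)
  also have "\<dots> = x 1 ^ p * \<sigma> b"
    unfolding \<sigma>b by (rule prod.cong[OF refl]) (auto simp: Suc_diff_le)
  finally have ab: "a * b = x 1 ^ p * \<sigma> b" .
  have "\<sigma> b \<noteq> 0" "x 1 \<noteq> 0" "x 1 \<in> M"
    using hom_on_eq_0_iff[OF field_set_M \<sigma>(1) b_in_M] b_nz \<sigma>_\<xi>_nz[of 1] \<sigma>_closed[OF \<xi>_in_M, of 1] unfolding x_def by simp_all
  then have "\<sigma> b / (a * b) = (inverse (x 1)) ^ p"
    unfolding ab by (simp add: field_simps)
  then show ?thesis
    unfolding pth_powers_def using \<open>x 1 \<noteq> 0\<close> field_set_inverse[OF field_set_M \<open>x 1 \<in> M\<close>] by auto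
qed

text \<open>\<open>pair_group\<close> tests every representative. Passing to c^p a and d^p b changes
  the three quantities by pth powers of d^g / \<tau> d, of the norm of d, and of \<sigma> d / (c
  d).\<close>

lemma pair_in_group:
  "(pth_power_class p K a, pth_power_class p M b) \<in> pair_group K L1 M p g \<sigma> \<tau>"
proof -
  have cls: "pth_power_class p G x = {c ^ p * x | c. c \<in> G \<and> c \<noteq> 0}" for G :: "'a set" and x
    by (auto simp: pth_power_class_def r_coset_def pth_powers_def)
  have mult: "u * v ^ p \<in> pth_powers p G" if G: "field_set G" and u: "u \<in> pth_powers p G" and v: "v \<in> G" "v \<noteq> 0" for u v and G :: "'a set"
  proof -
    obtain w where "w \<in> G" "w \<noteq> 0" "u = w ^ p"
      using u by (auto simp: pth_powers_def)
    then show ?thesis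
      using v field_set_mult[OF G] unfolding pth_powers_def
      by (intro image_eqI[of _ _ "w * v"]) (auto simp: power_mult_distrib)
  qed
  have carrier: "pth_power_class p G x \<in> carrier (unit_group G Mod pth_powers p G)" if "x \<in> G" "x \<noteq> 0" for G :: "'a set" and x
    using that by (auto simp: FactGroup_def RCOSETS_def pth_power_class_def)
  have "b' ^ g / \<tau> b' \<in> pth_powers p M \<and> field_norm M L1 b' \<in> pth_powers p L1 \<and> \<sigma> b' / (a' * b') \<in> pth_powers p M"
    if a': "a' \<in> pth_power_class p K a" and b': "b' \<in> pth_power_class p M b" for a' b'
  proof -
    obtain c where c: "c \<in> K" "c \<noteq> 0" "a' = c ^ p * a"
      using a' unfolding cls by blast
    obtain d where d: "d \<in> M" "d \<noteq> 0" "b' = d ^ p * b"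
      using b' unfolding cls by blast
    have dp: "d ^ p \<in> M"
      using field_set_power[OF field_set_M d(1)] .
    have b'M: "b' \<in> M"
      unfolding d(3) by (rule field_set_mult[OF field_set_M dp b_in_M])
    have \<tau>d: "\<tau> d \<in> M" "\<tau> d \<noteq> 0" and \<sigma>d: "\<sigma> d \<in> M" "\<sigma> d \<noteq> 0"
      using \<tau>(2) \<sigma>(2) d hom_on_eq_0_iff[OF field_set_M \<tau>(1) d(1)] hom_on_eq_0_iff[OF field_set_M \<sigma>(1) d(1)] by auto
    have "\<tau> b' = \<tau> d ^ p * \<tau> b"
      unfolding d(3) by (simp add: hom_on_mult[OF field_set_M \<tau>(1)] hom_on_power[OF field_set_M \<tau>(1)] dp d(1) b_in_M)
    then have "b' ^ g / \<tau> b' = (b ^ g / \<tau> b) * (d ^ g / \<tau> d) ^ p"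
      unfolding d(3) by (simp add: power_mult_distrib power_divide mult_ac flip: power_mult)
    then have 1: "b' ^ g / \<tau> b' \<in> pth_powers p M"
      using mult[OF field_set_M b_power_g, of "d ^ g / \<tau> d"] d \<tau>d
        field_set_divide[OF field_set_M field_set_power[OF field_set_M]] by simp
    have "field_norm M L1 b' = conj_prod b * conj_prod d ^ p"
      unfolding field_norm_M[OF b'M] unfolding d(3)
      using conj_prod_mult[OF dp b_in_M] conj_prod_power[OF d(1)] by (simp add: mult.commute)
    then have 2: "field_norm M L1 b' \<in> pth_powers p L1"
      using mult[OF field_set_L1 conj_prod_b conj_prod_in_L1[OF d(1)] conj_prod_nz[OF d(1,2)]] by simp
    have "\<sigma> b' = \<sigma> d ^ p * \<sigma> b"
      unfolding d(3) by (simp add: hom_on_mult[OF field_set_M \<sigma>(1)] hom_on_power[OF field_set_M \<sigma>(1)] dp d(1) b_in_M)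
    then have "\<sigma> b' / (a' * b') = \<sigma> b / (a * b) * (\<sigma> d / (c * d)) ^ p"
      unfolding d(3) c(3) by (simp add: power_mult_distrib power_divide mult_ac)
    moreover have "\<sigma> d / (c * d) \<in> M" "\<sigma> d / (c * d) \<noteq> 0"
      using c d \<sigma>d KM by (auto intro!: field_set_divide[OF field_set_M] field_set_mult[OF field_set_M])
    ultimately have 3: "\<sigma> b' / (a' * b') \<in> pth_powers p M"
      using mult[OF field_set_M \<sigma>_b] by simp
    from 1 2 3 show ?thesis by blast
  qed
  then show ?thesis
    unfolding pair_group_def using carrier[of a K] carrier[of b M] a b_in_M b_nz by blast
qed

end

end

subsection \<open>The group law on an elliptic curve\<close>

locale elliptic =
  fixes a1 a2 a3 a4 a6 :: "'a::{alg_closed_field,field_char_0}"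
  assumes nonsingular: "discriminant (Weierstrass a1 a2 a3 a4 a6) \<noteq> 0"
begin

abbreviation on :: "'a point \<Rightarrow> bool" where
  "on \<equiv> on_curve (Weierstrass a1 a2 a3 a4 a6)"

abbreviation plus :: "'a point \<Rightarrow> 'a point \<Rightarrow> 'a point" (infixl "\<boxplus>" 65) where
  "plus \<equiv> point_add (Weierstrass a1 a2 a3 a4 a6)"

definition cubic :: "'a \<Rightarrow> 'a" where
  "cubic x = x^3 + a2 * x^2 + a4 * x + a6"

fun neg :: "'a point \<Rightarrow> 'a point" where
  "neg Infinity = Infinity"
| "neg (Affine x y) = Affine x (- y - a1 * x - a3)"

text \<open>Vieta's relations for the cubic obtained by inserting y = l x + n into the curve
  equation. They record intersections with multiplicity, so chords and tangents are treated
  alike.\<close>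

definition on_line :: "'a \<Rightarrow> 'a \<Rightarrow> 'a \<Rightarrow> 'a \<Rightarrow> 'a \<Rightarrow> bool" where
  "on_line l n x1 x2 x3 \<longleftrightarrow>
     x1 + x2 + x3 = l^2 + a1 * l - a2 \<and>
     x1 * x2 + x2 * x3 + x1 * x3 = a4 - 2 * l * n - a1 * n - a3 * l \<and>
     x1 * x2 * x3 = n^2 + a3 * n - a6"

declare point_add.simps(3) [simp del]

lemma on_iff: "on (Affine x y) \<longleftrightarrow> y^2 + a1 * x * y + a3 * y = cubic x"
  by (simp add: cubic_def)

lemma on_neg: "on P \<Longrightarrow> on (neg P)"
  by (cases P) (auto simp: algebra_simps power2_eq_square)

lemma neg_neg [simp]: "neg (neg P) = P"
  by (cases P) auto

lemma plus_Infinity [simp]: "P \<boxplus> Infinity = P" "Infinity \<boxplus> P = P"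
  by (cases P; simp)+

lemma on_line_identity:
  assumes "on_line l n x1 x2 x3"
  shows "cubic x - ((l * x + n)^2 + a1 * x * (l * x + n) + a3 * (l * x + n)) =
    (x - x1) * (x - x2) * (x - x3)"
proof -
  have "x1 * x2 * x3 = n^2 + a3 * n - a6" "x1 * x2 + x2 * x3 + x1 * x3 = a4 - 2 * l * n - a1 * n - a3 * l"
    "x1 + x2 + x3 = l^2 + a1 * l - a2"
    using assms by (auto simp: on_line_def)
  then show ?thesis
    unfolding cubic_def by Groebner_Basis.algebra
qed

text \<open>If both partial derivatives vanish, x is a double root of 4 x^3 + b2 x^2 + 2 b4 x + b6.
  This expresses b4 and b6 through b2 and x, and the discriminant becomes 0; it is multiplied by 4
  because 4 b8 = b2 b6 - b4^2.\<close>

lemma partial_nonzero: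
  assumes "on (Affine x y)" "2 * y + a1 * x + a3 = 0"
  shows "3 * x^2 + 2 * a2 * x + a4 - a1 * y \<noteq> 0"
proof
  assume *: "3 * x^2 + 2 * a2 * x + a4 - a1 * y = 0"
  define b2 b4 b6 b8 where "b2 = a1^2 + 4 * a2" "b4 = 2 * a4 + a1 * a3" "b6 = a3^2 + 4 * a6"
    and "b8 = a1^2 * a6 + 4 * a2 * a6 - a1 * a3 * a4 + a2 * a3^2 - a4^2"
  have b4: "b4 = - (6 * x^2 + b2 * x)"
    using * assms(2) unfolding b2_b4_b6_def by Groebner_Basis.algebra
  have "y^2 + a1 * x * y + a3 * y = x^3 + a2 * x^2 + a4 * x + a6"
    using assms(1) by simp
  with assms(2) have "4 * x^3 + b2 * x^2 + 2 * b4 * x + b6 = 0"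
    unfolding b2_b4_b6_def by Groebner_Basis.algebra
  then have b6: "b6 = - (4 * x^3 + b2 * x^2 + 2 * b4 * x)"
    by Groebner_Basis.algebra
  have b8: "4 * b8 = b2 * b6 - b4^2"
    unfolding b2_b4_b6_def b8_def by Groebner_Basis.algebra
  have "4 * (- (b2^2) * b8 - 8 * b4^3 - 27 * b6^2 + 9 * b2 * b4 * b6) =
    - (b2^2) * (b2 * b6 - b4^2) - 32 * b4^3 - 108 * b6^2 + 36 * b2 * b4 * b6"
    unfolding b8[symmetric] by Groebner_Basis.algebra
  also have "\<dots> = 0"
    unfolding b6 b4 by Groebner_Basis.algebra
  finally have "- (b2^2) * b8 - 8 * b4^3 - 27 * b6^2 + 9 * b2 * b4 * b6 = 0"
    by (metis mult_eq_0_iff zero_neq_numeral)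
  then have "discriminant (Weierstrass a1 a2 a3 a4 a6) = 0"
    by (simp add: Let_def b2_b4_b6_def[symmetric] b8_def[symmetric])
  with nonsingular show False by simp
qed

lemma same_x:
  assumes "on (Affine x y)" "on (Affine x y')"
  shows "y' = y \<or> y' = - y - a1 * x - a3"
proof -
  have "(y' - y) * (y' + y + a1 * x + a3) = (y'^2 + a1 * x * y' + a3 * y') - (y^2 + a1 * x * y + a3 * y)"
    by Groebner_Basis.algebra
  then have "(y' - y) * (y' + y + a1 * x + a3) = 0"
    using assms unfolding on_iff by simp
  then have "y' - y = 0 \<or> y' + y + a1 * x + a3 = 0"
    by simp
  then show ?thesis by (auto simp: algebra_simps eq_neg_iff_add_eq_0)
qed

lemma plus_neg [simp]: "P \<boxplus> neg P = Infinity" "neg P \<boxplus> P = Infinity"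
  by (cases P; simp add: point_add.simps)+

text \<open>The line is a parameter instead of being computed from the points, so that a sum can be
  read off any line already known to pass through them.\<close>

lemma plus_chord:
  assumes "x1 \<noteq> x2" "y1 = l * x1 + n" "y2 = l * x2 + n" "x3 = l^2 + a1 * l - a2 - x1 - x2"
  shows "Affine x1 y1 \<boxplus> Affine x2 y2 = neg (Affine x3 (l * x3 + n))"
proof -
  have l: "(y2 - y1) / (x2 - x1) = l"
    using assms(1) unfolding assms(2,3) by (simp add: field_simps)
  have n: "y1 - l * x1 = n"
    by (simp add: assms(2))
  have y: "- (l + a1) * x3 - n - a3 = - (l * x3 + n) - a1 * x3 - a3"
    by Groebner_Basis.algebra
  show ?thesis
    using assms(1) by (simp only: point_add.simps Let_def l n assms(4)[symmetric] y neg.simps simp_thms if_False)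
qed

lemma plus_tangent:
  assumes "2 * y + a1 * x + a3 \<noteq> 0" "(2 * y + a1 * x + a3) * l = 3 * x^2 + 2 * a2 * x + a4 - a1 * y"
    "y = l * x + n" "x3 = l^2 + a1 * l - a2 - x - x"
  shows "Affine x y \<boxplus> Affine x y = neg (Affine x3 (l * x3 + n))"
proof -
  have l: "(3 * x^2 + 2 * a2 * x + a4 - a1 * y) / (2 * y + a1 * x + a3) = l"
    using assms(1) unfolding assms(2)[symmetric] by simp
  have n: "y - l * x = n"
    by (simp add: assms(3))
  have y: "- (l + a1) * x3 - n - a3 = - (l * x3 + n) - a1 * x3 - a3"
    by Groebner_Basis.algebra
  have "y + y + a1 * x + a3 \<noteq> 0"
    using assms(1) unfolding mult_2 .
  then show ?thesis
    by (simp only: point_add.simps Let_def l n assms(4)[symmetric] y neg.simps simp_thms if_False if_True)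
qed

text \<open>The addition formula fixes the sum of the roots. The second Vieta relation comes from
  dividing the difference of the equations at x1 and x2 by x1 - x2, and the third from inserting it
  back.\<close>

lemma chordE:
  assumes "on (Affine x1 y1)" "on (Affine x2 y2)" "x1 \<noteq> x2"
  obtains l n x3 where "Affine x1 y1 \<boxplus> Affine x2 y2 = neg (Affine x3 (l * x3 + n))"
    "y1 = l * x1 + n" "y2 = l * x2 + n" "on_line l n x1 x2 x3"
proof -
  define l where "l = (y2 - y1) / (x2 - x1)"
  define n where "n = y1 - l * x1"
  define x3 where "x3 = l^2 + a1 * l - a2 - x1 - x2"
  have y1: "y1 = l * x1 + n" by (simp add: n_def)
  have "l * (x2 - x1) = y2 - y1"
    using assms(3) by (simp add: l_def)
  then have y2: "y2 = l * x2 + n"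
    unfolding n_def by Groebner_Basis.algebra
  have e1: "x1^3 + (a2 - l^2 - a1 * l) * x1^2 + (a4 - 2 * l * n - a1 * n - a3 * l) * x1 + (a6 - n^2 - a3 * n) = 0"
    using assms(1) unfolding on_iff cubic_def y1 by Groebner_Basis.algebra
  have e2: "x2^3 + (a2 - l^2 - a1 * l) * x2^2 + (a4 - 2 * l * n - a1 * n - a3 * l) * x2 + (a6 - n^2 - a3 * n) = 0"
    using assms(2) unfolding on_iff cubic_def y2 by Groebner_Basis.algebra
  have "(x1 - x2) * (x1^2 + x1 * x2 + x2^2 + (a2 - l^2 - a1 * l) * (x1 + x2) + (a4 - 2 * l * n - a1 * n - a3 * l)) = 0"
    using e1 e2 by Groebner_Basis.algebra
  then have e3: "x1^2 + x1 * x2 + x2^2 + (a2 - l^2 - a1 * l) * (x1 + x2) + (a4 - 2 * l * n - a1 * n - a3 * l) = 0"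
    using assms(3) by simp
  have "x1 + x2 + x3 = l^2 + a1 * l - a2"
    by (simp add: x3_def)
  moreover have "x1 * x2 + x2 * x3 + x1 * x3 = a4 - 2 * l * n - a1 * n - a3 * l"
    using e3 unfolding x3_def by Groebner_Basis.algebra
  moreover have "x1 * x2 * x3 = n^2 + a3 * n - a6"
    using e1 e3 unfolding x3_def by Groebner_Basis.algebra
  ultimately have "on_line l n x1 x2 x3"
    by (simp add: on_line_def)
  moreover have "Affine x1 y1 \<boxplus> Affine x2 y2 = neg (Affine x3 (l * x3 + n))"
    using plus_chord[OF assms(3) y1 y2 x3_def] .
  ultimately show ?thesis
    using that y1 y2 by blast
qed

text \<open>Here the equation for the slope replaces the divided difference: it says that x is a
  double root of the cubic on the line.\<close>

lemma tangentE:
  assumes "on (Affine x y)" "Affine x y \<noteq> neg (Affine x y)"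
  obtains l n x3 where "Affine x y \<boxplus> Affine x y = neg (Affine x3 (l * x3 + n))"
    "y = l * x + n" "on_line l n x x x3"
    "(2 * y + a1 * x + a3) * l = 3 * x^2 + 2 * a2 * x + a4 - a1 * y"
proof -
  have nz: "2 * y + a1 * x + a3 \<noteq> 0"
  proof
    assume "2 * y + a1 * x + a3 = 0"
    then have "y = - y - a1 * x - a3" by Groebner_Basis.algebra
    with assms(2) show False by simp
  qed
  define l where "l = (3 * x^2 + 2 * a2 * x + a4 - a1 * y) / (2 * y + a1 * x + a3)"
  define n where "n = y - l * x"
  define x3 where "x3 = l^2 + a1 * l - a2 - x - x"
  have y: "y = l * x + n" by (simp add: n_def)
  have l: "(2 * y + a1 * x + a3) * l = 3 * x^2 + 2 * a2 * x + a4 - a1 * y"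
    using nz by (simp add: l_def)
  have e1: "x^3 + (a2 - l^2 - a1 * l) * x^2 + (a4 - 2 * l * n - a1 * n - a3 * l) * x + (a6 - n^2 - a3 * n) = 0"
    using assms(1) unfolding on_iff cubic_def y by Groebner_Basis.algebra
  have e3: "3 * x^2 + 2 * (a2 - l^2 - a1 * l) * x + (a4 - 2 * l * n - a1 * n - a3 * l) = 0"
    using l unfolding n_def by Groebner_Basis.algebra
  have "x + x + x3 = l^2 + a1 * l - a2"
    by (simp add: x3_def)
  moreover have "x * x + x * x3 + x * x3 = a4 - 2 * l * n - a1 * n - a3 * l"
    using e3 unfolding x3_def by Groebner_Basis.algebra
  moreover have "x * x * x3 = n^2 + a3 * n - a6"
    using e1 e3 unfolding x3_def by Groebner_Basis.algebra
  ultimately have "on_line l n x x x3"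
    by (simp add: on_line_def)
  moreover have "Affine x y \<boxplus> Affine x y = neg (Affine x3 (l * x3 + n))"
    using plus_tangent[OF nz l y x3_def] .
  ultimately show ?thesis
    using that y l by blast
qed

lemma plusE:
  assumes "on (Affine x1 y1)" "on (Affine x2 y2)" "Affine x2 y2 \<noteq> neg (Affine x1 y1)"
  obtains l n x3 where "Affine x1 y1 \<boxplus> Affine x2 y2 = neg (Affine x3 (l * x3 + n))"
    "y1 = l * x1 + n" "y2 = l * x2 + n" "on_line l n x1 x2 x3"
proof (cases "x1 = x2")
  case True
  then have "y2 = y1"
    using same_x[of x1 y1 y2] assms by auto
  with True tangentE[of x1 y1] assms that show ?thesis by metis
next
  case False
  with chordE[OF assms(1,2)] that show ?thesis by blast
qed

lemma on_line_point:
  assumes "on_line l n x1 x2 x3"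
  shows "on (Affine x3 (l * x3 + n))"
  using on_line_identity[OF assms, of x3] unfolding on_iff by simp

lemma on_plus:
  assumes "on P" "on Q"
  shows "on (P \<boxplus> Q)"
proof (cases P; cases Q)
  fix x1 y1 x2 y2
  assume PQ: "P = Affine x1 y1" "Q = Affine x2 y2"
  show ?thesis
  proof (cases "Q = neg P")
    case False
    obtain l n x3 where "P \<boxplus> Q = neg (Affine x3 (l * x3 + n))" "on_line l n x1 x2 x3"
      using plusE[of x1 y1 x2 y2] assms False unfolding PQ by metis
    then show ?thesis
      using on_neg[OF on_line_point] by simp
  qed (simp del: neg.simps)
qed (use assms in auto)

lemma plus_commute:
  assumes "on P" "on Q"
  shows "P \<boxplus> Q = Q \<boxplus> P"
proof (cases P; cases Q)
  fix x1 y1 x2 y2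
  assume PQ: "P = Affine x1 y1" "Q = Affine x2 y2"
  show ?thesis
  proof (cases "x1 = x2")
    case True
    then have "Q = P \<or> Q = neg P"
      using same_x[of x1 y1 y2] assms unfolding PQ by auto
    then show ?thesis
      using plus_neg by metis
  next
    case False
    then obtain l n x3 where *: "P \<boxplus> Q = neg (Affine x3 (l * x3 + n))" "y1 = l * x1 + n"
      "y2 = l * x2 + n" "on_line l n x1 x2 x3"
      using chordE[of x1 y1 x2 y2] assms unfolding PQ by metis
    have "Q \<boxplus> P = neg (Affine x3 (l * x3 + n))"
      unfolding PQ using False *(2-4) by (intro plus_chord) (auto simp: on_line_def algebra_simps)
    with *(1) show ?thesis by simp
  qed
qed auto

text \<open>The negation maps the line through the two points to the line y = m x + k. That line
  contains the sum, the negative of the first point, and as third point the negative of the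
  second.\<close>

lemma neg_plus_cancel_chord:
  assumes "on (Affine x1 y1)" "on (Affine x2 y2)" "x1 \<noteq> x2"
  shows "(Affine x1 y1 \<boxplus> Affine x2 y2) \<boxplus> neg (Affine x1 y1) = Affine x2 y2"
proof -
  obtain l n x3 where s: "Affine x1 y1 \<boxplus> Affine x2 y2 = neg (Affine x3 (l * x3 + n))"
    and y: "y1 = l * x1 + n" "y2 = l * x2 + n" and L: "on_line l n x1 x2 x3"
    using chordE[OF assms] by blast
  have on3: "on (Affine x3 (l * x3 + n))"
    using on_line_point[OF L] .
  define y3 where "y3 = l * x3 + n"
  define m k where "m = - l - a1" and "k = - n - a3"
  have neg: "neg (Affine x y) = Affine x (m * x + k)" if "y = l * x + n" for x y
    unfolding that neg.simps m_def k_def by (simp add: algebra_simps)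
  have e: "m^2 + a1 * m - a2 - x3 - x1 = x2"
    using L unfolding on_line_def m_def by Groebner_Basis.algebra
  have y2: "neg (Affine x2 (m * x2 + k)) = Affine x2 y2"
    using neg[OF y(2)] by (metis neg_neg)
  show ?thesis
  proof (cases "x3 = x1")
    case False
    then show ?thesis
      using plus_chord[of x3 x1 "m * x3 + k" m k "m * x1 + k" x2] e
      unfolding s neg[OF y(1)] neg[OF refl] y2 by simp
  next
    \<comment> \<open>The sum is now the negative of the first point, so the second addition is a
      doubling. If \<open>d\<close> were 0, then \<open>ld\<close> would make both partial
      derivatives vanish.\<close>
    case True
    define d where "d = 2 * y1 + a1 * x1 + a3"
    have ld: "d * l = 3 * x1^2 + 2 * a2 * x1 + a4 - a1 * y1"
      using L True unfolding on_line_def d_def y(1) by Groebner_Basis.algebra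
    have "d \<noteq> 0"
      using partial_nonzero[OF assms(1)] ld unfolding d_def by auto
    have d': "2 * (m * x1 + k) + a1 * x1 + a3 = - d"
      unfolding d_def y m_def k_def by (simp add: algebra_simps)
    have "- d * m = 3 * x1^2 + 2 * a2 * x1 + a4 - a1 * (m * x1 + k)"
      using ld unfolding d_def y m_def k_def by Groebner_Basis.algebra
    then show ?thesis
      using plus_tangent[of "m * x1 + k" x1 m k x2] e True \<open>d \<noteq> 0\<close>
      unfolding s neg[OF y(1)] neg[OF refl] y2 True d' by simp
  qed
qed

text \<open>The last equation says that the two lines cross the vertical line x = x3 in points that
  are negatives of each other.\<close>

lemma sum_lines:
  assumes "on (Affine x1 y1)" "on (Affine x2 y2)" "on (Affine x4 y4)"
    "Affine x2 y2 \<noteq> neg (Affine x1 y1)" "Affine x4 y4 \<noteq> neg (Affine x1 y1 \<boxplus> Affine x2 y2)"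
  obtains l n k m x3 x5 where "Affine x1 y1 \<boxplus> Affine x2 y2 = neg (Affine x3 (l * x3 + n))"
    "Affine x1 y1 \<boxplus> Affine x2 y2 \<boxplus> Affine x4 y4 = neg (Affine x5 (k * x5 + m))"
    "y1 = l * x1 + n" "y2 = l * x2 + n" "y4 = k * x4 + m"
    "on_line l n x1 x2 x3" "on_line k m x3 x4 x5" "(l * x3 + n) + (k * x3 + m) + a1 * x3 + a3 = 0"
proof -
  obtain l n x3 where 1: "Affine x1 y1 \<boxplus> Affine x2 y2 = neg (Affine x3 (l * x3 + n))"
    "y1 = l * x1 + n" "y2 = l * x2 + n" "on_line l n x1 x2 x3"
    using plusE[OF assms(1,2,4)] .
  define y3 where "y3 = - (l * x3 + n) - a1 * x3 - a3"
  have 2: "Affine x1 y1 \<boxplus> Affine x2 y2 = Affine x3 y3"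
    using 1(1) unfolding y3_def by simp
  have on3: "on (Affine x3 y3)"
    using on_plus[OF assms(1,2)] unfolding 2 .
  obtain k m x5 where 3: "Affine x3 y3 \<boxplus> Affine x4 y4 = neg (Affine x5 (k * x5 + m))"
    "y3 = k * x3 + m" "y4 = k * x4 + m" "on_line k m x3 x4 x5"
    using plusE[OF on3 assms(3) assms(5)[unfolded 2]] .
  have "(l * x3 + n) + (k * x3 + m) + a1 * x3 + a3 = 0"
    using 3(2) unfolding y3_def by Groebner_Basis.algebra
  with 1 2 3 show ?thesis
    using that by metis
qed

text \<open>The product of the two lines, divided by the vertical line through their common point, is
  the function \<open>x\<^sup>2 + u x + w - s y\<close>. It has a pole of order four at infinity and vanishes at the three
  summands and at the inverse of their sum.\<close>

lemma sum_function:
  assumes "on_line l n x1 x2 x3" "on_line k m x3 x4 x5"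
    "(l * x3 + n) + (k * x3 + m) + a1 * x3 + a3 = 0"
  obtains s u w where "s = l + k + a1"
    "\<forall>x. x^2 + u * x + w - s * (l * x + n) = (x - x1) * (x - x2)"
    "\<forall>x. x^2 + u * x + w - s * (k * x + m) = (x - x4) * (x - x5)"
    "x5 = s^2 - a1 * s - 2 * u - x1 - x2 - x4"
proof -
  define s where "s = l + k + a1"
  define u w where "u = s * l - (x1 + x2)" and "w = x1 * x2 + s * n"
  have 1: "x1 + x2 = l^2 + a1 * l - a2 - x3"
    and 2: "x1 * x2 = a4 - 2 * l * n - a1 * n - a3 * l - x3 * (x1 + x2)"
    and 3: "x4 + x5 = k^2 + a1 * k - a2 - x3"
    and 4: "x4 * x5 = a4 - 2 * k * m - a1 * m - a3 * k - x3 * (x4 + x5)"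
    using assms(1,2) unfolding on_line_def by Groebner_Basis.algebra+
  have m: "m = - (s * x3 + n + a3)"
    using assms(3) unfolding s_def by Groebner_Basis.algebra
  have 5: "u - s * k = - (x4 + x5)"
    unfolding u_def 1 3 s_def by Groebner_Basis.algebra
  have 6: "w - s * m = x4 * x5"
    unfolding w_def 2 4 1 3 m s_def by Groebner_Basis.algebra
  have "x^2 + u * x + w - s * (l * x + n) = (x - x1) * (x - x2)" for x
    unfolding u_def w_def by Groebner_Basis.algebra
  moreover have "x^2 + u * x + w - s * (k * x + m) = (x - x4) * (x - x5)" for x
    using 5 6 by Groebner_Basis.algebra
  moreover have "x5 = s^2 - a1 * s - 2 * u - x1 - x2 - x4"
    using 5 1 unfolding s_def u_def by Groebner_Basis.algebra
  ultimately show ?thesis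
    using that s_def by blast
qed

text \<open>Both functions vanish at the point over x5, so s times either y-coordinate is the same
  value.\<close>

lemma same_function_same_sum:
  assumes "s = s'" "u = u'" "w = w'" "x5' = x5" "s \<noteq> 0"
    and "\<forall>x. x^2 + u * x + w - s * (k * x + m) = (x - x4) * (x - x5)"
    and "\<forall>x. x^2 + u' * x + w' - s' * (k' * x + m') = (x - x1) * (x - x5')"
  shows "neg (Affine x5 (k * x5 + m)) = neg (Affine x5' (k' * x5' + m'))"
proof -
  have "s * (k * x5 + m) = s * (k' * x5 + m')"
    using assms(6)[rule_format, of x5] assms(7)[rule_format, of x5] assms(1-4) by Groebner_Basis.algebra
  with assms(4,5) show ?thesis by simp
qed

text \<open>The functions for the two bracketings both vanish at three points with distinct
  x-coordinates, which is a linear system for s, u, w. Were s and s' different, the points would be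
  collinear; the first function then forces (x4 - x1) (x4 - x2) = 0.\<close>

lemma assoc_distinct:
  assumes "on (Affine x1 y1)" "on (Affine x2 y2)" "on (Affine x4 y4)"
    and "x1 \<noteq> x2" "x2 \<noteq> x4" "x1 \<noteq> x4"
    and "Affine x4 y4 \<noteq> neg (Affine x1 y1 \<boxplus> Affine x2 y2)"
    and "Affine x1 y1 \<noteq> neg (Affine x2 y2 \<boxplus> Affine x4 y4)"
  shows "Affine x1 y1 \<boxplus> Affine x2 y2 \<boxplus> Affine x4 y4 = Affine x1 y1 \<boxplus> (Affine x2 y2 \<boxplus> Affine x4 y4)"
proof -
  let ?A = "Affine x1 y1" and ?B = "Affine x2 y2" and ?D = "Affine x4 y4"
  have "?B \<noteq> neg (?A)"
    using assms(4) by simp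
  then obtain l n k m x3 x5 where "?A \<boxplus> ?B = neg (Affine x3 (l * x3 + n))"
    and U: "?A \<boxplus> ?B \<boxplus> ?D = neg (Affine x5 (k * x5 + m))"
    and y: "y1 = l * x1 + n" "y2 = l * x2 + n" "y4 = k * x4 + m"
    and L: "on_line l n x1 x2 x3" "on_line k m x3 x4 x5" "(l * x3 + n) + (k * x3 + m) + a1 * x3 + a3 = 0"
    by (rule sum_lines[OF assms(1,2,3) _ assms(7)])
  obtain s u w where "s = l + k + a1" and f: "\<forall>x. x^2 + u * x + w - s * (l * x + n) = (x - x1) * (x - x2)"
    "\<forall>x. x^2 + u * x + w - s * (k * x + m) = (x - x4) * (x - x5)"
    "x5 = s^2 - a1 * s - 2 * u - x1 - x2 - x4"
    by (rule sum_function[OF L])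
  have "?D \<noteq> neg (?B)"
    using assms(5) by simp
  then obtain l' n' k' m' x3' x5' where "?B \<boxplus> ?D = neg (Affine x3' (l' * x3' + n'))"
    and V: "?B \<boxplus> ?D \<boxplus> ?A = neg (Affine x5' (k' * x5' + m'))"
    and y': "y2 = l' * x2 + n'" "y4 = l' * x4 + n'" "y1 = k' * x1 + m'"
    and L': "on_line l' n' x2 x4 x3'" "on_line k' m' x3' x1 x5'" "(l' * x3' + n') + (k' * x3' + m') + a1 * x3' + a3 = 0"
    by (rule sum_lines[OF assms(2,3,1) _ assms(8)])
  obtain s' u' w' where "s' = l' + k' + a1" and f': "\<forall>x. x^2 + u' * x + w' - s' * (l' * x + n') = (x - x2) * (x - x4)"
    "\<forall>x. x^2 + u' * x + w' - s' * (k' * x + m') = (x - x1) * (x - x5')"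
    "x5' = s'^2 - a1 * s' - 2 * u' - x2 - x4 - x1"
    by (rule sum_function[OF L'])
  have 1: "x1^2 + u * x1 + w = s * y1" "x2^2 + u * x2 + w = s * y2" "x4^2 + u * x4 + w = s * y4"
    using f(1)[rule_format, of x1] f(1)[rule_format, of x2] f(2)[rule_format, of x4] by (simp_all add: y(1) y(2) y(3))
  have 2: "x1^2 + u' * x1 + w' = s' * y1" "x2^2 + u' * x2 + w' = s' * y2" "x4^2 + u' * x4 + w' = s' * y4"
    using f'(2)[rule_format, of x1] f'(1)[rule_format, of x2] f'(1)[rule_format, of x4] by (simp_all add: y'(1) y'(2) y'(3))
  have "s = s'"
  proof (rule ccontr)
    assume "s \<noteq> s'"
    have "(s - s') * (y4 - y1) * (x2 - x1) = (s - s') * (y2 - y1) * (x4 - x1)"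
      using 1 2 by Groebner_Basis.algebra
    with \<open>s \<noteq> s'\<close> have "(y4 - y1) * (x2 - x1) = (y2 - y1) * (x4 - x1)"
      by simp
    then have "(x2 - x1) * (y4 - (l * x4 + n)) = 0"
      unfolding y(1,2) by Groebner_Basis.algebra
    with assms(4) have "y4 = l * x4 + n" by simp
    with f(1)[rule_format, of x4] 1(3) assms(5,6) show False by simp
  qed
  moreover have "u = u'"
  proof -
    have "(u - u') * (x1 - x2) = 0"
      using 1 2 \<open>s = s'\<close> by Groebner_Basis.algebra
    with assms(4) show ?thesis by simp
  qed
  moreover have "w = w'"
    using 1(1) 2(1) calculation by Groebner_Basis.algebra
  moreover have "x5' = x5"
    unfolding f(3) f'(3) \<open>s = s'\<close> \<open>u = u'\<close> by (simp add: algebra_simps)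
  moreover have "s \<noteq> 0"
    using f(1)[rule_format, of x4] 1(3) assms(5,6) by auto
  ultimately have "?A \<boxplus> ?B \<boxplus> ?D = ?B \<boxplus> ?D \<boxplus> ?A"
    unfolding U V by (rule same_function_same_sum[OF _ _ _ _ _ f(2) f'(2)])
  also have "\<dots> = ?A \<boxplus> (?B \<boxplus> ?D)"
    by (intro plus_commute on_plus assms)
  finally show ?thesis .
qed

text \<open>The condition at a second point becomes a condition on the slope: the function vanishes
  doubly along the tangent, 2 x1 + u = s l. For the other bracketing both lines only pass through
  the point, so the double zero has to be derived.\<close>

lemma assoc_double:
  assumes "on (Affine x1 y1)" "on (Affine x4 y4)" "x1 \<noteq> x4"
    and "Affine x1 y1 \<noteq> neg (Affine x1 y1)"
    and "Affine x4 y4 \<noteq> neg (Affine x1 y1 \<boxplus> Affine x1 y1)"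
    and "Affine x4 y4 \<boxplus> Affine x1 y1 = Affine x6 y6" "x6 \<noteq> x1"
  shows "Affine x1 y1 \<boxplus> Affine x1 y1 \<boxplus> Affine x4 y4 = Affine x1 y1 \<boxplus> (Affine x1 y1 \<boxplus> Affine x4 y4)"
proof -
  let ?A = "Affine x1 y1" and ?D = "Affine x4 y4"
  obtain l n k m x3 x5 where A: "?A \<boxplus> ?A = neg (Affine x3 (l * x3 + n))"
    and U: "?A \<boxplus> ?A \<boxplus> ?D = neg (Affine x5 (k * x5 + m))"
    and y: "y1 = l * x1 + n" "y4 = k * x4 + m"
    and L: "on_line l n x1 x1 x3" "on_line k m x3 x4 x5" "(l * x3 + n) + (k * x3 + m) + a1 * x3 + a3 = 0"
    by (rule sum_lines[OF assms(1,1,2) assms(4,5)])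
  obtain s u w where "s = l + k + a1" and f: "\<forall>x. x^2 + u * x + w - s * (l * x + n) = (x - x1) * (x - x1)"
    "\<forall>x. x^2 + u * x + w - s * (k * x + m) = (x - x4) * (x - x5)"
    "x5 = s^2 - a1 * s - 2 * u - x1 - x1 - x4"
    by (rule sum_function[OF L])
  define d where "d = 2 * y1 + a1 * x1 + a3"
  have tangent: "d * l = 3 * x1^2 + 2 * a2 * x1 + a4 - a1 * y1"
    using L(1) unfolding on_line_def y(1) d_def by Groebner_Basis.algebra
  have ne: "?A \<noteq> neg (?D)" "?A \<noteq> neg (?D \<boxplus> ?A)"
    unfolding assms(6) using assms(3,7) by simp_all
  obtain l' n' k' m' x3' x5' where A': "?D \<boxplus> ?A = neg (Affine x3' (l' * x3' + n'))"
    and V: "?D \<boxplus> ?A \<boxplus> ?A = neg (Affine x5' (k' * x5' + m'))"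
    and y': "y4 = l' * x4 + n'" "y1 = l' * x1 + n'" "y1 = k' * x1 + m'"
    and L': "on_line l' n' x4 x1 x3'" "on_line k' m' x3' x1 x5'" "(l' * x3' + n') + (k' * x3' + m') + a1 * x3' + a3 = 0"
    by (rule sum_lines[OF assms(2,1,1) ne])
  obtain s' u' w' where s': "s' = l' + k' + a1"
    and f': "\<forall>x. x^2 + u' * x + w' - s' * (l' * x + n') = (x - x4) * (x - x1)"
    "\<forall>x. x^2 + u' * x + w' - s' * (k' * x + m') = (x - x1) * (x - x5')"
    "x5' = s'^2 - a1 * s' - 2 * u' - x4 - x1 - x1"
    by (rule sum_function[OF L'])
  have "x3' = x6"
    using A' assms(6) by simp
  \<comment> \<open>\<open>d1\<close> is the derivative at x1 of the cubic on the first chord,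
    \<open>d2\<close> compares the two chords at x1 and x3', and \<open>d3\<close> is the derivative
    of the function along the first chord. Their combination contains the factor x1 - x3', non-zero
    because x6 differs from x1.\<close>
  have d1: "(x1 - x3') * (x1 - x4) = (l - l') * d"
    using L'(1) tangent y'(2) unfolding on_line_def d_def by Groebner_Basis.algebra
  have d2: "s' * (x1 - x3') = d"
    using L'(3) y'(2,3) unfolding s' d_def by Groebner_Basis.algebra
  have d3: "2 * x1 + u' - s' * l' = x1 - x4"
    using f'(1)[rule_format, of 0] f'(1)[rule_format, of 1] by (simp add: algebra_simps)
  have "(x1 - x3') * (2 * x1 + u' - s' * l) = 0"
    using d1 d2 d3 by Groebner_Basis.algebra
  then have slope': "2 * x1 + u' = s' * l"
    using assms(7) \<open>x3' = x6\<close> by simp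
  have slope: "2 * x1 + u = s * l"
    using f(1)[rule_format, of 0] f(1)[rule_format, of 1] by (simp add: algebra_simps)
  have 1: "x1^2 + u * x1 + w = s * y1" "x4^2 + u * x4 + w = s * y4"
    using f(1)[rule_format, of x1] f(2)[rule_format, of x4] by (simp_all add: y(1) y(2))
  have 2: "x1^2 + u' * x1 + w' = s' * y1" "x4^2 + u' * x4 + w' = s' * y4"
    using f'(2)[rule_format, of x1] f'(1)[rule_format, of x4] by (simp_all add: y'(1) y'(3))
  have "s = s'"
  proof (rule ccontr)
    assume "s \<noteq> s'"
    have "(s - s') * (y4 - (l * x4 + n)) = 0"
      using 1 2 slope slope' y(1) by Groebner_Basis.algebra
    with \<open>s \<noteq> s'\<close> have "y4 = l * x4 + n" by simp
    with f(1)[rule_format, of x4] 1(2) assms(3) show False by simp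
  qed
  moreover have "u = u'"
    using slope slope' \<open>s = s'\<close> by Groebner_Basis.algebra
  moreover have "w = w'"
    using 1(1) 2(1) calculation by Groebner_Basis.algebra
  moreover have "x5' = x5"
    unfolding f(3) f'(3) \<open>s = s'\<close> \<open>u = u'\<close> by (simp add: algebra_simps)
  moreover have "s \<noteq> 0"
    using f(1)[rule_format, of x4] 1(2) assms(3) by auto
  ultimately have "?A \<boxplus> ?A \<boxplus> ?D = ?D \<boxplus> ?A \<boxplus> ?A"
    unfolding U V by (rule same_function_same_sum[OF _ _ _ _ _ f(2) f'(2)])
  also have "\<dots> = ?A \<boxplus> (?A \<boxplus> ?D)"
    by (metis plus_commute on_plus assms(1,2))
  finally show ?thesis .
qed

text \<open>The case distinctions disappear if associativity is only required for all but finitely many third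
  summands; the full law then follows by adding a generic point to both sides and cancelling it.\<close>

definition generic :: "'a point filter" where
  "generic = inf cofinite (principal (Collect on))"

lemma eventually_generic_iff: "eventually Q generic \<longleftrightarrow> finite {D. on D \<and> \<not> Q D}"
  by (simp add: generic_def eventually_inf_principal eventually_cofinite)

lemma infinite_on: "infinite (Collect on)"
proof
  assume "finite (Collect on)"
  then have "finite ((\<lambda>P. case P of Affine x y \<Rightarrow> x | Infinity \<Rightarrow> 0) ` Collect on)"
    by simp
  moreover have "x \<in> (\<lambda>P. case P of Affine x y \<Rightarrow> x | Infinity \<Rightarrow> 0) ` Collect on" for x
  proof -
    have "Polynomial.degree [: - cubic x, a1 * x + a3, 1 :] > 0"
      by simp
    then obtain y where "poly [: - cubic x, a1 * x + a3, 1 :] y = 0"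
      using alg_closed_imp_poly_has_root by blast
    then have "on (Affine x y)"
      unfolding on_iff by (simp add: algebra_simps power2_eq_square)
    then show ?thesis
      by (intro image_eqI[of _ _ "Affine x y"]) simp_all
  qed
  ultimately have "finite (UNIV :: 'a set)"
    by (metis UNIV_eq_I)
  then show False
    using infinite_UNIV_char_0 by blast
qed

lemma generic_exists:
  assumes "eventually Q generic"
  obtains D where "on D" "Q D"
proof -
  have "\<not> Collect on \<subseteq> {D. on D \<and> \<not> Q D}"
    using assms infinite_on finite_subset unfolding eventually_generic_iff by blast
  with that show ?thesis by blast
qed

lemma generic_neq: "eventually (\<lambda>D. D \<noteq> P) generic"
  unfolding eventually_generic_iff by (rule finite_subset[of _ "{P}"]) auto

lemma generic_affine: "eventually (\<lambda>D. \<exists>x y. D = Affine x y \<and> on D \<and> x \<noteq> c) generic"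
proof -
  have "finite {D. on D \<and> (\<exists>y. D = Affine c y)}"
  proof (cases "\<exists>y. on (Affine c y)")
    case True
    then obtain y where "on (Affine c y)" ..
    then have "{D. on D \<and> (\<exists>y. D = Affine c y)} \<subseteq> {Affine c y, neg (Affine c y)}"
      using same_x[of c y] by (auto simp del: on_curve.simps)
    then show ?thesis
      by (rule finite_subset) simp
  next
    case False
    then have "{D. on D \<and> (\<exists>y. D = Affine c y)} = {}"
      by (auto simp del: on_curve.simps)
    then show ?thesis by (metis finite.emptyI)
  qed
  then have "finite (insert Infinity {D. on D \<and> (\<exists>y. D = Affine c y)})"
    by simp
  then show ?thesis
    unfolding eventually_generic_iff
    by (rule rev_finite_subset) (auto simp del: on_curve.simps, metis point.exhaust)
qed

lemma neg_plus_cancel_generic: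
  assumes "on P"
  shows "eventually (\<lambda>D. P \<boxplus> D \<boxplus> neg P = D) generic"
proof (cases P)
  case (Affine x y)
  show ?thesis
    using generic_affine[of x]
    by eventually_elim (use assms neg_plus_cancel_chord[of x y] in \<open>auto simp: Affine simp del: on_curve.simps neg.simps\<close>)
qed simp

text \<open>Outside a finite set D is recovered from P + D by subtracting P, so a finite set of
  exceptional sums comes from finitely many D.\<close>

lemma generic_plus:
  assumes "on P" "eventually Q generic"
  shows "eventually (\<lambda>D. Q (P \<boxplus> D)) generic"
proof -
  have "{D. on D \<and> \<not> Q (P \<boxplus> D)} \<subseteq>
    {D. on D \<and> P \<boxplus> D \<boxplus> neg P \<noteq> D} \<union> (\<lambda>C. C \<boxplus> neg P) ` {C. on C \<and> \<not> Q C}"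
    using on_plus[OF assms(1)] by (auto simp: image_iff) metis
  then show ?thesis
    using assms(2) neg_plus_cancel_generic[OF assms(1)] unfolding eventually_generic_iff
    by (meson finite_UnI finite_imageI finite_subset)
qed

text \<open>With P and Q fixed, every side condition of \<open>assoc_distinct\<close> and
  \<open>assoc_double\<close> on the third summand fails for finitely many D only.\<close>

lemma assoc_generic:
  assumes P: "on P" and Q: "on Q"
  shows "eventually (\<lambda>D. P \<boxplus> Q \<boxplus> D = P \<boxplus> (Q \<boxplus> D)) generic"
proof (cases P; cases Q)
  fix x1 y1 x2 y2
  assume PQ: "P = Affine x1 y1" "Q = Affine x2 y2"
  consider "Q = neg P" | "Q \<noteq> neg P" "x1 = x2" | "x1 \<noteq> x2"
    by blast
  then show ?thesis
  proof cases
    case 1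
    show ?thesis
      using generic_affine[of x1] neg_plus_cancel_generic[OF Q]
    proof eventually_elim
      case (elim D)
      then have "P \<boxplus> (Q \<boxplus> D) = D"
        using 1 P Q on_plus plus_commute by (metis neg_neg)
      with 1 show ?case by simp
    qed
  next
    case 2
    then have "Q = P"
      using same_x[of x1 y1 y2] assms unfolding PQ by auto
    have "eventually (\<lambda>D. \<exists>x y. P \<boxplus> D = Affine x y \<and> on (P \<boxplus> D) \<and> x \<noteq> x1) generic"
      using generic_plus[OF P generic_affine] .
    with generic_affine[of x1] generic_neq[of "neg (P \<boxplus> P)"] show ?thesis
    proof eventually_elim
      case (elim D)
      then obtain x y x' y' where D: "D = Affine x y" "on D" "x1 \<noteq> x" "P \<boxplus> D = Affine x' y'" "x' \<noteq> x1"
        by metis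
      have "D \<boxplus> P = Affine x' y'"
        using D(4) plus_commute[OF P D(2)] by simp
      then show ?case
        using assoc_double[of x1 y1 x y x' y'] D P 2(1) elim(2) \<open>Q = P\<close> unfolding PQ(1) by metis
    qed
  next
    case 3
    have "eventually (\<lambda>D. Q \<boxplus> D \<noteq> neg P) generic"
      using generic_plus[OF Q generic_neq] .
    with generic_affine[of x1] generic_affine[of x2] generic_neq[of "neg (P \<boxplus> Q)"] show ?thesis
    proof eventually_elim
      case (elim D)
      then obtain x y where D: "D = Affine x y" "on D" "x1 \<noteq> x" "x2 \<noteq> x"
        by (metis point.inject)
      then show ?case
        using assoc_distinct[of x1 y1 x2 y2 x y] P Q 3 elim(3,4) unfolding PQ D(1) by (metis neg_neg)
    qed
  qed
qed simp_all

lemma plus_assoc: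
  assumes "on P" "on Q" "on R"
  shows "P \<boxplus> Q \<boxplus> R = P \<boxplus> (Q \<boxplus> R)" (is "?U = ?V")
proof -
  \<comment> \<open>Both sides are brought to P + (Q + (R + D)); each of the four moves is an
    instance of associativity with a generic last summand.\<close>
  have "eventually (\<lambda>D. ?U \<boxplus> D = ?V \<boxplus> D) generic"
    using assoc_generic[OF on_plus[OF assms(1,2)] assms(3)] generic_plus[OF assms(3) assoc_generic[OF assms(1,2)]]
      assoc_generic[OF assms(1) on_plus[OF assms(2,3)]] assoc_generic[OF assms(2,3)]
    by eventually_elim simp
  moreover have cancel: "eventually (\<lambda>D. D \<boxplus> W \<boxplus> neg D = W) generic" if "on W" for W
  proof (cases W)
    case (Affine x y)
    show ?thesis
      using generic_affine[of x]
      by eventually_elim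
        (use that neg_plus_cancel_chord in \<open>auto simp: Affine simp del: on_curve.simps neg.simps\<close>)
  qed simp
  have on: "on ?U" "on ?V"
    by (intro on_plus assms)+
  ultimately have "eventually (\<lambda>D. ?U \<boxplus> D = ?V \<boxplus> D \<and> D \<boxplus> ?U \<boxplus> neg D = ?U \<and> D \<boxplus> ?V \<boxplus> neg D = ?V) generic"
    by (intro eventually_conj cancel)
  then obtain D where "on D" "?U \<boxplus> D = ?V \<boxplus> D" "D \<boxplus> ?U \<boxplus> neg D = ?U" "D \<boxplus> ?V \<boxplus> neg D = ?V"
    by (rule generic_exists) auto
  then show ?thesis
    using plus_commute on by metis
qed

end

subsection \<open>Torsion points\<close>

context elliptic
begin

abbreviation times :: "nat \<Rightarrow> 'a point \<Rightarrow> 'a point" (infixr "\<cdot>" 75) where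
  "n \<cdot> P \<equiv> point_mult (Weierstrass a1 a2 a3 a4 a6) n P"

lemma times_0 [simp]: "0 \<cdot> P = Infinity" and times_Suc: "Suc n \<cdot> P = P \<boxplus> n \<cdot> P"
  and times_1 [simp]: "Suc 0 \<cdot> P = P"
  by (simp_all add: point_mult_def)

lemma on_Infinity: "on Infinity"
  by simp

lemma on_times: "on P \<Longrightarrow> on (n \<cdot> P)"
  by (induction n) (auto simp: times_Suc on_plus simp del: on_curve.simps intro: on_Infinity)

lemma times_Infinity [simp]: "n \<cdot> Infinity = Infinity"
  by (induction n) (auto simp: times_Suc)

lemma times_add: "on P \<Longrightarrow> (m + n) \<cdot> P = m \<cdot> P \<boxplus> n \<cdot> P"
  by (induction m) (auto simp: times_Suc plus_assoc on_times simp del: on_curve.simps)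

lemma times_times: "on P \<Longrightarrow> m \<cdot> n \<cdot> P = (m * n) \<cdot> P"
  by (induction m) (auto simp: times_Suc times_add simp del: on_curve.simps)

lemma plus_swap:
  assumes "on P" "on Q" "on R" "on U"
  shows "(P \<boxplus> Q) \<boxplus> (R \<boxplus> U) = (P \<boxplus> R) \<boxplus> (Q \<boxplus> U)"
proof -
  have "(P \<boxplus> Q) \<boxplus> (R \<boxplus> U) = P \<boxplus> ((Q \<boxplus> R) \<boxplus> U)"
    using assms by (simp only: plus_assoc on_plus)
  also have "Q \<boxplus> R = R \<boxplus> Q"
    using assms plus_commute by blast
  also have "P \<boxplus> ((R \<boxplus> Q) \<boxplus> U) = (P \<boxplus> R) \<boxplus> (Q \<boxplus> U)"
    using assms by (simp only: plus_assoc on_plus)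
  finally show ?thesis .
qed

lemma times_plus: "on P \<Longrightarrow> on Q \<Longrightarrow> n \<cdot> (P \<boxplus> Q) = n \<cdot> P \<boxplus> n \<cdot> Q"
  by (induction n) (auto simp: times_Suc plus_swap on_times simp del: on_curve.simps)

lemma times_mod:
  assumes "on P" "p \<cdot> P = Infinity"
  shows "(n mod p) \<cdot> P = n \<cdot> P"
proof -
  have "n \<cdot> P = (n div p * p + n mod p) \<cdot> P"
    by simp
  also have "\<dots> = (n div p) \<cdot> p \<cdot> P \<boxplus> (n mod p) \<cdot> P"
    using assms(1) by (simp only: times_add times_times)
  finally show ?thesis
    using assms(2) by simp
qed

section \<open>Galois action on points\<close>

context
  fixes f :: "'a \<Rightarrow> 'a"
  assumes f: "hom_on UNIV f" and coeffs: "f a1 = a1" "f a2 = a2" "f a3 = a3" "f a4 = a4" "f a6 = a6"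
begin

lemmas f_simps = hom_on_simps[OF field_set_UNIV f, simplified]

lemma f_numeral: "f (numeral n) = numeral n"
proof -
  have "f (of_nat m) = of_nat m" for m
    by (induction m) (auto simp: f_simps)
  from this[of "numeral n"] show ?thesis by simp
qed

lemma f_eq_iff: "f x = f y \<longleftrightarrow> x = y"
  using hom_on_inj[OF field_set_UNIV f] by (auto dest: injD)

lemma f_eq_0_iff: "f x = 0 \<longleftrightarrow> x = 0"
  using hom_on_eq_0_iff[OF field_set_UNIV f] by simp

lemma map_point_plus: "map_point f (P \<boxplus> Q) = map_point f P \<boxplus> map_point f Q"
proof (cases P; cases Q)
  fix x1 y1 x2 y2
  assume PQ: "P = Affine x1 y1" "Q = Affine x2 y2"
  have eq: "f x1 = f x2 \<and> f y1 + f y2 + a1 * f x2 + a3 = 0 \<longleftrightarrow> x1 = x2 \<and> y1 + y2 + a1 * x2 + a3 = 0"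
    using f_eq_0_iff[of "y1 + y2 + a1 * x2 + a3"] by (simp add: f_simps coeffs f_eq_iff)
  show ?thesis
    unfolding PQ point.map point_add.simps(3) eq Let_def
    by (simp add: f_simps coeffs f_eq_iff f_numeral)
qed auto

lemma map_point_times: "map_point f (n \<cdot> P) = n \<cdot> map_point f P"
  by (induction n) (auto simp: times_Suc map_point_plus)

lemma on_map_point: "on P \<Longrightarrow> on (map_point f P)"
proof (cases P)
  case (Affine x y)
  assume "on P"
  then have "f (y^2 + a1 * x * y + a3 * y) = f (x^3 + a2 * x^2 + a4 * x + a6)"
    by (simp add: Affine)
  then show ?thesis
    by (simp add: Affine f_simps coeffs)
qed simp

end

end

lemma map_point_eq_imp_eq:
  "map_point f P = map_point h P \<Longrightarrow> x \<in> set_point P \<Longrightarrow> f x = h x"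
  by (cases P) auto

locale torsion_data = elliptic a1 a2 a3 a4 a6
  for a1 a2 a3 a4 a6 :: "'a::{alg_closed_field,field_char_0}" +
  fixes K M :: "'a set" and p g :: nat and S T :: "'a point" and V :: "'a point set"
  assumes K: "field_set K" and alg: "algebraic_over K"
    and coeffs: "a1 \<in> K" "a2 \<in> K" "a3 \<in> K" "a4 \<in> K" "a6 \<in> K"
    and V: "V = {P. on P \<and> p \<cdot> P = Infinity}"
    and p: "Factorial_Ring.prime p" and g: "residue_primroot p g"
    and ST: "S \<in> V" "T \<in> V"
    and basis: "bij_betw (\<lambda>(i, j). i \<cdot> S \<boxplus> j \<cdot> T) ({..<p} \<times> {..<p}) V"
    and image: "\<And>\<rho>. \<rho> \<in> abs_gal K \<Longrightarrow>
      map_point \<rho> S = S \<and> (\<exists>y x. 0 < x \<and> x < p \<and> map_point \<rho> T = y \<cdot> S \<boxplus> x \<cdot> T)"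
    and M: "M = adjoin K (\<Union>P\<in>V. set_point P)"
begin

lemma on_ST: "on S" "on T" and times_p: "p \<cdot> S = Infinity" "p \<cdot> T = Infinity"
  using ST by (auto simp: V simp del: on_curve.simps)

lemma p_gt_1: "p > 1"
  using prime_gt_1_nat[OF p] .

definition comb :: "nat \<Rightarrow> nat \<Rightarrow> 'a point" where
  "comb i j = i \<cdot> S \<boxplus> j \<cdot> T"

lemma comb_mod: "comb (i mod p) (j mod p) = comb i j"
  using times_mod on_ST times_p by (simp add: comb_def)

lemma comb_eqD:
  assumes "comb i j = comb i' j'"
  shows "i mod p = i' mod p" "j mod p = j' mod p"
proof -
  have "(\<lambda>(i, j). i \<cdot> S \<boxplus> j \<cdot> T) (i mod p, j mod p) = (\<lambda>(i, j). i \<cdot> S \<boxplus> j \<cdot> T) (i' mod p, j' mod p)"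
    using assms comb_mod[of i j] comb_mod[of i' j'] by (simp add: comb_def)
  moreover have "inj_on (\<lambda>(i, j). i \<cdot> S \<boxplus> j \<cdot> T) ({..<p} \<times> {..<p})"
    using basis by (simp add: bij_betw_def)
  ultimately have "(i mod p, j mod p) = (i' mod p, j' mod p)"
    using p_gt_1 by (elim inj_onD) auto
  then show "i mod p = i' mod p" "j mod p = j' mod p" by auto
qed

lemma comb_T: "comb 0 1 = T"
  by (simp add: comb_def)

lemma torsion_comb: "P \<in> V \<Longrightarrow> \<exists>i j. P = comb i j"
  using basis by (auto simp: bij_betw_def comb_def)

lemma field_set_M: "field_set M"
  by (simp add: M field_set_adjoin)

lemma K_subset_M: "K \<subseteq> M" and torsion_subset_M: "P \<in> V \<Longrightarrow> set_point P \<subseteq> M"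
  using adjoin_superset[of K "\<Union>P\<in>V. set_point P"] adjoin_superset[of "\<Union>P\<in>V. set_point P" K]
  unfolding M by auto

context
  fixes \<rho> assumes \<rho>: "\<rho> \<in> abs_gal K"
begin

lemma hom_\<rho>: "hom_on UNIV \<rho>" and \<rho>_coeffs: "\<rho> a1 = a1" "\<rho> a2 = a2" "\<rho> a3 = a3" "\<rho> a4 = a4" "\<rho> a6 = a6"
  using abs_gal_hom[OF \<rho>] abs_gal_fixes[OF \<rho>] coeffs by auto

lemmas \<rho>_plus = map_point_plus[OF hom_\<rho> \<rho>_coeffs]
  and \<rho>_times = map_point_times[OF hom_\<rho> \<rho>_coeffs]

lemma \<rho>_torsion: "P \<in> V \<Longrightarrow> map_point \<rho> P \<in> V"
  using on_map_point[OF hom_\<rho> \<rho>_coeffs] \<rho>_times[of p P, symmetric] by (simp add: V del: on_curve.simps)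

lemma \<rho>_comb: "map_point \<rho> (comb i j) = i \<cdot> S \<boxplus> j \<cdot> map_point \<rho> T"
  using image[OF \<rho>] by (simp add: comb_def \<rho>_plus \<rho>_times)

lemma \<rho>_closed: "x \<in> M \<Longrightarrow> \<rho> x \<in> M"
proof -
  have "set_point P \<subseteq> {x \<in> UNIV. \<rho> x \<in> M}" if "P \<in> V" for P
    using torsion_subset_M[OF \<rho>_torsion[OF that]] by (auto simp: point.set_map)
  then have "M \<subseteq> {x \<in> UNIV. \<rho> x \<in> M}"
    using K_subset_M abs_gal_fixes[OF \<rho>]
    by (subst M, intro adjoin_subset field_set_vimage[OF field_set_UNIV hom_\<rho> field_set_M]) auto
  then show "x \<in> M \<Longrightarrow> \<rho> x \<in> M" by blast
qed

end

text \<open>S is fixed by the whole group, so the image of T determines that of every combination of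
  S and T, hence of all coordinates generating M.\<close>

lemma eq_on_M:
  assumes "\<rho> \<in> abs_gal K" "\<rho>' \<in> abs_gal K" "map_point \<rho> T = map_point \<rho>' T" "x \<in> M"
  shows "\<rho> x = \<rho>' x"
proof -
  have "\<rho> y = \<rho>' y" if "P \<in> V" "y \<in> set_point P" for P y
  proof -
    obtain i j where "P = comb i j"
      using torsion_comb[OF \<open>P \<in> V\<close>] by blast
    then have "map_point \<rho> P = map_point \<rho>' P"
      using \<rho>_comb assms by simp
    then show ?thesis
      using map_point_eq_imp_eq that by metis
  qed
  moreover have "\<rho> y = \<rho>' y" if "y \<in> K" for y
    using abs_gal_fixes[OF assms(1) that] abs_gal_fixes[OF assms(2) that] by simp
  ultimately show ?thesis
    using hom_on_eq_adjoin[OF field_set_UNIV abs_gal_hom[OF assms(1)] abs_gal_hom[OF assms(2)] subset_UNIV, of K "\<Union>P\<in>V. set_point P" x]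
      assms(4) unfolding M by blast
qed

context
  fixes s t
  assumes s: "s \<in> abs_gal K" "map_point s T = S \<boxplus> T"
    and t: "t \<in> abs_gal K" "map_point t T = g \<cdot> T"
begin

lemma s_comb: "map_point (s ^^ n) (comb i j) = comb (i + n * j) j"
proof (induction n)
  case (Suc n)
  have step: "map_point s (comb k j) = comb (k + j) j" for k
  proof -
    have "map_point s (comb k j) = k \<cdot> S \<boxplus> (j \<cdot> S \<boxplus> j \<cdot> T)"
      using \<rho>_comb[OF s(1)] s(2) times_plus[OF on_ST] by simp
    also have "\<dots> = comb (k + j) j"
      unfolding comb_def using on_ST by (simp only: times_add plus_assoc on_times)
    finally show ?thesis .
  qed
  then show ?case
    unfolding funpow.simps point.map_comp[symmetric] Suc.IH step by (simp add: ac_simps)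
qed (simp add: point.map_id0 id_def[symmetric])

lemma t_comb: "map_point (t ^^ n) (comb i j) = comb i (g ^ n * j)"
proof (induction n)
  case (Suc n)
  have step: "map_point t (comb i k) = comb i (g * k)" for k
    using \<rho>_comb[OF t(1)] t(2) times_times[OF on_ST(2)] by (simp add: comb_def mult.commute)
  then show ?case
    unfolding funpow.simps point.map_comp[symmetric] Suc.IH step by (simp add: mult.assoc)
qed (simp add: point.map_id0 id_def[symmetric])

lemma s_T: "map_point (s ^^ n) T = comb n 1" and t_T: "map_point (t ^^ n) T = comb 0 (g ^ n)"
  using s_comb[of n 0 1] t_comb[of n 0 1] unfolding comb_T by simp_all

lemma coprime_g: "coprime g p"
  using g by (simp add: residue_primroot_def coprime_commute)

lemma s_order: "x \<in> M \<Longrightarrow> (s ^^ p) x = x"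
proof -
  have eq: "map_point (s ^^ p) T = map_point (s ^^ 0) T"
    unfolding s_T using comb_mod[of p 1] comb_mod[of 0 1] by simp
  show "(s ^^ p) x = x" if "x \<in> M"
    using eq_on_M[OF abs_gal_funpow[OF s(1)] abs_gal_funpow[OF s(1)] eq that] by simp
qed

lemma t_order: "x \<in> M \<Longrightarrow> (t ^^ (p - 1)) x = x"
proof -
  have "\<not> p dvd g"
    using coprime_g p_gt_1 coprime_absorb_right by force
  then have "[g ^ (p - 1) = 1] (mod p)"
    using fermat_theorem[OF p] by blast
  then have eq: "map_point (t ^^ (p - 1)) T = map_point (t ^^ 0) T"
    unfolding t_T using comb_mod[of 0 "g ^ (p - 1)"] comb_mod[of 0 1] by (simp add: cong_def)
  show "(t ^^ (p - 1)) x = x" if "x \<in> M"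
    using eq_on_M[OF abs_gal_funpow[OF t(1)] abs_gal_funpow[OF t(1)] eq that] by simp
qed

text \<open>Both composites send T to g S + g T.\<close>

lemma s_t_commute: "x \<in> M \<Longrightarrow> s (t x) = t ((s ^^ g) x)"
proof -
  have "map_point (\<lambda>x. s (t x)) T = map_point (s ^^ 1) (map_point (t ^^ 1) T)"
    by (simp add: point.map_comp o_def)
  also have "\<dots> = map_point (t ^^ 1) (map_point (s ^^ g) T)"
    unfolding s_T t_T t_comb s_comb by simp
  also have "\<dots> = map_point (\<lambda>x. t ((s ^^ g) x)) T"
    by (simp add: point.map_comp o_def)
  finally show "x \<in> M \<Longrightarrow> s (t x) = t ((s ^^ g) x)"
    using eq_on_M[OF abs_gal_compose[OF s(1) t(1)] abs_gal_compose[OF t(1) abs_gal_funpow[OF s(1)]]] by blast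
qed

text \<open>If T goes to y S + x T, then x = g^j mod p for some j since g is a primitive root. As
  s^i t^j sends T to i g^j S + g^j T, the exponent i is y divided by x mod p.\<close>

lemma s_t_generate:
  assumes "\<rho> \<in> abs_gal K"
  shows "\<exists>i j. \<forall>x\<in>M. \<rho> x = (s ^^ i) ((t ^^ j) x)"
proof -
  obtain y x where yx: "0 < x" "x < p" "map_point \<rho> T = comb y x"
    using image[OF assms] unfolding comb_def by blast
  have "\<not> p dvd x"
    using yx nat_dvd_not_less by blast
  then have "x \<in> totatives p"
    using yx p by (auto simp: totatives_def prime_imp_coprime_nat coprime_commute)
  then obtain j where j: "x = g ^ j mod p"
    using residue_primroot_is_generator[OF p_gt_1 g] unfolding bij_betw_def by blast
  obtain l where l: "(x * l) mod p = 1"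
    using mult_inverse_mod[OF p \<open>\<not> p dvd x\<close>] .
  define i where "i = y * l"
  have "(i * g ^ j) mod p = (y * ((x * l) mod p)) mod p"
    unfolding i_def j by (simp add: mod_mult_left_eq mod_mult_right_eq mult_ac)
  then have i: "(i * g ^ j) mod p = y mod p"
    using l by simp
  have "map_point (\<lambda>x. (s ^^ i) ((t ^^ j) x)) T = map_point (s ^^ i) (map_point (t ^^ j) T)"
    by (simp add: point.map_comp o_def)
  also have "\<dots> = comb (i * g ^ j) (g ^ j)"
    unfolding t_T s_comb by simp
  also have "\<dots> = comb y x"
    using comb_mod[of "i * g ^ j" "g ^ j"] comb_mod[of y x] i j by simp
  finally have "map_point \<rho> T = map_point (\<lambda>x. (s ^^ i) ((t ^^ j) x)) T"
    using yx(3) by simp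
  then show ?thesis
    using eq_on_M[OF assms abs_gal_compose[OF abs_gal_funpow[OF s(1)] abs_gal_funpow[OF t(1)]]] by blast
qed

text \<open>For every \<open>j\<close>, one of the coordinates \<open>x, y\<close> of \<open>T\<close> has different images under \<open>s\<close> and \<open>t\<^sup>j\<close>; a
  combination \<open>x + n y\<close> then works for all \<open>j\<close> simultaneously.\<close>

lemma separating_element: "\<exists>z\<in>M. \<forall>j. s z \<noteq> (t ^^ j) z"
proof -
  have "T \<noteq> Infinity"
    using comb_eqD(2)[of 0 1 0 0] p_gt_1 by (auto simp: comb_def)
  then obtain x y where T: "T = Affine x y"
    by (cases T) auto
  have xy: "x \<in> M" "y \<in> M"
    using torsion_subset_M[OF ST(2)] by (auto simp: T)
  have hom: "(f :: 'a \<Rightarrow> 'a) (x + of_nat n * y) = f x + of_nat n * f y" if "f \<in> abs_gal K" for f n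
    using abs_gal_hom[OF that] abs_gal_fixes[OF that field_set_of_nat[OF K]]
    by (simp add: hom_on_simps[OF field_set_UNIV])
  have ne: "s x \<noteq> (t ^^ j) x \<or> s y \<noteq> (t ^^ j) y" for j
  proof -
    have "map_point (s ^^ 1) T \<noteq> map_point (t ^^ j) T"
      unfolding s_T t_T using comb_eqD(1)[of 1 1 0 "g ^ j"] p_gt_1 by auto
    then show ?thesis by (auto simp: T)
  qed
  \<comment> \<open>Two different n in \<open>B j\<close> would make s and t^j agree on y and then
    on x. So each \<open>B j\<close> has at most one element, and only j < p - 1 matter because
    t^(p-1) is the identity on M.\<close>
  define B where "B j = {n. s (x + of_nat n * y) = (t ^^ j) (x + of_nat n * y)}" for j
  have "finite (B j)" for j
  proof -
    have "n = m" if "n \<in> B j" "m \<in> B j" for n m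
    proof -
      have eqs: "s x + of_nat n * s y = (t ^^ j) x + of_nat n * (t ^^ j) y"
        "s x + of_nat m * s y = (t ^^ j) x + of_nat m * (t ^^ j) y"
        using that hom[OF s(1)] hom[OF abs_gal_funpow[OF t(1)]] by (auto simp: B_def)
      then have "(of_nat n - of_nat m) * (s y - (t ^^ j) y) = 0"
        by Groebner_Basis.algebra
      then have "of_nat n - of_nat m = (0 :: 'a) \<or> s y = (t ^^ j) y"
        by simp
      moreover have "s y \<noteq> (t ^^ j) y"
        using ne[of j] eqs by auto
      ultimately show ?thesis by simp
    qed
    then have "B j \<subseteq> {SOME n. n \<in> B j}"
      by (metis someI singletonI subsetI)
    then show ?thesis
      by (rule finite_subset) simp
  qed
  then have "finite (\<Union>j<p - 1. B j)"
    by blast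
  then obtain n where n: "n \<notin> (\<Union>j<p - 1. B j)"
    using infinite_UNIV_nat by (metis UNIV_eq_I)
  define z where "z = x + of_nat n * y"
  have z: "z \<in> M"
    unfolding z_def using xy by (intro field_set_intros[OF field_set_M])
  have "s z \<noteq> (t ^^ j) z" for j
  proof -
    have "j mod (p - 1) < p - 1"
      using p_gt_1 by simp
    then have "s z \<noteq> (t ^^ (j mod (p - 1))) z"
      using n by (auto simp: B_def z_def)
    then show ?thesis
      using funpow_mod_eq[OF t_order[OF z]] by simp
  qed
  with z show ?thesis by blast
qed

end

end

theorem theorem2p11:
  fixes E :: "'k::field_char_0 weierstrass"
    and p g :: nat
    and S T :: "'k alg_closure point"
    and K L1 L2 M :: "'k alg_closure set"
    and \<zeta> \<beta> a :: "'k alg_closure"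
    and \<sigma> \<tau> :: "'k alg_closure \<Rightarrow> 'k alg_closure"
  assumes p: "Factorial_Ring.prime p" "odd p"
    and g: "residue_primroot p g"
    and E: "elliptic_curve E"
    and basis: "torsion_basis E p S T"
    and image: "galois_image E p S T = {((1, y), (0, x)) | x y. x \<in> {1..<p} \<and> y \<in> {0..<p}}"
    and K: "K = range to_ac"
    and M: "M = torsion_field E p"
    and \<zeta>: "\<zeta> ^ p = 1" "\<zeta> \<noteq> 1"
    and L1: "L1 = adjoin K {\<zeta>}"
    and \<sigma>: "\<sigma> \<in> gal M K" "map_point \<sigma> S = S" "map_point \<sigma> T = point_add (curve_ac E) S T"
    and \<tau>: "\<tau> \<in> gal M K" "map_point \<tau> S = S" "map_point \<tau> T = point_mult (curve_ac E) g T"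
    and L2: "L2 = {x \<in> M. \<tau> x = x}"
    and \<beta>: "\<beta> \<in> L1 - {0}" "\<exists>\<delta>. \<delta> ^ p = \<beta> \<and> M = adjoin L1 {\<delta>}"
    and a: "a \<in> K - {0}"
    and \<Delta>: "symbol_trivial L1 p (kummer_char p \<zeta> a) \<beta>"
  shows "(\<exists>\<xi>\<in>L2. field_norm L2 K \<xi> = a) \<and>
         (\<forall>\<xi>\<in>L2. field_norm L2 K \<xi> = a \<longrightarrow>
            (let b = \<Prod>i = 1..p - 1. (\<sigma> ^^ i) \<xi> ^ (p - i)
             in (pth_power_class p K a, pth_power_class p M b) \<in> pair_group K L1 M p g \<sigma> \<tau>))"
proof -
  obtain a1 a2 a3 a4 a6 where Eq: "E = Weierstrass a1 a2 a3 a4 a6"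
    by (cases E)
  have W: "curve_ac E = Weierstrass (to_ac a1) (to_ac a2) (to_ac a3) (to_ac a4) (to_ac a6)"
    by (simp add: Eq)
  let ?W = "Weierstrass (to_ac a1) (to_ac a2) (to_ac a3) (to_ac a4) (to_ac a6)"
  have "discriminant (curve_ac E) = to_ac (discriminant E)"
    unfolding Eq by (simp add: Let_def)
  then have disc: "discriminant (Weierstrass (to_ac a1) (to_ac a2) (to_ac a3) (to_ac a4) (to_ac a6)) \<noteq> 0"
    using E unfolding W elliptic_curve_def by simp
  interpret elliptic "to_ac a1" "to_ac a2" "to_ac a3" "to_ac a4" "to_ac a6"
    by unfold_locales (rule disc)
  have fieldK: "field_set K" and algK: "algebraic_over K"
    unfolding K by (rule field_set_range_to_ac, rule algebraic_over_range_to_ac)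
  have V: "torsion E p = {P. on_curve ?W P \<and> point_mult ?W p P = Infinity}"
    unfolding torsion_def W ..
  have ST: "S \<in> torsion E p" "T \<in> torsion E p"
    and bij: "bij_betw (\<lambda>(i, j). point_add ?W (point_mult ?W i S) (point_mult ?W j T)) ({..<p} \<times> {..<p}) (torsion E p)"
    using basis unfolding torsion_basis_def lin_comb_def W by auto
  have MK: "M = adjoin K (\<Union>P\<in>torsion E p. set_point P)"
    unfolding M torsion_field_def K ..
  have torsion_stable: "map_point \<rho> P \<in> torsion E p" if \<rho>: "\<rho> \<in> abs_gal K" and P: "P \<in> torsion E p" for \<rho> P
  proof -
    have \<rho>': "hom_on UNIV \<rho>" "\<rho> (to_ac a1) = to_ac a1" "\<rho> (to_ac a2) = to_ac a2" "\<rho> (to_ac a3) = to_ac a3"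
      "\<rho> (to_ac a4) = to_ac a4" "\<rho> (to_ac a6) = to_ac a6"
      using abs_gal_hom[OF \<rho>] abs_gal_fixes[OF \<rho>] unfolding K by auto
    show ?thesis
      using P on_map_point[OF \<rho>'] map_point_times[OF \<rho>', of p P, symmetric] by (simp add: V del: on_curve.simps)
  qed
  have span: "\<exists>i<p. \<exists>j<p. P = point_add ?W (point_mult ?W i S) (point_mult ?W j T)" if "P \<in> torsion E p" for P
  proof -
    have "P \<in> (\<lambda>(i, j). point_add ?W (point_mult ?W i S) (point_mult ?W j T)) ` ({..<p} \<times> {..<p})"
      using bij that by (simp add: bij_betw_def)
    then show ?thesis by auto
  qed
  \<comment> \<open>\<open>galois_image\<close> is a set of matrices with reduced entries.
    Coordinates of the images of S and T are taken from the basis first; the assumed shape of the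
    image then restricts them.\<close>
  have img: "map_point \<rho> S = S \<and> (\<exists>y x. 0 < x \<and> x < p \<and> map_point \<rho> T = point_add ?W (point_mult ?W y S) (point_mult ?W x T))"
    if \<rho>: "\<rho> \<in> abs_gal K" for \<rho>
  proof -
    obtain i j where ij: "i < p" "j < p" "map_point \<rho> S = point_add ?W (point_mult ?W i S) (point_mult ?W j T)"
      using span[OF torsion_stable[OF \<rho> ST(1)]] by blast
    obtain y x where yx: "y < p" "x < p" "map_point \<rho> T = point_add ?W (point_mult ?W y S) (point_mult ?W x T)"
      using span[OF torsion_stable[OF \<rho> ST(2)]] by blast
    have "((i, y), (j, x)) \<in> galois_image E p S T"
      using ij yx \<rho> unfolding galois_image_def lin_comb_def W K by auto
    then have "i = 1" "j = 0" "0 < x"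
      unfolding image by auto
    with ij(3) yx show ?thesis by auto
  qed
  note prime = p
  interpret torsion_data "to_ac a1" "to_ac a2" "to_ac a3" "to_ac a4" "to_ac a6" K M p g S T "torsion E p"
    by unfold_locales (use fieldK algK V p(1) g ST bij img MK in \<open>auto simp: K simp del: on_curve.simps\<close>)
  \<comment> \<open>\<sigma> and \<tau> are given on M only, while the lemmas on the action on
    points concern homomorphisms of the whole algebraic closure.\<close>
  have gal_ext: "\<exists>h\<in>abs_gal K. (\<forall>x\<in>M. h x = f x) \<and> map_point h T = map_point f T" if f: "f \<in> gal M K" for f
  proof -
    have "hom_on M f" "\<And>x. x \<in> K \<Longrightarrow> f x = x"
      using f by (auto simp: gal_iff)
    then obtain h where h: "h \<in> abs_gal K" "\<forall>x\<in>M. h x = f x"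
      using extend_abs_gal[OF fieldK algK K_subset_M field_set_M] by metis
    moreover have "map_point h T = map_point f T"
      using h(2) torsion_subset_M[OF ST(2)] by (intro point.map_cong) auto
    ultimately show ?thesis by blast
  qed
  obtain s where s: "s \<in> abs_gal K" "\<forall>x\<in>M. s x = \<sigma> x" "map_point s T = point_add ?W S T"
    using gal_ext[OF \<sigma>(1)] \<sigma>(3) unfolding W by auto
  obtain t where t: "t \<in> abs_gal K" "\<forall>x\<in>M. t x = \<tau> x" "map_point t T = point_mult ?W g T"
    using gal_ext[OF \<tau>(1)] \<tau>(3) unfolding W by auto
  obtain z where z: "z \<in> M" "\<And>j. s z \<noteq> (t ^^ j) z"
    using separating_element[OF s(1,3) t(1,3)] by blast
  obtain \<delta> where \<delta>: "\<delta> ^ p = \<beta>" "M = adjoin L1 {\<delta>}"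
    using \<beta>(2) by blast
  have \<beta>': "\<beta> \<in> L1" "\<beta> \<noteq> 0"
    using \<beta>(1) by auto
  have \<sigma>M: "hom_on M \<sigma>" "\<sigma> ` M \<subseteq> M" "\<And>x. x \<in> K \<Longrightarrow> \<sigma> x = x"
    using \<sigma>(1) by (auto simp: gal_iff bij_betw_def)
  have \<tau>M: "hom_on M \<tau>" "\<tau> ` M \<subseteq> M" "\<And>x. x \<in> K \<Longrightarrow> \<tau> x = x"
    using \<tau>(1) by (auto simp: gal_iff bij_betw_def)
  have s_pow: "(s ^^ n) x = (\<sigma> ^^ n) x" if "x \<in> M" for n x
    by (rule funpow_cong_on[OF \<sigma>M(2) _ that]) (use s(2) in blast)
  have t_pow: "(t ^^ n) x = (\<tau> ^^ n) x" if "x \<in> M" for n x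
    by (rule funpow_cong_on[OF \<tau>M(2) _ that]) (use t(2) in blast)
  interpret G: galois_data K L1 M p g \<sigma> \<tau> \<zeta> \<delta> \<beta> z
  proof
    show "coprime g p"
      by (rule coprime_g[OF s(1,3) t(1,3)])
    show "\<exists>i j. \<forall>x\<in>M. \<rho> x = (\<sigma> ^^ i) ((\<tau> ^^ j) x)" if "\<rho> \<in> abs_gal K" for \<rho>
      using s_t_generate[OF s(1,3) t(1,3) that] s_pow t_pow \<rho>_closed[OF abs_gal_funpow[OF t(1)]] by metis
    show "(\<sigma> ^^ p) x = x" if "x \<in> M" for x
      using s_order[OF s(1,3) t(1,3) that] s_pow[OF that] by simp
    show "(\<tau> ^^ (p - 1)) x = x" if "x \<in> M" for x
      using t_order[OF s(1,3) t(1,3) that] t_pow[OF that] by simp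
    show "\<sigma> (\<tau> x) = \<tau> ((\<sigma> ^^ g) x)" if "x \<in> M" for x
      using s_t_commute[OF s(1,3) t(1,3) that] s(2) t(2) s_pow[OF that] that
        \<rho>_closed[OF t(1) that] \<rho>_closed[OF abs_gal_funpow[OF s(1)] that] by metis
    show "\<sigma> z \<noteq> (\<tau> ^^ j) z" for j
      using z s(2) t_pow by metis
  qed (fact fieldK algK K_subset_M prime \<zeta> L1 \<delta> \<beta>' \<sigma>M \<tau>M z(1))+
  have L2: "L2 = G.L2"
    by (simp add: L2 G.L2_def)
  have aK: "a \<in> K" "a \<noteq> 0"
    using a by auto
  obtain \<xi> where "\<xi> \<in> L2" "field_norm L2 K \<xi> = a"
    using G.norm_from_L2[OF aK \<Delta>] G.field_norm_L2 unfolding L2 by metis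
  moreover have "(pth_power_class p K a, pth_power_class p M (\<Prod>i = 1..p - 1. (\<sigma> ^^ i) \<xi> ^ (p - i)))
      \<in> pair_group K L1 M p g \<sigma> \<tau>" if "\<xi> \<in> L2" "field_norm L2 K \<xi> = a" for \<xi>
  proof (rule G.pair_in_group[OF aK])
    show "\<xi> \<in> G.L2"
      using that(1) unfolding L2 .
    then show "G.conj_prod \<xi> = a"
      using that(2) G.field_norm_L2 unfolding L2 by simp
  qed
  ultimately show ?thesis
    unfolding Let_def by blast
qed

end
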